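(* Let $G$ be a finitely generated group with a word metric. Let $\phi:A\to G$ be a monomorphism of a subgroup $A$ of $G$, and let $G'$ be the corresponding HNN extension of $G$. If $G$ has the operator norm localization property, then $G'$ (with a word metric) has the operator norm localization property.
   Context: The HNN extension is $G'=\langle G,t \mid t a t^{-1}=\phi(a),\ a\in A\rangle$, with a word metric associated to a finite generating set. Operator norm localization: let $H$ be a separable infinite-dimensional Hilbert space. A Borel measure on a metric space is locally finite if bounded Borel sets have finite measure; positive measures are understood to be nonzero. For a positive locally finite Borel measure $\nu$ on a metric space $X$, a bounded operator $T$ on $L^2(X,\nu)\otimes H$ has propagation at most $r$ if $\langle T\varphi,\psi\rangle=0$ whenever $d(\mathrm{Supp}(\varphi),\mathrm{Supp}(\psi))>r$; $\mathcal{A}_r(X,\nu)$ is the set of such operators. $X$ has the operator norm localization property if there are $0<c\le 1$ and a non-decreasing $f:\mathbf{N}\to\mathbf{N}$ such that for every positive locally finite Borel measure $\nu$ on $X$, every $k\in\mathbf{N}$ and every $T\in\mathcal{A}_k(X,\nu)$ there is a nonzero $\varphi\in L^2(X,\nu)\otimes H$ with $\mathrm{Diam}(\mathrm{Supp}(\varphi))\le f(k)$ and $\|T\varphi\|\ge c\|T\|\|\varphi\|$. *)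

theory Defs
  imports "HOL-Analysis.Analysis" "HOL-Algebra.Generated_Groups"
begin

section \<open>Complex Hilbert spaces\<close>

text \<open>The inner product is linear in the first argument; the norm and the topology are those of
  the underlying real inner product space, whose inner product is the real part of \<open>cinner\<close>.\<close>

class complex_hilbert_space = real_inner + complete_space +
  fixes scaleC :: "complex \<Rightarrow> 'a \<Rightarrow> 'a"  (infixr \<open>*\<^sub>C\<close> 75)
    and cinner :: "'a \<Rightarrow> 'a \<Rightarrow> complex"
  assumes scaleC_of_real: "complex_of_real r *\<^sub>C x = scaleR r x"
    and scaleC_add_right: "a *\<^sub>C (x + y) = a *\<^sub>C x + a *\<^sub>C y"
    and scaleC_add_left: "(a + b) *\<^sub>C x = a *\<^sub>C x + b *\<^sub>C x"
    and scaleC_scaleC: "a *\<^sub>C (b *\<^sub>C x) = (a * b) *\<^sub>C x"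
    and cinner_add_left: "cinner (x + y) z = cinner x z + cinner y z"
    and cinner_scaleC_left: "cinner (a *\<^sub>C x) y = a * cinner x y"
    and cinner_commute: "cinner x y = cnj (cinner y x)"
    and Re_cinner: "Re (cinner x y) = inner x y"

instantiation complex :: complex_hilbert_space
begin
definition scaleC_complex :: "complex \<Rightarrow> complex \<Rightarrow> complex" where "scaleC_complex a x = a * x"
definition cinner_complex :: "complex \<Rightarrow> complex \<Rightarrow> complex" where "cinner_complex x y = x * cnj y"
instance
  by standard
    (auto simp: scaleC_complex_def cinner_complex_def inner_complex_def scaleR_conv_of_real
      algebra_simps)
end


section \<open>Operators on \<open>L\<^sup>2(X,\<nu>) \<otimes> H\<close>\<close>

text \<open>\<open>L\<^sup>2(X,\<nu>) \<otimes> H\<close> is realised as \<open>L\<^sup>2(X,\<nu>;H)\<close>. Since a type cannot depend on \<open>\<nu>\<close>, its elements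
  are represented by functions, two functions being identified when they agree \<open>\<nu>\<close>-almost
  everywhere. As \<open>H\<close> will be second countable, Borel measurability of \<open>H\<close>-valued functions is the
  same as strong measurability.\<close>

definition L2 :: "'a measure \<Rightarrow> ('a \<Rightarrow> 'h::complex_hilbert_space) set" where
  "L2 \<nu> = {\<phi> \<in> borel_measurable \<nu>. integrable \<nu> (\<lambda>x. (norm (\<phi> x))\<^sup>2)}"

definition L2_norm :: "'a measure \<Rightarrow> ('a \<Rightarrow> 'h::complex_hilbert_space) \<Rightarrow> real" where
  "L2_norm \<nu> \<phi> = sqrt (LINT x|\<nu>. (norm (\<phi> x))\<^sup>2)"

definition L2_inner ::
  "'a measure \<Rightarrow> ('a \<Rightarrow> 'h::complex_hilbert_space) \<Rightarrow> ('a \<Rightarrow> 'h) \<Rightarrow> complex" where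
  "L2_inner \<nu> \<phi> \<psi> = (LINT x|\<nu>. cinner (\<phi> x) (\<psi> x))"

text \<open>A bounded operator is given by a map on representatives that respects almost everywhere
  equality.\<close>

definition L2_bounded_operator ::
  "'a measure \<Rightarrow> (('a \<Rightarrow> 'h::complex_hilbert_space) \<Rightarrow> ('a \<Rightarrow> 'h)) \<Rightarrow> bool" where
  "L2_bounded_operator \<nu> T \<longleftrightarrow>
     (\<forall>\<phi>\<in>L2 \<nu>. T \<phi> \<in> L2 \<nu>) \<and>
     (\<forall>\<phi>\<in>L2 \<nu>. \<forall>\<psi>\<in>L2 \<nu>. (AE x in \<nu>. \<phi> x = \<psi> x) \<longrightarrow> (AE x in \<nu>. T \<phi> x = T \<psi> x)) \<and>
     (\<forall>\<phi>\<in>L2 \<nu>. \<forall>\<psi>\<in>L2 \<nu>. AE x in \<nu>. T (\<lambda>y. \<phi> y + \<psi> y) x = T \<phi> x + T \<psi> x) \<and>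
     (\<forall>a. \<forall>\<phi>\<in>L2 \<nu>. AE x in \<nu>. T (\<lambda>y. a *\<^sub>C \<phi> y) x = a *\<^sub>C T \<phi> x) \<and>
     (\<exists>C. \<forall>\<phi>\<in>L2 \<nu>. L2_norm \<nu> (T \<phi>) \<le> C * L2_norm \<nu> \<phi>)"

definition L2_operator_norm ::
  "'a measure \<Rightarrow> (('a \<Rightarrow> 'h::complex_hilbert_space) \<Rightarrow> ('a \<Rightarrow> 'h)) \<Rightarrow> real" where
  "L2_operator_norm \<nu> T = (SUP \<phi>\<in>{\<phi> \<in> L2 \<nu>. L2_norm \<nu> \<phi> \<le> 1}. L2_norm \<nu> (T \<phi>))"


section \<open>Operator norm localization\<close>

text \<open>Distances between sets and diameters take values in \<open>[0,\<infinity>]\<close>; the distance to the empty set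
  is \<open>\<infinity>\<close> and the diameter of the empty set is \<open>0\<close>.\<close>

definition set_distance :: "'a metric \<Rightarrow> 'a set \<Rightarrow> 'a set \<Rightarrow> ennreal" where
  "set_distance m P Q = (INF x\<in>P. INF y\<in>Q. ennreal (mdist m x y))"

definition set_diameter :: "'a metric \<Rightarrow> 'a set \<Rightarrow> ennreal" where
  "set_diameter m P = (SUP x\<in>P. SUP y\<in>P. ennreal (mdist m x y))"

definition locally_finite_borel_measure :: "'a metric \<Rightarrow> 'a measure \<Rightarrow> bool" where
  "locally_finite_borel_measure m \<nu> \<longleftrightarrow>
     space \<nu> = mspace m \<and>
     sets \<nu> = sigma_sets (mspace m) {U. openin (mtopology_of m) U} \<and>
     (\<forall>B\<in>sets \<nu>. Metric_space.mbounded (mspace m) (mdist m) B \<longrightarrow> emeasure \<nu> B < \<infinity>)"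

text \<open>The essential (closed) support, which depends only on the almost everywhere class.\<close>

definition L2_support :: "'a metric \<Rightarrow> 'a measure \<Rightarrow> ('a \<Rightarrow> 'h::complex_hilbert_space) \<Rightarrow> 'a set" where
  "L2_support m \<nu> \<phi> =
     {x \<in> mspace m. \<forall>U. openin (mtopology_of m) U \<and> x \<in> U \<longrightarrow>
        \<not> (AE y in \<nu>. y \<in> U \<longrightarrow> \<phi> y = 0)}"

definition propagation_operators ::
  "'a metric \<Rightarrow> 'a measure \<Rightarrow> real \<Rightarrow> (('a \<Rightarrow> 'h::complex_hilbert_space) \<Rightarrow> ('a \<Rightarrow> 'h)) set" where
  "propagation_operators m \<nu> r =
     {T. L2_bounded_operator \<nu> T \<and>
         (\<forall>\<phi>\<in>L2 \<nu>. \<forall>\<psi>\<in>L2 \<nu>.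
            set_distance m (L2_support m \<nu> \<phi>) (L2_support m \<nu> \<psi>) > ennreal r \<longrightarrow>
            L2_inner \<nu> (T \<phi>) \<psi> = 0)}"

text \<open>The first argument specifies the Hilbert space \<open>H\<close>.\<close>

definition operator_norm_localization ::
  "'h::{complex_hilbert_space, second_countable_topology} itself \<Rightarrow> 'a metric \<Rightarrow> bool" where
  "operator_norm_localization _ m \<longleftrightarrow>
     (\<exists>(c::real) (f::nat \<Rightarrow> nat). 0 < c \<and> c \<le> 1 \<and> mono f \<and>
        (\<forall>\<nu>. locally_finite_borel_measure m \<nu> \<and> emeasure \<nu> (space \<nu>) \<noteq> 0 \<longrightarrow>
          (\<forall>(k::nat) (T :: ('a \<Rightarrow> 'h) \<Rightarrow> ('a \<Rightarrow> 'h)). T \<in> propagation_operators m \<nu> (real k) \<longrightarrow>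
             (\<exists>\<phi>\<in>L2 \<nu>. \<not> (AE x in \<nu>. \<phi> x = 0) \<and>
                set_diameter m (L2_support m \<nu> \<phi>) \<le> of_nat (f k) \<and>
                L2_norm \<nu> (T \<phi>) \<ge> c * L2_operator_norm \<nu> T * L2_norm \<nu> \<phi>))))"


section \<open>Word metrics\<close>

definition finite_generating_set :: "('a, 'b) monoid_scheme \<Rightarrow> 'a set \<Rightarrow> bool" where
  "finite_generating_set G S \<longleftrightarrow> finite S \<and> S \<subseteq> carrier G \<and> generate G S = carrier G"

definition word_length :: "('a, 'b) monoid_scheme \<Rightarrow> 'a set \<Rightarrow> 'a \<Rightarrow> nat" where
  "word_length G S g =
     (LEAST n. \<exists>w. length w = n \<and> set w \<subseteq> S \<union> m_inv G ` S \<and> foldr (mult G) w \<one>\<^bsub>G\<^esub> = g)"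

text \<open>The value outside the carrier is irrelevant; it only makes the function symmetric everywhere,
  as \<open>Metric_space\<close> requires.\<close>

definition word_dist :: "('a, 'b) monoid_scheme \<Rightarrow> 'a set \<Rightarrow> 'a \<Rightarrow> 'a \<Rightarrow> real" where
  "word_dist G S g h =
     (if g \<in> carrier G \<and> h \<in> carrier G then real (word_length G S (inv\<^bsub>G\<^esub> g \<otimes>\<^bsub>G\<^esub> h)) else 0)"

definition word_metric :: "('a, 'b) monoid_scheme \<Rightarrow> 'a set \<Rightarrow> 'a metric" where
  "word_metric G S = metric (carrier G, word_dist G S)"

context group
begin

lemma foldr_mult_closed: "set w \<subseteq> carrier G \<Longrightarrow> foldr (mult G) w \<one> \<in> carrier G"
  by (induction w) auto

lemma foldr_mult_append:
  "set u \<subseteq> carrier G \<Longrightarrow> set v \<subseteq> carrier G \<Longrightarrow>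
    foldr (mult G) (u @ v) \<one> = foldr (mult G) u \<one> \<otimes> foldr (mult G) v \<one>"
  by (induction u) (auto simp: m_assoc foldr_mult_closed)

lemma foldr_mult_inv:
  "set w \<subseteq> carrier G \<Longrightarrow>
    foldr (mult G) (rev (map (m_inv G) w)) \<one> = inv (foldr (mult G) w \<one>)"
proof (induction w)
  case (Cons a w)
  have *: "set (rev (map (m_inv G) w)) \<subseteq> carrier G" using Cons.prems by auto
  show ?case
    using Cons foldr_mult_append[OF *, of "[inv a]"]
    by (simp add: inv_mult_group foldr_mult_closed)
qed simp

lemma generate_words:
  assumes S: "S \<subseteq> carrier G" and g: "g \<in> generate G S"
  shows "\<exists>w. set w \<subseteq> S \<union> m_inv G ` S \<and> foldr (mult G) w \<one> = g"
  using g
proof (induction rule: generate.induct)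
  case one
  show ?case by (rule exI[of _ "[]"]) simp
next
  case (incl h)
  then show ?case using S by (intro exI[of _ "[h]"]) auto
next
  case (inv h)
  then show ?case using S by (intro exI[of _ "[inv h]"]) auto
next
  case (eng h1 h2)
  then obtain u v where uv: "set u \<subseteq> S \<union> m_inv G ` S" "foldr (mult G) u \<one> = h1"
    "set v \<subseteq> S \<union> m_inv G ` S" "foldr (mult G) v \<one> = h2" by blast
  have "S \<union> m_inv G ` S \<subseteq> carrier G" using S by auto
  then show ?case using uv foldr_mult_append[of u v] by (intro exI[of _ "u @ v"]) auto
qed

lemma word_length_witness:
  assumes "finite_generating_set G S" "g \<in> carrier G"
  obtains w where "length w = word_length G S g" "set w \<subseteq> S \<union> m_inv G ` S"
    "foldr (mult G) w \<one> = g"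
proof -
  have "\<exists>w. set w \<subseteq> S \<union> m_inv G ` S \<and> foldr (mult G) w \<one> = g"
    using assms generate_words by (auto simp: finite_generating_set_def)
  then have "\<exists>n w. length w = n \<and> set w \<subseteq> S \<union> m_inv G ` S \<and> foldr (mult G) w \<one> = g" by blast
  from LeastI_ex[OF this] show thesis unfolding word_length_def[symmetric] using that by blast
qed

lemma word_length_le:
  "set w \<subseteq> S \<union> m_inv G ` S \<Longrightarrow> foldr (mult G) w \<one> = g \<Longrightarrow> word_length G S g \<le> length w"
  unfolding word_length_def by (rule Least_le) blast

lemma word_length_inv_le:
  assumes S: "finite_generating_set G S" and g: "g \<in> carrier G"
  shows "word_length G S (inv g) \<le> word_length G S g"
proof -
  obtain w where w: "length w = word_length G S g" "set w \<subseteq> S \<union> m_inv G ` S"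
    "foldr (mult G) w \<one> = g" using word_length_witness[OF S g] .
  have Sc: "S \<subseteq> carrier G" using S by (simp add: finite_generating_set_def)
  have sub: "S \<union> m_inv G ` S \<subseteq> carrier G" using Sc by auto
  have inv_sub: "inv x \<in> S \<union> m_inv G ` S" if "x \<in> S \<union> m_inv G ` S" for x
    using that
  proof
    assume "x \<in> m_inv G ` S"
    then obtain y where "y \<in> S" "x = inv y" by blast
    then show ?thesis using Sc by (simp add: subset_iff)
  qed simp
  have "set (rev (map (m_inv G) w)) \<subseteq> S \<union> m_inv G ` S" using w(2) inv_sub by auto
  moreover have "foldr (mult G) (rev (map (m_inv G) w)) \<one> = inv g"
    using w sub foldr_mult_inv[of w] by auto
  ultimately show ?thesis using word_length_le[of "rev (map (m_inv G) w)" S "inv g"] w(1) by simp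
qed

lemma word_length_mult_le:
  assumes S: "finite_generating_set G S" and g: "g \<in> carrier G" and h: "h \<in> carrier G"
  shows "word_length G S (g \<otimes> h) \<le> word_length G S g + word_length G S h"
proof -
  obtain u where u: "length u = word_length G S g" "set u \<subseteq> S \<union> m_inv G ` S"
    "foldr (mult G) u \<one> = g" using word_length_witness[OF S g] .
  obtain v where v: "length v = word_length G S h" "set v \<subseteq> S \<union> m_inv G ` S"
    "foldr (mult G) v \<one> = h" using word_length_witness[OF S h] .
  have "S \<union> m_inv G ` S \<subseteq> carrier G" using S by (auto simp: finite_generating_set_def)
  then have "foldr (mult G) (u @ v) \<one> = g \<otimes> h"
    using foldr_mult_append[of u v] u v by auto
  then show ?thesis using word_length_le[of "u @ v" S "g \<otimes> h"] u v by simp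
qed

lemma word_length_eq_0_iff:
  assumes S: "finite_generating_set G S" and g: "g \<in> carrier G"
  shows "word_length G S g = 0 \<longleftrightarrow> g = \<one>"
proof
  assume "word_length G S g = 0"
  then show "g = \<one>" using word_length_witness[OF S g] by (metis foldr_Nil id_apply length_0_conv)
next
  assume "g = \<one>"
  then show "word_length G S g = 0" using word_length_le[of "[]" S g] by simp
qed

lemma Metric_space_word_dist:
  assumes S: "finite_generating_set G S"
  shows "Metric_space (carrier G) (word_dist G S)"
proof
  fix x y
  show "0 \<le> word_dist G S x y" by (simp add: word_dist_def)
  show "word_dist G S x y = word_dist G S y x"
  proof (cases "x \<in> carrier G \<and> y \<in> carrier G")
    case True
    then have "inv (inv x \<otimes> y) = inv y \<otimes> x" "inv (inv y \<otimes> x) = inv x \<otimes> y"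
      by (simp_all add: inv_mult_group)
    then show ?thesis
      using True word_length_inv_le[OF S, of "inv x \<otimes> y"] word_length_inv_le[OF S, of "inv y \<otimes> x"]
      by (simp add: word_dist_def)
  qed (auto simp: word_dist_def)
next
  fix x y assume xy: "x \<in> carrier G" "y \<in> carrier G"
  have "inv x \<otimes> y = \<one> \<longleftrightarrow> x = y"
    using xy inv_solve_left'[of \<one> x y] by auto
  then show "word_dist G S x y = 0 \<longleftrightarrow> x = y"
    using xy word_length_eq_0_iff[OF S, of "inv x \<otimes> y"] by (simp add: word_dist_def)
next
  fix x y z assume xyz: "x \<in> carrier G" "y \<in> carrier G" "z \<in> carrier G"
  have "y \<otimes> (inv y \<otimes> z) = z"
    using xyz m_assoc[of y "inv y" z] by simp
  then have "inv x \<otimes> z = (inv x \<otimes> y) \<otimes> (inv y \<otimes> z)"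
    using xyz m_assoc[of "inv x" y "inv y \<otimes> z"] by simp
  then show "word_dist G S x z \<le> word_dist G S x y + word_dist G S y z"
    using xyz word_length_mult_le[OF S, of "inv x \<otimes> y" "inv y \<otimes> z"] by (simp add: word_dist_def)
qed

lemma mspace_word_metric: "finite_generating_set G S \<Longrightarrow> mspace (word_metric G S) = carrier G"
  by (simp add: word_metric_def Metric_space.mspace_metric Metric_space_word_dist)

lemma mdist_word_metric: "finite_generating_set G S \<Longrightarrow> mdist (word_metric G S) = word_dist G S"
  by (simp add: word_metric_def Metric_space.mdist_metric Metric_space_word_dist)

end


section \<open>HNN extensions\<close>

text \<open>The group presented by \<open>\<langle>G, t | t a t\<^sup>-\<^sup>1 = \<theta>(a), a \<in> A\<rangle>\<close>: words in the elements of \<open>G\<close>, \<open>t\<close> and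
  \<open>t\<^sup>-\<^sup>1\<close> modulo the congruence generated by the multiplication table of \<open>G\<close>, the two
  cancellations of \<open>t\<close> against \<open>t\<^sup>-\<^sup>1\<close>, and the displayed relations.\<close>

datatype 'a hnn_letter = Base 'a | Stable | Stable_inv

definition hnn_words :: "('a, 'b) monoid_scheme \<Rightarrow> 'a hnn_letter list set" where
  "hnn_words G = lists (Base ` carrier G \<union> {Stable, Stable_inv})"

inductive hnn_relator ::
  "('a, 'b) monoid_scheme \<Rightarrow> 'a set \<Rightarrow> ('a \<Rightarrow> 'a) \<Rightarrow> 'a hnn_letter list \<Rightarrow> 'a hnn_letter list \<Rightarrow> bool"
  for G A \<theta> where
  "hnn_relator G A \<theta> [Base \<one>\<^bsub>G\<^esub>] []"
| "g \<in> carrier G \<Longrightarrow> h \<in> carrier G \<Longrightarrow> hnn_relator G A \<theta> [Base g, Base h] [Base (g \<otimes>\<^bsub>G\<^esub> h)]"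
| "hnn_relator G A \<theta> [Stable, Stable_inv] []"
| "hnn_relator G A \<theta> [Stable_inv, Stable] []"
| "a \<in> A \<Longrightarrow> hnn_relator G A \<theta> [Stable, Base a, Stable_inv] [Base (\<theta> a)]"

inductive_set hnn_congruence ::
  "('a, 'b) monoid_scheme \<Rightarrow> 'a set \<Rightarrow> ('a \<Rightarrow> 'a) \<Rightarrow> ('a hnn_letter list \<times> 'a hnn_letter list) set"
  for G A \<theta> where
  refl: "w \<in> hnn_words G \<Longrightarrow> (w, w) \<in> hnn_congruence G A \<theta>"
| sym: "(v, w) \<in> hnn_congruence G A \<theta> \<Longrightarrow> (w, v) \<in> hnn_congruence G A \<theta>"
| trans: "(u, v) \<in> hnn_congruence G A \<theta> \<Longrightarrow> (v, w) \<in> hnn_congruence G A \<theta> \<Longrightarrow>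
    (u, w) \<in> hnn_congruence G A \<theta>"
| relator: "hnn_relator G A \<theta> l r \<Longrightarrow> p @ l @ s \<in> hnn_words G \<Longrightarrow> p @ r @ s \<in> hnn_words G \<Longrightarrow>
    (p @ l @ s, p @ r @ s) \<in> hnn_congruence G A \<theta>"

definition HNN :: "('a, 'b) monoid_scheme \<Rightarrow> 'a set \<Rightarrow> ('a \<Rightarrow> 'a) \<Rightarrow> 'a hnn_letter list set monoid" where
  "HNN G A \<theta> =
     \<lparr>carrier = hnn_words G // hnn_congruence G A \<theta>,
      monoid.mult = (\<lambda>X Y. \<Union>x\<in>X. \<Union>y\<in>Y. hnn_congruence G A \<theta> `` {x @ y}),
      one = hnn_congruence G A \<theta> `` {[]}\<rparr>"

lemma hnn_words_append [simp]:
  "u @ v \<in> hnn_words G \<longleftrightarrow> u \<in> hnn_words G \<and> v \<in> hnn_words G"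
  by (auto simp: hnn_words_def)

lemma hnn_words_Nil [simp]: "[] \<in> hnn_words G"
  by (simp add: hnn_words_def)

lemma hnn_congruence_words:
  "(v, w) \<in> hnn_congruence G A \<theta> \<Longrightarrow> v \<in> hnn_words G \<and> w \<in> hnn_words G"
  by (induction rule: hnn_congruence.induct) auto

lemma equiv_hnn_congruence: "equiv (hnn_words G) (hnn_congruence G A \<theta>)"
proof (rule equivI)
  show "hnn_congruence G A \<theta> \<subseteq> hnn_words G \<times> hnn_words G"
    using hnn_congruence_words by fast
  show "refl_on (hnn_words G) (hnn_congruence G A \<theta>)"
    by (simp add: refl_on_def hnn_congruence.refl)
  show "Relation.sym (hnn_congruence G A \<theta>)"
    by (rule symI) (rule hnn_congruence.sym)
  show "Relation.trans (hnn_congruence G A \<theta>)"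
    by (rule transI) (rule hnn_congruence.trans)
qed

lemma hnn_congruence_context:
  assumes "(v, w) \<in> hnn_congruence G A \<theta>" "p \<in> hnn_words G" "s \<in> hnn_words G"
  shows "(p @ v @ s, p @ w @ s) \<in> hnn_congruence G A \<theta>"
  using assms
proof (induction rule: hnn_congruence.induct)
  case (relator l r p' s')
  then show ?case
    using hnn_congruence.relator[of G A \<theta> l r "p @ p'" "s' @ s"] by simp
next
  case (refl w)
  then show ?case by (simp add: hnn_congruence.refl)
next
  case (sym v w)
  then show ?case by (simp add: hnn_congruence.sym)
next
  case (trans u v w)
  then show ?case by (metis hnn_congruence.trans)
qed

lemma hnn_congruence_append:
  assumes "(u, u') \<in> hnn_congruence G A \<theta>" "(v, v') \<in> hnn_congruence G A \<theta>"
  shows "(u @ v, u' @ v') \<in> hnn_congruence G A \<theta>"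
proof (rule hnn_congruence.trans)
  show "(u @ v, u' @ v) \<in> hnn_congruence G A \<theta>"
    using hnn_congruence_context[OF assms(1), of "[]" v] hnn_congruence_words[OF assms(2)] by simp
  show "(u' @ v, u' @ v') \<in> hnn_congruence G A \<theta>"
    using hnn_congruence_context[OF assms(2), of u' "[]"] hnn_congruence_words[OF assms(1)] by simp
qed

lemma congruent2_hnn_append:
  "congruent2 (hnn_congruence G A \<theta>) (hnn_congruence G A \<theta>) (\<lambda>x y. hnn_congruence G A \<theta> `` {x @ y})"
  by (auto simp: congruent2_def intro!: equiv_class_eq[OF equiv_hnn_congruence] hnn_congruence_append)

lemma HNN_mult_class:
  "u \<in> hnn_words G \<Longrightarrow> v \<in> hnn_words G \<Longrightarrow>
    hnn_congruence G A \<theta> `` {u} \<otimes>\<^bsub>HNN G A \<theta>\<^esub> hnn_congruence G A \<theta> `` {v} = hnn_congruence G A \<theta> `` {u @ v}"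
  by (simp add: HNN_def
      UN_equiv_class2[OF equiv_hnn_congruence equiv_hnn_congruence congruent2_hnn_append])

lemma HNN_carrierE:
  assumes "X \<in> carrier (HNN G A \<theta>)"
  obtains w where "w \<in> hnn_words G" "X = hnn_congruence G A \<theta> `` {w}"
  using assms by (auto simp: HNN_def quotient_def)

lemma HNN_class_in_carrier: "w \<in> hnn_words G \<Longrightarrow> hnn_congruence G A \<theta> `` {w} \<in> carrier (HNN G A \<theta>)"
  by (auto simp: HNN_def quotient_def)

lemma hnn_word_left_inverse:
  assumes "group G" "w \<in> hnn_words G"
  shows "\<exists>v\<in>hnn_words G. (v @ w, []) \<in> hnn_congruence G A \<theta>"
  using assms(2)
proof (induction w)
  case Nil
  show ?case by (rule bexI[of _ "[]"]) (simp_all add: hnn_congruence.refl)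
next
  case (Cons x w)
  interpret group G by fact
  have w: "w \<in> hnn_words G" and x: "[x] \<in> hnn_words G"
    using Cons.prems by (auto simp: hnn_words_def)
  obtain v where v: "v \<in> hnn_words G" "(v @ w, []) \<in> hnn_congruence G A \<theta>"
    using Cons.IH w by blast
  have "\<exists>y. [y] \<in> hnn_words G \<and> ([y, x], []) \<in> hnn_congruence G A \<theta>"
  proof (cases x)
    case (Base g)
    then have g: "g \<in> carrier G" using x by (auto simp: hnn_words_def)
    have "([Base (inv\<^bsub>G\<^esub> g), Base g], [Base \<one>\<^bsub>G\<^esub>]) \<in> hnn_congruence G A \<theta>"
      using hnn_congruence.relator[OF hnn_relator.intros(2)[of "inv\<^bsub>G\<^esub> g" G g A \<theta>], of "[]" "[]"] g
      by (simp add: hnn_words_def)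
    moreover have "([Base \<one>\<^bsub>G\<^esub>], []) \<in> hnn_congruence G A \<theta>"
      using hnn_congruence.relator[OF hnn_relator.intros(1)[of G A \<theta>], of "[]" "[]"]
      by (simp add: hnn_words_def)
    ultimately have "([Base (inv\<^bsub>G\<^esub> g), Base g], []) \<in> hnn_congruence G A \<theta>"
      by (rule hnn_congruence.trans)
    then show ?thesis
      unfolding Base using g by (intro exI[of _ "Base (inv\<^bsub>G\<^esub> g)"]) (simp add: hnn_words_def)
  next
    case Stable
    then show ?thesis
      using hnn_congruence.relator[OF hnn_relator.intros(4)[of G A \<theta>], of "[]" "[]"]
      by (intro exI[of _ Stable_inv]) (simp add: hnn_words_def)
  next
    case Stable_inv
    then show ?thesis
      using hnn_congruence.relator[OF hnn_relator.intros(3)[of G A \<theta>], of "[]" "[]"]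
      by (intro exI[of _ Stable]) (simp add: hnn_words_def)
  qed
  then obtain y where y: "[y] \<in> hnn_words G" "([y, x], []) \<in> hnn_congruence G A \<theta>" by blast
  have "(v @ [y, x] @ w, v @ [] @ w) \<in> hnn_congruence G A \<theta>"
    by (rule hnn_congruence_context[OF y(2) v(1) w])
  then have "((v @ [y]) @ x # w, []) \<in> hnn_congruence G A \<theta>"
    using hnn_congruence.trans[of "v @ y # x # w"] v(2) by simp
  then show ?case using v(1) y(1) by (intro bexI[of _ "v @ [y]"]) auto
qed

lemma group_HNN:
  assumes "group G"
  shows "group (HNN G A \<theta>)"
proof (rule groupI)
  have one: "\<one>\<^bsub>HNN G A \<theta>\<^esub> = hnn_congruence G A \<theta> `` {[]}" by (simp add: HNN_def)
  show "\<one>\<^bsub>HNN G A \<theta>\<^esub> \<in> carrier (HNN G A \<theta>)" by (simp add: one HNN_class_in_carrier)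
  fix X assume "X \<in> carrier (HNN G A \<theta>)"
  then obtain x where x: "x \<in> hnn_words G" "X = hnn_congruence G A \<theta> `` {x}" by (rule HNN_carrierE)
  show "\<one>\<^bsub>HNN G A \<theta>\<^esub> \<otimes>\<^bsub>HNN G A \<theta>\<^esub> X = X" by (simp add: one x HNN_mult_class)
  obtain v where v: "v \<in> hnn_words G" "(v @ x, []) \<in> hnn_congruence G A \<theta>"
    using hnn_word_left_inverse[OF assms x(1)] by blast
  then show "\<exists>Y\<in>carrier (HNN G A \<theta>). Y \<otimes>\<^bsub>HNN G A \<theta>\<^esub> X = \<one>\<^bsub>HNN G A \<theta>\<^esub>"
    using x equiv_class_eq[OF equiv_hnn_congruence v(2)]
    by (intro bexI[of _ "hnn_congruence G A \<theta> `` {v}"])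
      (auto simp: one HNN_mult_class HNN_class_in_carrier)
  fix Y assume "Y \<in> carrier (HNN G A \<theta>)"
  then obtain y where y: "y \<in> hnn_words G" "Y = hnn_congruence G A \<theta> `` {y}" by (rule HNN_carrierE)
  show "X \<otimes>\<^bsub>HNN G A \<theta>\<^esub> Y \<in> carrier (HNN G A \<theta>)"
    by (simp add: x y HNN_mult_class HNN_class_in_carrier)
  fix Z assume "Z \<in> carrier (HNN G A \<theta>)"
  then obtain z where z: "z \<in> hnn_words G" "Z = hnn_congruence G A \<theta> `` {z}" by (rule HNN_carrierE)
  show "X \<otimes>\<^bsub>HNN G A \<theta>\<^esub> Y \<otimes>\<^bsub>HNN G A \<theta>\<^esub> Z = X \<otimes>\<^bsub>HNN G A \<theta>\<^esub> (Y \<otimes>\<^bsub>HNN G A \<theta>\<^esub> Z)"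
    by (simp add: x y z HNN_mult_class)
qed

end

(*
  Operator norm localization is equivalent to a statement about finite complex matrices indexed by finite sets over the
  space, with multiplicities (matrix_localization). In this form it passes from G to the HNN
  extension through the Bass-Serre tree, whose vertices are the left cosets of G. Normal forms
  give the tree concretely: a coset is a reduced list, and its ancestors are the tails of the list.

  At a given scale R, cut the tree into slabs of N consecutive levels and assign each group element
  to its highest ancestor coset within its slab at distance at most s. A move of length R changes
  the assigned coset only near a slab boundary or when one of at most N distances crosses s;
  averaging over the position of the slabs and over s loses at most half of the mass of a vector.
  The remaining pieces are R-separated and lie in bounded neighbourhoods of cosets of G, so that the
  localization of G applies on each of them with the same constant.
*)

theory Submission
  imports Defs
begin

section \<open>Finite orthonormal families\<close>

text \<open>A piece cut out by distance in the tree alone need not lie near one coset: the elements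
  \<open>t h\<close> with \<open>h\<close> in \<open>G\<close> have vertices one edge away from the
  base vertex, yet may be arbitrarily far from \<open>G\<close>. This is why distances to cosets,
  measured in the group, enter through \<open>s\<close>. Without slabs the number of ancestors grows
  with the depth and counting the bad thresholds gives no uniform bound; a slab leaves at most
  \<open>N\<close> ancestors, each bad for at most \<open>2 * R\<close> thresholds.

  The mass that is averaged is that of \<open>t u\<close>, not of \<open>u\<close>. A piece of the
  output depends only on the inputs within \<open>k\<close> of it, so the scale
  \<open>R = 2 * k\<close> makes these sets of inputs disjoint. Their squared norms add up to at
  most that of \<open>u\<close>, and some piece attains half of the original quotient.

  Passing to a coset changes the scale, since \<open>G\<close> may be distorted in its extension.
  This costs nothing, because the localization constant is the same at all scales. Moving points
  onto a coset may identify some of them, which is why the matrices carry multiplicities.\<close>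

lemma cinner_add_right:
  fixes x y z :: "'h::complex_hilbert_space"
  shows "cinner x (y + z) = cinner x y + cinner x z"
  by (metis cinner_add_left cinner_commute complex_cnj_add)

lemma cinner_scaleC_right:
  fixes x y :: "'h::complex_hilbert_space"
  shows "cinner x (a *\<^sub>C y) = cnj a * cinner x y"
  by (metis cinner_commute cinner_scaleC_left complex_cnj_mult)

lemma scaleC_zero_left [simp]: "0 *\<^sub>C (x::'h::complex_hilbert_space) = 0"
  using scaleC_of_real[of 0 x] by simp

lemma scaleC_one [simp]: "1 *\<^sub>C (x::'h::complex_hilbert_space) = x"
  using scaleC_of_real[of 1 x] by simp

lemma scaleC_zero_right [simp]: "a *\<^sub>C (0::'h::complex_hilbert_space) = 0"
  using scaleC_add_right[of a "0::'h" 0] by simp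

lemma cinner_zero_left [simp]: "cinner (0::'h::complex_hilbert_space) x = 0"
  using cinner_add_left[of "0::'h" 0 x] by simp

lemma cinner_zero_right [simp]: "cinner (x::'h::complex_hilbert_space) 0 = 0"
  using cinner_add_right[of x 0 0] by simp

lemma cinner_diff_left:
  fixes x y z :: "'h::complex_hilbert_space"
  shows "cinner (x - y) z = cinner x z - cinner y z"
  using cinner_add_left[of "x - y" y z] by simp

lemma cinner_sum_left: "cinner (\<Sum>i\<in>I. f i) (x::'h::complex_hilbert_space) = (\<Sum>i\<in>I. cinner (f i) x)"
  by (induction I rule: infinite_finite_induct) (auto simp: cinner_add_left)

lemma cinner_sum_right: "cinner (x::'h::complex_hilbert_space) (\<Sum>i\<in>I. f i) = (\<Sum>i\<in>I. cinner x (f i))"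
  by (induction I rule: infinite_finite_induct) (auto simp: cinner_add_right)

lemma scaleC_sum_right: "a *\<^sub>C (\<Sum>i\<in>I. f i) = (\<Sum>i\<in>I. a *\<^sub>C (f i :: 'h::complex_hilbert_space))"
  by (induction I rule: infinite_finite_induct) (auto simp: scaleC_add_right)

lemma cinner_self: "cinner x x = complex_of_real ((norm (x::'h::complex_hilbert_space))\<^sup>2)"
proof (rule complex_eqI)
  show "Im (cinner x x) = Im (complex_of_real ((norm x)\<^sup>2))"
    using cinner_commute[of x x] by (metis Im_complex_of_real Reals_cnj_iff complex_is_Real_iff)
qed (simp add: Re_cinner power2_norm_eq_inner)

lemma norm_scaleC: "norm (a *\<^sub>C (x::'h::complex_hilbert_space)) = cmod a * norm x"
proof -
  have "complex_of_real ((norm (a *\<^sub>C x))\<^sup>2) = a * cnj a * cinner x x"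
    unfolding cinner_self[symmetric] cinner_scaleC_left cinner_scaleC_right by (simp only: ac_simps)
  also have "\<dots> = complex_of_real ((cmod a * norm x)\<^sup>2)"
    unfolding cinner_self complex_norm_square[symmetric] power_mult_distrib by (simp only: of_real_mult)
  finally have "(norm (a *\<^sub>C x))\<^sup>2 = (cmod a * norm x)\<^sup>2" by (simp only: of_real_eq_iff)
  then show ?thesis
    by simp
qed

definition orthonormal_on :: "'i set \<Rightarrow> ('i \<Rightarrow> 'h::complex_hilbert_space) \<Rightarrow> bool" where
  "orthonormal_on I e \<longleftrightarrow> (\<forall>i\<in>I. \<forall>j\<in>I. cinner (e i) (e j) = (if i = j then 1 else 0))"

lemma orthonormal_on_subset: "orthonormal_on I e \<Longrightarrow> J \<subseteq> I \<Longrightarrow> orthonormal_on J e"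
  unfolding orthonormal_on_def by blast

lemma cinner_orthonormal_sum:
  assumes "finite I" "orthonormal_on I e" "j \<in> I"
  shows "cinner (\<Sum>i\<in>I. a i *\<^sub>C e i) (e j) = a j"
proof -
  have "cinner (\<Sum>i\<in>I. a i *\<^sub>C e i) (e j) = (\<Sum>i\<in>I. if i = j then a j else 0)"
    unfolding cinner_sum_left
    by (rule sum.cong) (use assms in \<open>auto simp: orthonormal_on_def cinner_scaleC_left\<close>)
  then show ?thesis using assms by simp
qed

lemma norm_orthonormal_sum:
  assumes "finite I" "orthonormal_on I e"
  shows "(norm (\<Sum>i\<in>I. a i *\<^sub>C e i))\<^sup>2 = (\<Sum>i\<in>I. (cmod (a i))\<^sup>2)"
proof -
  let ?s = "\<Sum>i\<in>I. a i *\<^sub>C e i"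
  have "complex_of_real ((norm ?s)\<^sup>2) = (\<Sum>j\<in>I. cnj (a j) * cinner ?s (e j))"
    unfolding cinner_self[symmetric] by (subst cinner_sum_right) (simp add: cinner_scaleC_right)
  also have "\<dots> = (\<Sum>j\<in>I. complex_of_real ((cmod (a j))\<^sup>2))"
  proof (intro sum.cong HOL.refl)
    fix j assume "j \<in> I"
    then show "cnj (a j) * cinner ?s (e j) = complex_of_real ((cmod (a j))\<^sup>2)"
      unfolding complex_norm_square using cinner_orthonormal_sum[OF assms, of j a]
      by (simp add: mult.commute)
  qed
  finally show ?thesis by (simp only: of_real_sum[symmetric] of_real_eq_iff)
qed

lemma norm_diff_orthonormal_projection:
  assumes "finite I" "orthonormal_on I e"
  shows "(norm (x - (\<Sum>i\<in>I. cinner x (e i) *\<^sub>C e i)))\<^sup>2 =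
    (norm x)\<^sup>2 - (\<Sum>i\<in>I. (cmod (cinner x (e i)))\<^sup>2)"
proof -
  let ?s = "\<Sum>i\<in>I. cinner x (e i) *\<^sub>C e i"
  have "cinner x ?s = (\<Sum>i\<in>I. complex_of_real ((cmod (cinner x (e i)))\<^sup>2))"
    unfolding cinner_sum_right cinner_scaleC_right
    by (simp add: complex_norm_square mult.commute del: of_real_power)
  then have "Re (cinner x ?s) = (\<Sum>i\<in>I. (cmod (cinner x (e i)))\<^sup>2)" by simp
  then have "inner x ?s = (norm ?s)\<^sup>2" "(norm ?s)\<^sup>2 = (\<Sum>i\<in>I. (cmod (cinner x (e i)))\<^sup>2)"
    using norm_orthonormal_sum[OF assms, of "\<lambda>i. cinner x (e i)"] by (simp_all add: Re_cinner)
  then show ?thesis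
    by (simp add: power2_norm_eq_inner inner_diff_left inner_diff_right inner_commute)
qed

lemma Bessel_inequality:
  assumes "finite I" "orthonormal_on I e"
  shows "(\<Sum>i\<in>I. (cmod (cinner x (e i)))\<^sup>2) \<le> (norm x)\<^sup>2"
  using norm_diff_orthonormal_projection[OF assms, of x]
    zero_le_power2[of "norm (x - (\<Sum>i\<in>I. cinner x (e i) *\<^sub>C e i))"] by linarith

text \<open>One Gram-Schmidt step: the new vector is the normalised residual of \<open>x\<close>,
  which is nonzero by assumption.\<close>

lemma orthonormal_extend:
  fixes x :: "'h::complex_hilbert_space"
  assumes "finite B" "orthonormal_on B (\<lambda>e. e)" and x: "x \<noteq> (\<Sum>e\<in>B. cinner x e *\<^sub>C e)"
  obtains b where "b \<notin> B" "orthonormal_on (insert b B) (\<lambda>e. e)"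
    "x = (\<Sum>e\<in>insert b B. cinner x e *\<^sub>C e)"
proof -
  define r where "r = x - (\<Sum>e\<in>B. cinner x e *\<^sub>C e)"
  define b where "b = complex_of_real (1 / norm r) *\<^sub>C r"
  have r0: "norm r \<noteq> 0" using x by (simp add: r_def)
  have re: "cinner r e = 0" if "e \<in> B" for e
    unfolding r_def cinner_diff_left
    using cinner_orthonormal_sum[OF assms(1,2) that, of "\<lambda>e. cinner x e"] by simp
  have be: "cinner b e = 0" "cinner e b = 0" if "e \<in> B" for e
    using re[OF that] cinner_commute[of e r]
    by (simp_all add: b_def cinner_scaleC_left cinner_scaleC_right)
  have bb: "cinner b b = 1"
    using r0 by (simp add: cinner_self b_def norm_scaleC norm_divide)
  have bB: "b \<notin> B" using be bb by force
  have "cinner x b = cinner r b + cinner (\<Sum>e\<in>B. cinner x e *\<^sub>C e) b"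
    by (simp add: r_def flip: cinner_add_left)
  also have "\<dots> = cinner r b" using be by (simp add: cinner_sum_left cinner_scaleC_left)
  also have "\<dots> = norm r"
    using r0 by (simp add: b_def cinner_scaleC_right cinner_self power2_eq_square)
  finally have xb: "cinner x b = norm r" .
  have "cinner x b *\<^sub>C b = r"
    unfolding xb unfolding b_def using r0 by (simp add: scaleC_scaleC)
  then have "x = (\<Sum>e\<in>insert b B. cinner x e *\<^sub>C e)"
    using assms(1) bB by (simp add: r_def)
  moreover have "orthonormal_on (insert b B) (\<lambda>e. e)"
    using assms(2) be bb bB unfolding orthonormal_on_def by auto
  ultimately show thesis using that bB by blast
qed

lemma finite_orthonormal_expansion:
  assumes "finite V"
  obtains B :: "'h::complex_hilbert_space set" where "finite B" "orthonormal_on B (\<lambda>e. e)"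
    "\<forall>x\<in>V. x = (\<Sum>e\<in>B. cinner x e *\<^sub>C e)"
proof -
  have "\<exists>B. finite B \<and> orthonormal_on B (\<lambda>e. e) \<and> (\<forall>x\<in>V. x = (\<Sum>e\<in>B. cinner x e *\<^sub>C e))"
    using assms
  proof induction
    case empty
    show ?case by (intro exI[of _ "{}"]) (auto simp: orthonormal_on_def)
  next
    case (insert v V)
    then obtain B where B: "finite B" "orthonormal_on B (\<lambda>e. e)"
      "\<forall>x\<in>V. x = (\<Sum>e\<in>B. cinner x e *\<^sub>C e)" by blast
    show ?case
    proof (cases "v = (\<Sum>e\<in>B. cinner v e *\<^sub>C e)")
      case True
      then show ?thesis using B by (intro exI[of _ B]) auto
    next
      case False
      obtain b where b: "b \<notin> B" "orthonormal_on (Set.insert b B) (\<lambda>e. e)"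
        "v = (\<Sum>e\<in>Set.insert b B. cinner v e *\<^sub>C e)"
        using orthonormal_extend[OF B(1,2) False] .
      \<comment> \<open>The new vector is orthogonal to \<open>B\<close>, so earlier expansions only
        acquire a zero coefficient.\<close>
      have "x = (\<Sum>e\<in>Set.insert b B. cinner x e *\<^sub>C e)" if "x \<in> V" for x
      proof -
        have x: "x = (\<Sum>e\<in>B. cinner x e *\<^sub>C e)" using B(3) that by blast
        have "cinner x b = (\<Sum>e\<in>B. cinner x e * cinner e b)"
          by (subst x) (simp add: cinner_sum_left cinner_scaleC_left)
        also have "\<dots> = 0" using b(1,2) by (intro sum.neutral) (auto simp: orthonormal_on_def)
        finally show ?thesis using B(1) b(1) x by simp
      qed
      then show ?thesis using B b by (intro exI[of _ "Set.insert b B"]) auto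
    qed
  qed
  then show thesis using that by blast
qed

lemma orthonormal_family_exists:
  assumes inf: "\<not> (\<exists>B :: 'h::complex_hilbert_space set. finite B \<and> span B = UNIV)"
    and "finite I"
  obtains e :: "'i \<Rightarrow> 'h::complex_hilbert_space" where "orthonormal_on I e"
proof -
  have "\<exists>B :: 'h set. finite B \<and> card B = n \<and> orthonormal_on B (\<lambda>e. e)" for n
  proof (induction n)
    case 0
    show ?case by (intro exI[of _ "{}"]) (auto simp: orthonormal_on_def)
  next
    case (Suc n)
    then obtain B :: "'h set" where B: "finite B" "card B = n" "orthonormal_on B (\<lambda>e. e)" by blast
    \<comment> \<open>\<open>span\<close> is the real span. Adjoining the multiples by
      \<open>\<i>\<close> makes it contain all complex combinations of \<open>B\<close>, so a vector
      outside it differs from its projection onto \<open>B\<close>.\<close>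
    let ?C = "B \<union> (*\<^sub>C) \<i> ` B"
    have "finite ?C" using B(1) by simp
    then have "span ?C \<noteq> UNIV" using inf by metis
    then obtain x where x: "x \<notin> span ?C" by blast
    have "z *\<^sub>C e \<in> span ?C" if "e \<in> B" for z e
    proof -
      have "z *\<^sub>C e = (complex_of_real (Re z) + complex_of_real (Im z) * \<i>) *\<^sub>C e"
        by (metis complex_eq mult.commute)
      also have "\<dots> = Re z *\<^sub>R e + Im z *\<^sub>R (\<i> *\<^sub>C e)"
        by (simp only: scaleC_add_left scaleC_of_real flip: scaleC_scaleC)
      finally have "z *\<^sub>C e = Re z *\<^sub>R e + Im z *\<^sub>R (\<i> *\<^sub>C e)" .
      moreover have "e \<in> span ?C" "\<i> *\<^sub>C e \<in> span ?C" using that by (auto intro: span_base)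
      ultimately show ?thesis by (simp only: span_add span_scale)
    qed
    then have "(\<Sum>e\<in>B. cinner x e *\<^sub>C e) \<in> span ?C" by (intro span_sum)
    with x have *: "x \<noteq> (\<Sum>e\<in>B. cinner x e *\<^sub>C e)" by auto
    obtain b where b: "b \<notin> B" "orthonormal_on (insert b B) (\<lambda>e. e)"
      using orthonormal_extend[OF B(1,3) *] .
    have "card (insert b B) = Suc n" using B(1,2) b(1) by simp
    then show ?case using B(1) b(2) finite.insertI by metis
  qed
  from this[of "card I"] obtain B :: "'h set"
    where B: "finite B" "card B = card I" "orthonormal_on B (\<lambda>e. e)"
    by (elim exE conjE)
  obtain e where e: "bij_betw e I B"
    using finite_same_card_bij[OF \<open>finite I\<close> B(1) B(2)[symmetric]] by (elim exE)
  have "orthonormal_on I e"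
    unfolding orthonormal_on_def
  proof (intro ballI)
    fix i j assume "i \<in> I" "j \<in> I"
    then show "cinner (e i) (e j) = (if i = j then 1 else 0)"
      using B(3) bij_betwE[OF e] inj_on_eq_iff[OF bij_betw_imp_inj_on[OF e]]
      unfolding orthonormal_on_def by simp
  qed
  then show thesis by (rule that)
qed

section \<open>From operators to finite matrices\<close>

definition sqnorm :: "'i set \<Rightarrow> ('i \<Rightarrow> complex) \<Rightarrow> real" where
  "sqnorm I u = (\<Sum>i\<in>I. (cmod (u i))\<^sup>2)"

definition mat_vec :: "'i set \<Rightarrow> ('i \<Rightarrow> 'i \<Rightarrow> complex) \<Rightarrow> ('i \<Rightarrow> complex) \<Rightarrow> 'i \<Rightarrow> complex" where
  "mat_vec I t u i = (\<Sum>j\<in>I. t i j * u j)"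

text \<open>\<open>p\<close> places the indices in the space and need not be injective, which
  encodes multiplicities. Testing against every \<open>u\<close> with \<open>t u\<close> nonzero
  replaces the operator norm. The inequality compares squared quotients with denominators multiplied
  out, so \<open>c\<close> is the square of a localization constant.\<close>

definition matrix_localization ::
  "'i itself \<Rightarrow> 'x metric \<Rightarrow> real \<Rightarrow> nat \<Rightarrow> nat \<Rightarrow> bool" where
  "matrix_localization _ m c k D \<longleftrightarrow>
     (\<forall>(I::'i set) p t u. finite I \<and> p ` I \<subseteq> mspace m \<and>
        (\<forall>i\<in>I. \<forall>j\<in>I. t i j \<noteq> 0 \<longrightarrow> mdist m (p i) (p j) \<le> real k) \<and>
        sqnorm I (mat_vec I t u) > 0 \<longrightarrow>
        (\<exists>v. sqnorm I v > 0 \<and>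
           (\<forall>i\<in>I. \<forall>j\<in>I. v i \<noteq> 0 \<and> v j \<noteq> 0 \<longrightarrow> mdist m (p i) (p j) \<le> real D) \<and>
           c * sqnorm I (mat_vec I t u) * sqnorm I v \<le> sqnorm I (mat_vec I t v) * sqnorm I u))"

lemma sqnorm_nonneg [simp]: "0 \<le> sqnorm I u"
  by (simp add: sqnorm_def sum_nonneg)

lemma sqnorm_mono: "finite I \<Longrightarrow> J \<subseteq> I \<Longrightarrow> sqnorm J u \<le> sqnorm I u"
  unfolding sqnorm_def by (rule sum_mono2) auto

lemma sqnorm_eq_0_iff: "finite I \<Longrightarrow> sqnorm I u = 0 \<longleftrightarrow> (\<forall>i\<in>I. u i = 0)"
  by (simp add: sqnorm_def sum_nonneg_eq_0_iff)

text \<open>The Frobenius norm dominates the operator norm, by Cauchy-Schwarz in each row.\<close>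

lemma sqnorm_mat_vec_le:
  assumes "finite I"
  shows "sqnorm I (mat_vec I t u) \<le> (\<Sum>i\<in>I. sqnorm I (t i)) * sqnorm I u"
proof -
  have "(cmod (mat_vec I t u i))\<^sup>2 \<le> sqnorm I (t i) * sqnorm I u" for i
  proof -
    have "cmod (mat_vec I t u i) \<le> (\<Sum>j\<in>I. cmod (t i j) * cmod (u j))"
      unfolding mat_vec_def by (rule order_trans[OF norm_sum]) (simp add: norm_mult)
    then have "(cmod (mat_vec I t u i))\<^sup>2 \<le> (\<Sum>j\<in>I. cmod (t i j) * cmod (u j))\<^sup>2"
      by (rule power_mono) simp
    also have "\<dots> \<le> sqnorm I (t i) * sqnorm I u"
      unfolding sqnorm_def by (rule Cauchy_Schwarz_ineq_sum)
    finally show ?thesis .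
  qed
  then show ?thesis
    unfolding sqnorm_def[of I "mat_vec I t u"] sum_distrib_right by (intro sum_mono)
qed

section \<open>Integrals and supports over discrete spaces\<close>

lemma has_bochner_integral_finite_support:
  fixes f :: "'x \<Rightarrow> 'b::{banach, second_countable_topology}"
  assumes M: "sets M = Pow X" and F: "finite F" "F \<subseteq> X" "\<And>x. x \<in> F \<Longrightarrow> emeasure M {x} < \<infinity>"
    and f: "AE x in M. x \<notin> F \<longrightarrow> f x = 0"
  shows "has_bochner_integral M f (\<Sum>x\<in>F. measure M {x} *\<^sub>R f x)"
proof -
  have sp: "space M = X" using sets_eq_imp_space_eq[of M "count_space X"] M by simp
  have meas: "g \<in> borel_measurable M" for g :: "'x \<Rightarrow> 'b"
    unfolding measurable_def using M sp by auto
  have 1: "has_bochner_integral M (\<lambda>x. \<Sum>y\<in>F. indicator {y} x *\<^sub>R f y)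
      (\<Sum>y\<in>F. measure M {y} *\<^sub>R f y)"
    using F M by (intro has_bochner_integral_sum has_bochner_integral_scaleR_left
        has_bochner_integral_real_indicator) auto
  have 2: "AE x in M. (\<Sum>y\<in>F. indicator {y} x *\<^sub>R f y) = f x"
    using f
  proof eventually_elim
    case (elim x)
    have "(\<Sum>y\<in>F. indicator {y} x *\<^sub>R f y) = (\<Sum>y\<in>F. if y = x then f x else 0)"
      by (intro sum.cong) (auto simp: indicator_def)
    then show ?case using elim F by simp
  qed
  show ?thesis
    by (rule iffD1[OF has_bochner_integral_cong_AE[OF meas meas 2] 1])
qed

lemma locally_finite_borel_measure_discrete:
  assumes "mtopology_of m = discrete_topology (mspace m)"
  shows "locally_finite_borel_measure m \<nu> \<longleftrightarrow> sets \<nu> = Pow (mspace m) \<and>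
     (\<forall>B\<in>sets \<nu>. Metric_space.mbounded (mspace m) (mdist m) B \<longrightarrow> emeasure \<nu> B < \<infinity>)"
proof -
  have "sigma_sets (mspace m) (Pow (mspace m)) = Pow (mspace m)"
    by (rule sigma_algebra.sigma_sets_eq[OF sigma_algebra_Pow])
  moreover have "{U. openin (mtopology_of m) U} = Pow (mspace m)" by (auto simp: assms)
  moreover have "sets \<nu> = Pow (mspace m) \<Longrightarrow> space \<nu> = mspace m"
    using sets_eq_imp_space_eq[of \<nu> "count_space (mspace m)"] by simp
  ultimately show ?thesis unfolding locally_finite_borel_measure_def by auto
qed

text \<open>A point of positive mass lies in no null set. Through this, almost everywhere identities
  between representatives can be evaluated at single points.\<close>

lemma not_AE_zero_at_atom:
  assumes M: "sets M = Pow X" and "x \<in> X" "emeasure M {x} \<noteq> 0" "AE y in M. P y"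
  shows "P x"
proof (rule ccontr)
  assume "\<not> P x"
  have sp: "space M = X" using sets_eq_imp_space_eq[of M "count_space X"] M by simp
  obtain N where "{y\<in>space M. \<not> P y} \<subseteq> N" "emeasure M N = 0" "N \<in> sets M"
    using assms(4) by (rule AE_E)
  then have "emeasure M {x} \<le> emeasure M N"
    using \<open>\<not> P x\<close> sp \<open>x \<in> X\<close> by (intro emeasure_mono) auto
  then show False using \<open>emeasure M N = 0\<close> assms(3) by simp
qed

lemma mem_L2_support:
  assumes M: "sets \<nu> = Pow (mspace m)" and top: "mtopology_of m = discrete_topology (mspace m)"
    and x: "x \<in> mspace m" "emeasure \<nu> {x} \<noteq> 0" "\<phi> x \<noteq> 0"
  shows "x \<in> L2_support m \<nu> \<phi>"
  unfolding L2_support_def using not_AE_zero_at_atom[OF M x(1,2)] x(1,3) by blast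

lemma L2_support_discrete_subset:
  assumes M: "sets \<nu> = Pow (mspace m)" and top: "mtopology_of m = discrete_topology (mspace m)"
  shows "L2_support m \<nu> \<phi> \<subseteq> {x \<in> mspace m. \<phi> x \<noteq> 0}"
proof
  fix x assume x: "x \<in> L2_support m \<nu> \<phi>"
  then have xm: "x \<in> mspace m" by (simp add: L2_support_def)
  have "\<forall>U. openin (mtopology_of m) U \<and> x \<in> U \<longrightarrow> \<not> (AE y in \<nu>. y \<in> U \<longrightarrow> \<phi> y = 0)"
    using x by (simp add: L2_support_def)
  then have *: "\<not> (AE y in \<nu>. y \<in> {x} \<longrightarrow> \<phi> y = 0)"
    by (rule allE[where x = "{x}"]) (erule mp, use xm in \<open>simp add: top\<close>)
  have "\<phi> x \<noteq> 0"
  proof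
    assume "\<phi> x = 0"
    then have "AE y in \<nu>. y \<in> {x} \<longrightarrow> \<phi> y = 0" by (intro AE_I2) simp
    with * show False by (rule notE)
  qed
  then show "x \<in> {x \<in> mspace m. \<phi> x \<noteq> 0}" using xm by simp
qed

lemma set_diameter_le_iff:
  "set_diameter m P \<le> of_nat D \<longleftrightarrow> (\<forall>x\<in>P. \<forall>y\<in>P. mdist m x y \<le> real D)"
  unfolding set_diameter_def SUP_le_iff
  by (simp add: ennreal_le_iff flip: ennreal_of_nat_eq_real_of_nat)

text \<open>An orthonormal family indexed by \<open>I\<close> embeds \<open>\<complex>\<^sup>I\<close> into \<open>L\<^sup>2\<close> of the counting measure on
  \<open>p(I)\<close>; this is where infinite dimensionality of \<open>H\<close> absorbs the multiplicities of \<open>p\<close>.\<close>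

lemma operator_norm_localization_imp_matrix_localization:
  fixes m :: "'x metric"
  assumes inf: "\<not> (\<exists>B :: 'h::{complex_hilbert_space, second_countable_topology} set.
                finite B \<and> span B = UNIV)"
    and top: "mtopology_of m = discrete_topology (mspace m)"
    and onl: "operator_norm_localization TYPE('h) m"
  shows "\<exists>c>0. \<forall>k. \<exists>D. matrix_localization TYPE('i) m c k D"
proof -
  obtain c f where c: "0 < c" "c \<le> 1" and onl':
    "\<And>\<nu> k (T :: ('x \<Rightarrow> 'h) \<Rightarrow> ('x \<Rightarrow> 'h)). locally_finite_borel_measure m \<nu> \<Longrightarrow>
       emeasure \<nu> (space \<nu>) \<noteq> 0 \<Longrightarrow> T \<in> propagation_operators m \<nu> (real k) \<Longrightarrow>
       \<exists>\<phi>\<in>L2 \<nu>. \<not> (AE x in \<nu>. \<phi> x = 0) \<and>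
                set_diameter m (L2_support m \<nu> \<phi>) \<le> of_nat (f k) \<and>
                L2_norm \<nu> (T \<phi>) \<ge> c * L2_operator_norm \<nu> T * L2_norm \<nu> \<phi>"
    using onl unfolding operator_norm_localization_def by metis
  \<comment> \<open>The matrix form compares squared norms, hence the square of the
    constant.\<close>
  have "matrix_localization TYPE('i) m (c\<^sup>2) k (f k)" for k
    unfolding matrix_localization_def
  proof (intro allI impI, elim conjE)
    fix I :: "'i set" and p :: "'i \<Rightarrow> 'x" and t :: "'i \<Rightarrow> 'i \<Rightarrow> complex" and u :: "'i \<Rightarrow> complex"
    assume I: "finite I" and p: "p ` I \<subseteq> mspace m"
      and t: "\<forall>i\<in>I. \<forall>j\<in>I. t i j \<noteq> 0 \<longrightarrow> mdist m (p i) (p j) \<le> real k"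
      and tu: "0 < sqnorm I (mat_vec I t u)"
    obtain e :: "'i \<Rightarrow> 'h" where e: "orthonormal_on I e"
      using orthonormal_family_exists[OF inf I] .
    define P where "P = p ` I"
    have P: "finite P" "P \<subseteq> mspace m" using I p by (auto simp: P_def)
    define \<nu> where "\<nu> = point_measure (mspace m) (indicator P)"
    have sets: "sets \<nu> = Pow (mspace m)" and space: "space \<nu> = mspace m"
      by (simp_all add: \<nu>_def sets_point_measure space_point_measure)
    have em: "emeasure \<nu> B = of_nat (card (B \<inter> P))" if "B \<subseteq> mspace m" for B
    proof -
      have "{x\<in>B. 0 < (indicator P x :: ennreal)} = B \<inter> P" by (auto simp: indicator_def)
      then show ?thesis
        unfolding \<nu>_def using that P(1)
        by (subst emeasure_point_measure) (auto simp: indicator_def)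
    qed
    have m1: "measure \<nu> {x} = 1" "emeasure \<nu> {x} = 1" if "x \<in> P" for x
      using em[of "{x}"] that P(2) by (auto simp: measure_def)
    have AE: "AE x in \<nu>. x \<in> P"
    proof (rule AE_I)
      show "{x \<in> space \<nu>. x \<notin> P} \<subseteq> mspace m - P" by (auto simp: space)
      show "emeasure \<nu> (mspace m - P) = 0" using em[of "mspace m - P"] by (simp add: Int_commute[of _ P])
      show "mspace m - P \<in> sets \<nu>" by (auto simp: sets)
    qed
    have bint: "has_bochner_integral \<nu> g (\<Sum>x\<in>P. g x)"
      for g :: "'x \<Rightarrow> 'b::{banach, second_countable_topology}"
    proof -
      have "AE x in \<nu>. x \<notin> P \<longrightarrow> g x = 0" using AE by eventually_elim simp
      from has_bochner_integral_finite_support[OF sets P _ this] show ?thesis by (simp add: m1)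
    qed
    have meas: "g \<in> borel_measurable \<nu>" for g :: "'x \<Rightarrow> 'h"
      unfolding measurable_def using sets space by auto
    have L2: "\<phi> \<in> L2 \<nu>" for \<phi> :: "'x \<Rightarrow> 'h"
      using meas integrable.intros[OF bint] by (simp add: L2_def)
    have norm: "(L2_norm \<nu> \<phi>)\<^sup>2 = (\<Sum>x\<in>P. (norm (\<phi> x))\<^sup>2)" for \<phi> :: "'x \<Rightarrow> 'h"
      unfolding L2_norm_def has_bochner_integral_integral_eq[OF bint]
      by (simp add: sum_nonneg)
    have norm_nonneg: "0 \<le> L2_norm \<nu> \<phi>" for \<phi> :: "'x \<Rightarrow> 'h"
      by (simp add: L2_norm_def)
    define J where "J x = {i \<in> I. p i = x}" for x
    have J: "finite (J x)" "J x \<subseteq> I" "orthonormal_on (J x) e" for x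
      using I orthonormal_on_subset[OF e, of "J x"] by (auto simp: J_def)
    have sum_J: "(\<Sum>x\<in>P. \<Sum>i\<in>J x. g i) = (\<Sum>i\<in>I. g i)" for g :: "'i \<Rightarrow> real"
      unfolding J_def by (rule sum.group) (use I P in \<open>auto simp: P_def\<close>)
    \<comment> \<open>\<open>emb\<close> is isometric and \<open>coef\<close> is its adjoint and
      left inverse. The operator \<open>T\<close> below is \<open>t\<close> transported to the range
      of \<open>emb\<close>, and zero on the orthogonal complement.\<close>
    define emb where "emb v x = (\<Sum>i\<in>J x. v i *\<^sub>C e i)" for v x
    define coef where "coef \<phi> i = cinner (\<phi> (p i)) (e i)" for \<phi> i
    have norm_emb: "(L2_norm \<nu> (emb v))\<^sup>2 = sqnorm I v" for v
      unfolding norm emb_def norm_orthonormal_sum[OF J(1,3)] sum_J sqnorm_def ..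
    have coef_emb: "coef (emb v) i = v i" if "i \<in> I" for v i
      unfolding coef_def emb_def
      by (rule cinner_orthonormal_sum[OF J(1,3)]) (use that in \<open>simp add: J_def\<close>)
    have norm_coef: "sqnorm I (coef \<phi>) \<le> (L2_norm \<nu> \<phi>)\<^sup>2" for \<phi>
    proof -
      have "sqnorm I (coef \<phi>) = (\<Sum>x\<in>P. \<Sum>i\<in>J x. (cmod (cinner (\<phi> x) (e i)))\<^sup>2)"
        unfolding sqnorm_def sum_J[symmetric] by (intro sum.cong HOL.refl) (simp add: J_def coef_def)
      also have "\<dots> \<le> (L2_norm \<nu> \<phi>)\<^sup>2"
        unfolding norm by (intro sum_mono Bessel_inequality J)
      finally show ?thesis .
    qed
    define T where "T \<phi> = emb (mat_vec I t (coef \<phi>))" for \<phi>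
    have mv_cong: "mat_vec I t v = mat_vec I t w" if "\<forall>i\<in>I. v i = w i" for v w
      unfolding mat_vec_def using that by (intro ext sum.cong) auto
    have normT: "(L2_norm \<nu> (T \<phi>))\<^sup>2 = sqnorm I (mat_vec I t (coef \<phi>))" for \<phi>
      by (simp add: T_def norm_emb)
    define C where "C = (\<Sum>i\<in>I. sqnorm I (t i))"
    have C0: "0 \<le> C" by (simp add: C_def sum_nonneg)
    have normT_le: "L2_norm \<nu> (T \<phi>) \<le> sqrt C * L2_norm \<nu> \<phi>" for \<phi>
    proof -
      have "(L2_norm \<nu> (T \<phi>))\<^sup>2 \<le> C * sqnorm I (coef \<phi>)"
        unfolding normT C_def by (rule sqnorm_mat_vec_le[OF I])
      also have "\<dots> \<le> C * (L2_norm \<nu> \<phi>)\<^sup>2" by (intro mult_left_mono norm_coef C0)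
      also have "\<dots> = (sqrt C * L2_norm \<nu> \<phi>)\<^sup>2" using C0 by (simp add: power_mult_distrib)
      finally show ?thesis by (rule power2_le_imp_le) (simp add: C0 norm_nonneg)
    qed
    have coef_AE: "coef \<phi> i = coef \<psi> i" if "AE x in \<nu>. \<phi> x = \<psi> x" "i \<in> I" for \<phi> \<psi> i
    proof -
      have "p i \<in> P" using that by (simp add: P_def)
      then show ?thesis
        using not_AE_zero_at_atom[OF sets _ _ that(1), of "p i"] P m1 by (auto simp: coef_def)
    qed
    have T_AE: "T \<phi> = T \<psi>" if "AE x in \<nu>. \<phi> x = \<psi> x" for \<phi> \<psi>
      unfolding T_def using mv_cong coef_AE[OF that] by metis
    have T_add: "T (\<lambda>y. \<phi> y + \<psi> y) x = T \<phi> x + T \<psi> x" for \<phi> \<psi> x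
      by (simp add: T_def emb_def mat_vec_def coef_def cinner_add_left scaleC_add_left
          algebra_simps sum.distrib)
    have T_scale: "T (\<lambda>y. a *\<^sub>C \<phi> y) x = a *\<^sub>C T \<phi> x" for a \<phi> x
      by (simp add: T_def emb_def mat_vec_def coef_def cinner_scaleC_left scaleC_scaleC
          scaleC_sum_right sum_distrib_left mult.left_commute)
    have bounded: "L2_bounded_operator \<nu> T"
      unfolding L2_bounded_operator_def
    proof (intro conjI)
      show "\<exists>C. \<forall>\<phi>\<in>L2 \<nu>. L2_norm \<nu> (T \<phi>) \<le> C * L2_norm \<nu> \<phi>" using normT_le by blast
    qed (use L2 T_AE T_add T_scale in auto)
    have supp: "x \<in> L2_support m \<nu> \<phi>" if "x \<in> P" "\<phi> x \<noteq> 0" for x \<phi>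
      by (rule mem_L2_support[OF sets top]) (use that P m1 in auto)
    have "T \<in> propagation_operators m \<nu> (real k)"
      unfolding propagation_operators_def
    proof (intro CollectI conjI bounded ballI impI)
      fix \<phi> \<psi> :: "'x \<Rightarrow> 'h"
      assume far: "ennreal (real k) < set_distance m (L2_support m \<nu> \<phi>) (L2_support m \<nu> \<psi>)"
      \<comment> \<open>A nonzero entry joining the two supports would bring them within distance
        \<open>k\<close>.\<close>
      have z: "\<phi> (p j) = 0 \<or> \<psi> (p i) = 0" if "i \<in> I" "j \<in> I" "t i j \<noteq> 0" for i j
      proof (rule ccontr)
        assume "\<not> ?thesis"
        moreover have "p i \<in> P" "p j \<in> P" using that by (auto simp: P_def)
        ultimately have "p j \<in> L2_support m \<nu> \<phi>" "p i \<in> L2_support m \<nu> \<psi>"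
          by (auto intro: supp)
        then have "set_distance m (L2_support m \<nu> \<phi>) (L2_support m \<nu> \<psi>) \<le> ennreal (mdist m (p j) (p i))"
          unfolding set_distance_def by (meson INF_lower INF_lower2)
        also have "\<dots> \<le> ennreal (real k)"
          using t that by (simp add: mdist_commute ennreal_leI)
        finally show False using far by simp
      qed
      have "cinner (T \<phi> x) (\<psi> x) = 0" for x
      proof -
        have "mat_vec I t (coef \<phi>) i * cinner (e i) (\<psi> x) = 0" if "i \<in> J x" for i
        proof (cases "\<psi> x = 0")
          case False
          then have "t i j * coef \<phi> j = 0" if "j \<in> I" for j
            using z[of i j] \<open>i \<in> J x\<close> that by (cases "t i j = 0") (auto simp: J_def coef_def)
          then have "mat_vec I t (coef \<phi>) i = 0" unfolding mat_vec_def by (rule sum.neutral[OF ballI])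
          then show ?thesis by simp
        qed simp
        then have "(\<Sum>i\<in>J x. mat_vec I t (coef \<phi>) i * cinner (e i) (\<psi> x)) = 0"
          by (rule sum.neutral[OF ballI])
        then show ?thesis by (simp only: T_def emb_def cinner_sum_left cinner_scaleC_left)
      qed
      then show "L2_inner \<nu> (T \<phi>) \<psi> = 0" by (simp add: L2_inner_def)
    qed
    moreover have "locally_finite_borel_measure m \<nu>"
      unfolding locally_finite_borel_measure_discrete[OF top]
      using em by (auto simp: sets of_nat_less_top)
    moreover have "P \<noteq> {}" using tu by (auto simp: P_def sqnorm_def)
    then have "emeasure \<nu> (space \<nu>) \<noteq> 0"
      using em[of "mspace m"] P by (simp add: space Int_absorb1)
    ultimately obtain \<phi> where \<phi>: "\<not> (AE x in \<nu>. \<phi> x = 0)"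
      "set_diameter m (L2_support m \<nu> \<phi>) \<le> of_nat (f k)"
      "c * L2_operator_norm \<nu> T * L2_norm \<nu> \<phi> \<le> L2_norm \<nu> (T \<phi>)"
      using onl'[of \<nu> T k] by metis
    have u0: "0 < sqnorm I u"
    proof (rule ccontr)
      assume "\<not> 0 < sqnorm I u"
      then have "sqnorm I u = 0" using sqnorm_nonneg[of I u] by linarith
      then have "sqnorm I (mat_vec I t u) = 0" using sqnorm_eq_0_iff[OF I, of u]
        by (simp add: sqnorm_def mat_vec_def)
      then show False using tu by simp
    qed
    have opn: "sqrt (sqnorm I (mat_vec I t u) / sqnorm I u) \<le> L2_operator_norm \<nu> T"
    proof -
      \<comment> \<open>Normalising \<open>u\<close> places its image in the unit ball over which
        the operator norm is a supremum.\<close>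
      define s where "s = 1 / sqrt (sqnorm I u)"
      define w where "w i = complex_of_real s * u i" for i
      have s2: "s\<^sup>2 * sqnorm I u = 1" using u0 by (simp add: s_def power_divide)
      have "sqnorm I w = s\<^sup>2 * sqnorm I u"
        by (simp add: sqnorm_def w_def norm_mult power_mult_distrib sum_distrib_left)
      then have "(L2_norm \<nu> (emb w))\<^sup>2 = 1" by (simp add: norm_emb s2)
      then have w1: "L2_norm \<nu> (emb w) \<le> 1"
        using power2_le_imp_le[of "L2_norm \<nu> (emb w)" 1] by simp
      have mw: "mat_vec I t (coef (emb w)) = (\<lambda>i. complex_of_real s * mat_vec I t u i)"
        using mv_cong[of "coef (emb w)" w] coef_emb
        by (simp add: fun_eq_iff) (simp add: mat_vec_def w_def sum_distrib_left mult.left_commute)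
      have "(L2_norm \<nu> (T (emb w)))\<^sup>2 = s\<^sup>2 * sqnorm I (mat_vec I t u)"
        unfolding normT mw
        by (simp add: sqnorm_def norm_mult power_mult_distrib sum_distrib_left)
      also have "\<dots> = sqnorm I (mat_vec I t u) / sqnorm I u"
        using u0 by (simp add: s_def power_divide)
      finally have "sqrt (sqnorm I (mat_vec I t u) / sqnorm I u) = L2_norm \<nu> (T (emb w))"
        using norm_nonneg by (metis real_sqrt_unique)
      also have "\<dots> \<le> L2_operator_norm \<nu> T"
        unfolding L2_operator_norm_def
      proof (rule cSUP_upper)
        show "emb w \<in> {\<phi> \<in> L2 \<nu>. L2_norm \<nu> \<phi> \<le> 1}" using L2 w1 by simp
        show "bdd_above ((\<lambda>\<phi>. L2_norm \<nu> (T \<phi>)) ` {\<phi> \<in> L2 \<nu>. L2_norm \<nu> \<phi> \<le> 1})"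
        proof (rule bdd_aboveI2)
          fix \<phi> :: "'x \<Rightarrow> 'h" assume "\<phi> \<in> {\<phi> \<in> L2 \<nu>. L2_norm \<nu> \<phi> \<le> 1}"
          then have "sqrt C * L2_norm \<nu> \<phi> \<le> sqrt C * 1" using C0 by (intro mult_left_mono) auto
          then show "L2_norm \<nu> (T \<phi>) \<le> sqrt C" using normT_le[of \<phi>] by simp
        qed
      qed
      finally show ?thesis .
    qed
    \<comment> \<open>\<open>T\<close> factors through \<open>coef\<close>. Passing from
      \<open>\<phi>\<close> to its coefficients therefore keeps the norm of the image, does not
      increase the norm of the vector and does not enlarge the support.\<close>
    define v where "v = coef \<phi>"
    have \<phi>0: "0 < L2_norm \<nu> \<phi>"
    proof (rule ccontr)
      assume "\<not> 0 < L2_norm \<nu> \<phi>"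
      then have "(L2_norm \<nu> \<phi>)\<^sup>2 = 0" using norm_nonneg[of \<phi>] by simp
      then have "\<forall>x\<in>P. \<phi> x = 0" unfolding norm using P by (simp add: sum_nonneg_eq_0_iff)
      then have "AE x in \<nu>. \<phi> x = 0" using AE by auto
      then show False using \<phi>(1) by blast
    qed
    have "c * sqrt (sqnorm I (mat_vec I t u) / sqnorm I u) * L2_norm \<nu> \<phi> \<le>
        c * L2_operator_norm \<nu> T * L2_norm \<nu> \<phi>"
      using opn c \<phi>0 by (intro mult_right_mono mult_left_mono) auto
    then have "c * sqrt (sqnorm I (mat_vec I t u) / sqnorm I u) * L2_norm \<nu> \<phi> \<le> L2_norm \<nu> (T \<phi>)"
      using \<phi>(3) by linarith
    then have "(c * sqrt (sqnorm I (mat_vec I t u) / sqnorm I u) * L2_norm \<nu> \<phi>)\<^sup>2 \<le> (L2_norm \<nu> (T \<phi>))\<^sup>2"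
      using c \<phi>0 by (intro power_mono) auto
    then have *: "c\<^sup>2 * (sqnorm I (mat_vec I t u) / sqnorm I u) * (L2_norm \<nu> \<phi>)\<^sup>2 \<le>
        sqnorm I (mat_vec I t v)"
      by (simp add: power_mult_distrib normT v_def)
    moreover have "0 < c\<^sup>2 * (sqnorm I (mat_vec I t u) / sqnorm I u) * (L2_norm \<nu> \<phi>)\<^sup>2"
      using c tu u0 \<phi>0 by simp
    \<comment> \<open>A priori \<open>coef\<close> could annihilate \<open>\<phi>\<close>. The
      estimate shows that \<open>t v\<close>, hence \<open>v\<close>, is nonzero.\<close>
    ultimately have tv: "0 < sqnorm I (mat_vec I t v)" by linarith
    have v0: "0 < sqnorm I v"
    proof (rule ccontr)
      assume "\<not> 0 < sqnorm I v"
      then have "sqnorm I v = 0" using sqnorm_nonneg[of I v] by linarith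
      then have "sqnorm I (mat_vec I t v) = 0" using sqnorm_eq_0_iff[OF I, of v]
        by (simp add: sqnorm_def mat_vec_def)
      then show False using tv by simp
    qed
    have "c\<^sup>2 * (sqnorm I (mat_vec I t u) / sqnorm I u) * sqnorm I v \<le>
        c\<^sup>2 * (sqnorm I (mat_vec I t u) / sqnorm I u) * (L2_norm \<nu> \<phi>)\<^sup>2"
      unfolding v_def by (intro mult_left_mono norm_coef) auto
    then have "c\<^sup>2 * (sqnorm I (mat_vec I t u) / sqnorm I u) * sqnorm I v \<le> sqnorm I (mat_vec I t v)"
      using * by linarith
    then have "c\<^sup>2 * sqnorm I (mat_vec I t u) * sqnorm I v \<le> sqnorm I (mat_vec I t v) * sqnorm I u"
      using u0 by (simp add: field_simps)
    moreover have "mdist m (p i) (p j) \<le> real (f k)"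
      if "i \<in> I" "j \<in> I" "v i \<noteq> 0" "v j \<noteq> 0" for i j
    proof -
      have "p i \<in> P" "p j \<in> P" "\<phi> (p i) \<noteq> 0" "\<phi> (p j) \<noteq> 0"
        using that by (auto simp: P_def v_def coef_def)
      then have "p i \<in> L2_support m \<nu> \<phi>" "p j \<in> L2_support m \<nu> \<phi>" by (simp_all add: supp)
      then show ?thesis using \<phi>(2) unfolding set_diameter_le_iff by blast
    qed
    ultimately show "\<exists>v. 0 < sqnorm I v \<and>
           (\<forall>i\<in>I. \<forall>j\<in>I. v i \<noteq> 0 \<and> v j \<noteq> 0 \<longrightarrow> mdist m (p i) (p j) \<le> real (f k)) \<and>
           c\<^sup>2 * sqnorm I (mat_vec I t u) * sqnorm I v \<le> sqnorm I (mat_vec I t v) * sqnorm I u"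
      using v0 by blast
  qed
  then show ?thesis using c by (intro exI[of _ "c\<^sup>2"]) auto
qed

section \<open>From finite matrices to operators\<close>

lemma L2_norm_nonneg: "0 \<le> L2_norm \<nu> \<phi>"
  by (simp add: L2_norm_def)

lemma L2_norm_power2: "(L2_norm \<nu> \<phi>)\<^sup>2 = (LINT x|\<nu>. (norm (\<phi> x))\<^sup>2)"
  by (simp add: L2_norm_def)

locale discrete_measure =
  fixes \<nu> :: "'x measure" and X :: "'x set"
  assumes sets_eq: "sets \<nu> = Pow X" and countable: "countable X"
    and finite_atoms: "\<And>x. x \<in> X \<Longrightarrow> emeasure \<nu> {x} < \<infinity>"
begin

lemma space_eq: "space \<nu> = X"
  using sets_eq_imp_space_eq[of \<nu> "count_space X"] sets_eq by simp

lemma borel_measurable: "f \<in> borel_measurable \<nu>"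
  unfolding measurable_def using sets_eq space_eq by auto

lemma measure_pos_iff: "x \<in> X \<Longrightarrow> 0 < measure \<nu> {x} \<longleftrightarrow> emeasure \<nu> {x} \<noteq> 0"
  using finite_atoms[of x] by (simp add: measure_def enn2real_positive_iff zero_less_iff_neq_zero)

text \<open>Countability makes the union of the null singletons a null set, so the measure is
  carried by its atoms.\<close>

lemma AE_atoms: "AE x in \<nu>. x \<in> X \<and> 0 < measure \<nu> {x}"
proof -
  let ?N = "\<Union>x\<in>{x\<in>X. emeasure \<nu> {x} = 0}. {x}"
  have "?N \<in> null_sets \<nu>"
    using countable sets_eq by (intro null_sets_UN') (auto intro!: countable_subset[OF _ countable] null_setsI)
  moreover have "{x \<in> space \<nu>. \<not> (x \<in> X \<and> 0 < measure \<nu> {x})} \<subseteq> ?N"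
    using measure_pos_iff by (auto simp: space_eq)
  ultimately show ?thesis by (rule AE_I')
qed

lemma integral_finite_support:
  fixes f :: "'x \<Rightarrow> 'b::{banach, second_countable_topology}"
  assumes "finite F" "F \<subseteq> X" "\<And>x. x \<notin> F \<Longrightarrow> f x = 0"
  shows "has_bochner_integral \<nu> f (\<Sum>x\<in>F. measure \<nu> {x} *\<^sub>R f x)"
  by (rule has_bochner_integral_finite_support[OF sets_eq assms(1,2)])
    (use assms finite_atoms in auto)

lemma finite_support_L2:
  fixes \<phi> :: "'x \<Rightarrow> 'h::complex_hilbert_space"
  assumes "finite F" "F \<subseteq> X" "\<And>x. x \<notin> F \<Longrightarrow> \<phi> x = 0"
  shows "\<phi> \<in> L2 \<nu>" "(L2_norm \<nu> \<phi>)\<^sup>2 = (\<Sum>x\<in>F. measure \<nu> {x} * (norm (\<phi> x))\<^sup>2)"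
proof -
  have *: "has_bochner_integral \<nu> (\<lambda>x. (norm (\<phi> x))\<^sup>2) (\<Sum>x\<in>F. measure \<nu> {x} *\<^sub>R (norm (\<phi> x))\<^sup>2)"
    using assms by (intro integral_finite_support) auto
  then show "\<phi> \<in> L2 \<nu>" using borel_measurable by (auto simp: L2_def has_bochner_integral_iff)
  show "(L2_norm \<nu> \<phi>)\<^sup>2 = (\<Sum>x\<in>F. measure \<nu> {x} * (norm (\<phi> x))\<^sup>2)"
    using has_bochner_integral_integral_eq[OF *] by (simp add: L2_norm_power2)
qed

lemma sum_atoms_le_L2_norm:
  fixes \<phi> :: "'x \<Rightarrow> 'h::complex_hilbert_space"
  assumes "finite F" "F \<subseteq> X" "\<phi> \<in> L2 \<nu>"
  shows "(\<Sum>x\<in>F. measure \<nu> {x} * (norm (\<phi> x))\<^sup>2) \<le> (L2_norm \<nu> \<phi>)\<^sup>2"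
proof -
  let ?g = "\<lambda>x. if x \<in> F then (norm (\<phi> x))\<^sup>2 else 0"
  have *: "has_bochner_integral \<nu> ?g (\<Sum>x\<in>F. measure \<nu> {x} *\<^sub>R ?g x)"
    using assms by (intro integral_finite_support) auto
  have "(LINT x|\<nu>. ?g x) \<le> (LINT x|\<nu>. (norm (\<phi> x))\<^sup>2)"
    using assms(3) * by (intro integral_mono) (auto simp: L2_def has_bochner_integral_iff)
  then show ?thesis
    using has_bochner_integral_integral_eq[OF *] by (simp add: L2_norm_power2)
qed

text \<open>Dominated convergence along finite sets of atoms, those with index below
  \<open>n\<close> in an enumeration of \<open>X\<close>.\<close>

lemma L2_truncation:
  fixes \<phi> :: "'x \<Rightarrow> 'h::complex_hilbert_space"
  assumes \<phi>: "\<phi> \<in> L2 \<nu>" and "0 < \<epsilon>"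
  obtains F where "finite F" "F \<subseteq> X" "\<And>x. x \<in> F \<Longrightarrow> 0 < measure \<nu> {x}"
    "(LINT x|\<nu>. (norm (\<phi> x))\<^sup>2 * indicator (- F) x) < \<epsilon>"
proof -
  define A where "A n = {x\<in>X. 0 < measure \<nu> {x} \<and> to_nat_on X x < n}" for n
  let ?g = "\<lambda>x. (norm (\<phi> x))\<^sup>2"
  have g: "integrable \<nu> ?g" using \<phi> by (simp add: L2_def)
  have "(\<lambda>n. LINT x|\<nu>. ?g x * indicator (- A n) x) \<longlonglongrightarrow> (LINT x|\<nu>. 0)"
  proof (rule integral_dominated_convergence[where w = ?g])
    show "AE x in \<nu>. (\<lambda>n. ?g x * indicator (- A n) x) \<longlonglongrightarrow> 0"
      using AE_atoms
    proof eventually_elim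
      case (elim x)
      have "eventually (\<lambda>n. ?g x * indicator (- A n) x = 0) sequentially"
        using eventually_gt_at_top[of "to_nat_on X x"]
        by eventually_elim (use elim in \<open>auto simp: A_def\<close>)
      then show ?case by (rule tendsto_eventually)
    qed
  qed (use g borel_measurable in \<open>auto simp: indicator_def\<close>)
  then have "eventually (\<lambda>n. (LINT x|\<nu>. ?g x * indicator (- A n) x) < \<epsilon>) sequentially"
    using assms(2) by (intro order_tendstoD) auto
  then obtain n where n: "(LINT x|\<nu>. ?g x * indicator (- A n) x) < \<epsilon>"
    by (auto simp: eventually_sequentially)
  have "inj_on (to_nat_on X) (A n)"
    by (rule inj_on_subset[OF inj_on_to_nat_on[OF countable]]) (auto simp: A_def)
  moreover have "finite (to_nat_on X ` A n)"
    by (rule finite_subset[of _ "{..<n}"]) (auto simp: A_def)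
  ultimately have "finite (A n)" by (rule finite_imageD[rotated])
  with n show thesis by (intro that[of "A n"]) (auto simp: A_def)
qed

text \<open>Operators act on representatives and are linear only almost everywhere, so a finite sum
  is reached by induction. The common finite support keeps every partial sum in
  \<open>L2\<close>.\<close>

lemma L2_operator_sum:
  fixes \<beta> :: "'j \<Rightarrow> 'x \<Rightarrow> 'h::complex_hilbert_space"
  assumes T: "L2_bounded_operator \<nu> T" and F: "finite F" "F \<subseteq> X" "\<And>j x. x \<notin> F \<Longrightarrow> \<beta> j x = 0"
    and "finite J"
  shows "AE x in \<nu>. T (\<lambda>y. \<Sum>j\<in>J. a j *\<^sub>C \<beta> j y) x = (\<Sum>j\<in>J. a j *\<^sub>C T (\<beta> j) x)"
proof -
  have L2: "(\<lambda>y. \<Sum>j\<in>J. a j *\<^sub>C \<beta> j y) \<in> L2 \<nu>" "\<beta> j \<in> L2 \<nu>" "(\<lambda>y. a j *\<^sub>C \<beta> j y) \<in> L2 \<nu>" for J j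
    by (rule finite_support_L2(1)[OF F(1,2)], simp add: F(3))+
  have add: "\<And>\<phi> \<psi>. \<phi> \<in> L2 \<nu> \<Longrightarrow> \<psi> \<in> L2 \<nu> \<Longrightarrow> AE x in \<nu>. T (\<lambda>y. \<phi> y + \<psi> y) x = T \<phi> x + T \<psi> x"
    and scale: "\<And>a \<phi>. \<phi> \<in> L2 \<nu> \<Longrightarrow> AE x in \<nu>. T (\<lambda>y. a *\<^sub>C \<phi> y) x = a *\<^sub>C T \<phi> x"
    using T unfolding L2_bounded_operator_def by auto
  show ?thesis
    using \<open>finite J\<close>
  proof induction
    case empty
    have "(\<lambda>_. 0 :: 'h) \<in> L2 \<nu>" using L2(1)[of "{}"] by simp
    \<comment> \<open>Homogeneity with the scalar 0 shows that \<open>T\<close> sends zero to zero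
      almost everywhere.\<close>
    from scale[OF this, of 0] show ?case by simp
  next
    case (insert j J)
    have "AE x in \<nu>. T (\<lambda>y. a j *\<^sub>C \<beta> j y + (\<Sum>j\<in>J. a j *\<^sub>C \<beta> j y)) x =
        T (\<lambda>y. a j *\<^sub>C \<beta> j y) x + T (\<lambda>y. \<Sum>j\<in>J. a j *\<^sub>C \<beta> j y) x"
      by (rule add[OF L2(3) L2(1)])
    with scale[OF L2(2)[of j], of "a j"] insert.IH show ?case
      by eventually_elim (use insert.hyps in simp)
  qed
qed

text \<open>Both a vector and its image are cut down to finitely many atoms. With \<open>n\<close>
  the operator norm, some vector of the unit ball has image of squared norm above
  \<open>n^2/4\<close>. Cutting the vector leaves at least \<open>n^2/16\<close>, cutting the image
  at least \<open>n^2/32\<close>.\<close>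

lemma L2_operator_truncation:
  fixes T :: "('x \<Rightarrow> 'h::complex_hilbert_space) \<Rightarrow> 'x \<Rightarrow> 'h"
  assumes T: "L2_bounded_operator \<nu> T" and pos: "0 < L2_operator_norm \<nu> T"
  obtains \<phi> F where "finite F" "F \<subseteq> X" "\<forall>x\<in>F. 0 < measure \<nu> {x}"
    "\<forall>x. x \<notin> F \<longrightarrow> \<phi> x = 0" "L2_norm \<nu> \<phi> \<le> 1"
    "(L2_operator_norm \<nu> T)\<^sup>2 / 32 \<le> (\<Sum>x\<in>F. measure \<nu> {x} * (norm (T \<phi> x))\<^sup>2)"
proof -
  let ?n = "L2_operator_norm \<nu> T"
  obtain C where C: "\<And>\<phi>. \<phi> \<in> L2 \<nu> \<Longrightarrow> L2_norm \<nu> (T \<phi>) \<le> C * L2_norm \<nu> \<phi>"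
    using T unfolding L2_bounded_operator_def by blast
  have TL2: "\<And>\<phi>. \<phi> \<in> L2 \<nu> \<Longrightarrow> T \<phi> \<in> L2 \<nu>"
    and add: "\<And>\<phi> \<psi>. \<phi> \<in> L2 \<nu> \<Longrightarrow> \<psi> \<in> L2 \<nu> \<Longrightarrow> AE x in \<nu>. T (\<lambda>y. \<phi> y + \<psi> y) x = T \<phi> x + T \<psi> x"
    using T unfolding L2_bounded_operator_def by auto
  have "(\<lambda>_. 0) \<in> {\<phi> \<in> L2 \<nu>. L2_norm \<nu> (\<phi> :: 'x \<Rightarrow> 'h) \<le> 1}"
    using finite_support_L2(1)[of "{}" "\<lambda>_. 0::'h"] by (simp add: L2_norm_def)
  then have "(\<lambda>\<phi>. L2_norm \<nu> (T \<phi>)) ` {\<phi> \<in> L2 \<nu>. L2_norm \<nu> \<phi> \<le> 1} \<noteq> {}" by blast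
  moreover have "?n / 2 < Sup ((\<lambda>\<phi>. L2_norm \<nu> (T \<phi>)) ` {\<phi> \<in> L2 \<nu>. L2_norm \<nu> \<phi> \<le> 1})"
    using pos unfolding L2_operator_norm_def by linarith
  ultimately obtain \<phi>0 where \<phi>0: "\<phi>0 \<in> L2 \<nu>" "L2_norm \<nu> \<phi>0 \<le> 1" "?n / 2 < L2_norm \<nu> (T \<phi>0)"
    using less_cSupE by blast
  have n0: "?n\<^sup>2 / 4 < (L2_norm \<nu> (T \<phi>0))\<^sup>2"
    using power_strict_mono[OF \<phi>0(3), of 2] pos by (simp add: power_divide)
  \<comment> \<open>Chosen so that the discarded part of the vector has image of squared norm at
    most a sixteenth of \<open>?n^2\<close>; the summand 1 covers \<open>C = 0\<close>.\<close>
  define \<delta> where "\<delta> = ?n\<^sup>2 / (16 * (C\<^sup>2 + 1))"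
  have C1: "0 < C\<^sup>2 + 1" by (simp add: add_nonneg_pos)
  have \<delta>: "0 < \<delta>" using pos C1 by (simp add: \<delta>_def)
  obtain F1 where F1: "finite F1" "F1 \<subseteq> X" "\<And>x. x \<in> F1 \<Longrightarrow> 0 < measure \<nu> {x}"
    "(LINT x|\<nu>. (norm (\<phi>0 x))\<^sup>2 * indicator (- F1) x) < \<delta>"
    using L2_truncation[OF \<phi>0(1) \<delta>] by blast
  define \<phi> where "\<phi> x = (if x \<in> F1 then \<phi>0 x else 0)" for x
  define \<psi> where "\<psi> x = (if x \<in> F1 then 0 else \<phi>0 x)" for x
  have \<phi>L2: "\<phi> \<in> L2 \<nu>" by (rule finite_support_L2(1)[OF F1(1,2)]) (simp add: \<phi>_def)
  have int0: "integrable \<nu> (\<lambda>x. (norm (\<phi>0 x))\<^sup>2)" using \<phi>0(1) by (simp add: L2_def)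
  have \<psi>_eq: "(norm (\<psi> x))\<^sup>2 = (norm (\<phi>0 x))\<^sup>2 * indicator (- F1) x" for x
    by (simp add: \<psi>_def)
  have "integrable \<nu> (\<lambda>x. (norm (\<psi> x))\<^sup>2)"
    by (rule Bochner_Integration.integrable_bound[OF int0 borel_measurable]) (auto simp: \<psi>_def)
  then have \<psi>L2: "\<psi> \<in> L2 \<nu>" using borel_measurable by (simp add: L2_def)
  have \<psi>n: "(L2_norm \<nu> \<psi>)\<^sup>2 < \<delta>" unfolding L2_norm_power2 \<psi>_eq by (rule F1(4))
  have "(L2_norm \<nu> (T \<psi>))\<^sup>2 \<le> (C * L2_norm \<nu> \<psi>)\<^sup>2"
    using C[OF \<psi>L2] L2_norm_nonneg by (intro power_mono) auto
  also have "\<dots> \<le> C\<^sup>2 * \<delta>"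
    using \<psi>n by (simp add: power_mult_distrib mult_left_mono)
  also have "\<dots> \<le> (C\<^sup>2 + 1) * \<delta>" using \<delta> by (intro mult_right_mono) auto
  also have "\<dots> = ?n\<^sup>2 / 16"
  proof -
    have "x * (y / (16 * x)) = y / 16" if "0 < x" for x y :: real using that by simp
    then show ?thesis unfolding \<delta>_def using C1 by blast
  qed
  finally have T\<psi>: "(L2_norm \<nu> (T \<psi>))\<^sup>2 \<le> ?n\<^sup>2 / 16" .
  have "(\<lambda>y. \<phi> y + \<psi> y) = \<phi>0" by (auto simp: \<phi>_def \<psi>_def)
  then have "AE x in \<nu>. T \<phi>0 x = T \<phi> x + T \<psi> x" using add[OF \<phi>L2 \<psi>L2] by simp
  then have "AE x in \<nu>. (norm (T \<phi>0 x))\<^sup>2 \<le> 2 * (norm (T \<phi> x))\<^sup>2 + 2 * (norm (T \<psi> x))\<^sup>2"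
  proof eventually_elim
    case (elim x)
    have "(norm (T \<phi>0 x))\<^sup>2 \<le> (norm (T \<phi> x) + norm (T \<psi> x))\<^sup>2"
      unfolding elim by (intro power_mono norm_triangle_ineq) simp
    also have "\<dots> \<le> 2 * (norm (T \<phi> x))\<^sup>2 + 2 * (norm (T \<psi> x))\<^sup>2"
      using zero_le_power2[of "norm (T \<phi> x) - norm (T \<psi> x)"]
      by (simp add: power2_sum power2_diff)
    finally show ?case .
  qed
  then have "(LINT x|\<nu>. (norm (T \<phi>0 x))\<^sup>2) \<le>
      (LINT x|\<nu>. 2 * (norm (T \<phi> x))\<^sup>2 + 2 * (norm (T \<psi> x))\<^sup>2)"
    using TL2[OF \<phi>0(1)] TL2[OF \<phi>L2] TL2[OF \<psi>L2] by (intro integral_mono_AE) (auto simp: L2_def)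
  also have "\<dots> = 2 * (L2_norm \<nu> (T \<phi>))\<^sup>2 + 2 * (L2_norm \<nu> (T \<psi>))\<^sup>2"
    using TL2[OF \<phi>L2] TL2[OF \<psi>L2] by (simp add: L2_norm_power2 L2_def)
  finally have "(L2_norm \<nu> (T \<phi>0))\<^sup>2 \<le> 2 * (L2_norm \<nu> (T \<phi>))\<^sup>2 + 2 * (L2_norm \<nu> (T \<psi>))\<^sup>2"
    by (simp add: L2_norm_power2)
  then have T\<phi>: "?n\<^sup>2 / 16 \<le> (L2_norm \<nu> (T \<phi>))\<^sup>2" using n0 T\<psi> by linarith
  obtain F2 where F2: "finite F2" "F2 \<subseteq> X" "\<And>x. x \<in> F2 \<Longrightarrow> 0 < measure \<nu> {x}"
    "(LINT x|\<nu>. (norm (T \<phi> x))\<^sup>2 * indicator (- F2) x) < ?n\<^sup>2 / 32"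
    using L2_truncation[OF TL2[OF \<phi>L2], of "?n\<^sup>2 / 32"] pos by auto
  let ?g = "\<lambda>x. (norm (T \<phi> x))\<^sup>2"
  have intT: "integrable \<nu> ?g" using TL2[OF \<phi>L2] by (simp add: L2_def)
  have s: "has_bochner_integral \<nu> (\<lambda>x. ?g x * indicator F2 x) (\<Sum>x\<in>F2. measure \<nu> {x} *\<^sub>R (?g x * indicator F2 x))"
    using F2 by (intro integral_finite_support) auto
  have r: "integrable \<nu> (\<lambda>x. ?g x * indicator (- F2) x)"
    by (rule Bochner_Integration.integrable_bound[OF intT borel_measurable]) (auto simp: indicator_def)
  have "(LINT x|\<nu>. ?g x) = (LINT x|\<nu>. ?g x * indicator F2 x + ?g x * indicator (- F2) x)"
    by (intro Bochner_Integration.integral_cong HOL.refl) (auto simp: indicator_def)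
  also have "\<dots> = (\<Sum>x\<in>F2. measure \<nu> {x} * ?g x) + (LINT x|\<nu>. ?g x * indicator (- F2) x)"
    using s r by (subst Bochner_Integration.integral_add) (auto simp: has_bochner_integral_iff)
  finally have F2s: "?n\<^sup>2 / 32 \<le> (\<Sum>x\<in>F2. measure \<nu> {x} * ?g x)"
    using T\<phi> F2(4) by (simp add: L2_norm_power2)
  also have "\<dots> \<le> (\<Sum>x\<in>F1 \<union> F2. measure \<nu> {x} * ?g x)"
    using F1(1) F2(1) by (intro sum_mono2) auto
  finally have main: "?n\<^sup>2 / 32 \<le> (\<Sum>x\<in>F1 \<union> F2. measure \<nu> {x} * ?g x)" .
  have "(L2_norm \<nu> \<phi>)\<^sup>2 \<le> (L2_norm \<nu> \<phi>0)\<^sup>2"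
    using finite_support_L2(2)[OF F1(1,2), of \<phi>] sum_atoms_le_L2_norm[OF F1(1,2) \<phi>0(1)]
    by (simp add: \<phi>_def)
  then have "L2_norm \<nu> \<phi> \<le> L2_norm \<nu> \<phi>0" by (rule power2_le_imp_le) (rule L2_norm_nonneg)
  then have "L2_norm \<nu> \<phi> \<le> 1" using \<phi>0(2) by linarith
  then show thesis
    using that[of "F1 \<union> F2" \<phi>] F1 F2 main by (auto simp: \<phi>_def)
qed

end

text \<open>After truncation the operator is compressed to finitely many vectors, each carried by
  one atom and pointing in one direction of \<open>H\<close>. Hence the matrices are indexed by
  pairs from \<open>'x \<times> 'h\<close>.\<close>

lemma matrix_localization_imp_operator_norm_localization:
  fixes m :: "'x metric"
  assumes nontriv: "(h :: 'h::{complex_hilbert_space, second_countable_topology}) \<noteq> 0"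
    and top: "mtopology_of m = discrete_topology (mspace m)"
    and countable: "countable (mspace m)"
    and c: "0 < c" and ml: "\<forall>k. \<exists>D. matrix_localization TYPE('x \<times> 'h) m c k D"
  shows "operator_norm_localization TYPE('h) m"
proof -
  obtain D where D: "matrix_localization TYPE('x \<times> 'h) m c k (D k)" for k
    using ml by metis
  \<comment> \<open>Partial sums turn the diameter bounds into a monotone function of the
    scale.\<close>
  define f where "f k = (\<Sum>l\<le>k. D l)" for k
  have "mono f" unfolding f_def by (intro monoI sum_mono2) auto
  have Df: "D k \<le> f k" for k unfolding f_def by (rule member_le_sum) auto
  \<comment> \<open>The root undoes the squaring, the factor \<open>1/32\<close> is the loss from
    truncation, and the minimum ensures \<open>c' \<le> 1\<close>.\<close>
  define c' where "c' = min 1 (sqrt (c / 32))"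
  have c': "0 < c'" "c' \<le> 1" using c by (auto simp: c'_def)
  have "c' \<le> sqrt (c / 32)" by (simp add: c'_def)
  then have c'2: "c'\<^sup>2 \<le> c / 32" using c' c power_mono[of c' "sqrt (c / 32)" 2] by simp
  have "\<exists>\<phi>\<in>L2 \<nu>. \<not> (AE x in \<nu>. \<phi> x = 0) \<and>
      set_diameter m (L2_support m \<nu> \<phi>) \<le> of_nat (f k) \<and>
      L2_norm \<nu> (T \<phi>) \<ge> c' * L2_operator_norm \<nu> T * L2_norm \<nu> \<phi>"
    if lf: "locally_finite_borel_measure m \<nu>" and nz: "emeasure \<nu> (space \<nu>) \<noteq> 0"
      and T: "T \<in> propagation_operators m \<nu> (real k)" for \<nu> k and T :: "('x \<Rightarrow> 'h) \<Rightarrow> 'x \<Rightarrow> 'h"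
  proof -
    have sets: "sets \<nu> = Pow (mspace m)"
      using lf unfolding locally_finite_borel_measure_discrete[OF top] by blast
    have fin: "emeasure \<nu> {x} < \<infinity>" if "x \<in> mspace m" for x
    proof -
      have "Metric_space.mbounded (mspace m) (mdist m) {x}"
        using that by (simp add: Metric_space.mbounded_insert Metric_space.mbounded_empty)
      then show ?thesis
        using lf that unfolding locally_finite_borel_measure_discrete[OF top] sets by blast
    qed
    interpret discrete_measure \<nu> "mspace m"
      by unfold_locales (use sets fin countable in auto)
    have bdd: "L2_bounded_operator \<nu> T" using T by (simp add: propagation_operators_def)
    have supp: "L2_support m \<nu> \<phi> \<subseteq> {x \<in> mspace m. \<phi> x \<noteq> 0}" for \<phi> :: "'x \<Rightarrow> 'h"
      by (rule L2_support_discrete_subset[OF sets top])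
    show ?thesis
    proof (cases "0 < L2_operator_norm \<nu> T")
      \<comment> \<open>The required lower bound is then not positive, so a nonzero function carried
        by one atom suffices.\<close>
      case False
      have "\<exists>x\<in>mspace m. 0 < measure \<nu> {x}"
      proof (rule ccontr)
        assume no: "\<not> ?thesis"
        have "AE x in \<nu>. False" using AE_atoms by eventually_elim (use no in auto)
        then obtain N where "{x \<in> space \<nu>. \<not> False} \<subseteq> N" "emeasure \<nu> N = 0" "N \<in> sets \<nu>"
          by (rule AE_E)
        then have "emeasure \<nu> (space \<nu>) \<le> 0" using emeasure_mono[of "space \<nu>" N \<nu>] by simp
        then show False using nz by simp
      qed
      then obtain x where x: "x \<in> mspace m" "0 < measure \<nu> {x}" by blast
      define \<phi> where "\<phi> y = (if y = x then h else 0)" for y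
      have "\<phi> \<in> L2 \<nu>" using x by (intro finite_support_L2(1)[of "{x}"]) (auto simp: \<phi>_def)
      moreover have "\<not> (AE y in \<nu>. \<phi> y = 0)"
      proof
        assume "AE y in \<nu>. \<phi> y = 0"
        then have "\<phi> x = 0" using not_AE_zero_at_atom[OF sets x(1)] x measure_pos_iff by blast
        then show False using nontriv by (simp add: \<phi>_def)
      qed
      moreover have "L2_support m \<nu> \<phi> \<subseteq> {x}" using supp[of \<phi>] by (auto simp: \<phi>_def split: if_splits)
      then have "set_diameter m (L2_support m \<nu> \<phi>) \<le> of_nat (f k)"
        unfolding set_diameter_le_iff using x(1) mdist_zero[of x m x] by (metis of_nat_0_le_iff singletonD subsetD)
      moreover have "c' * L2_operator_norm \<nu> T * L2_norm \<nu> \<phi> \<le> 0"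
        using False c' L2_norm_nonneg[of \<nu> \<phi>] by (simp add: mult_nonneg_nonpos mult_nonpos_nonneg)
      then have "c' * L2_operator_norm \<nu> T * L2_norm \<nu> \<phi> \<le> L2_norm \<nu> (T \<phi>)"
        using L2_norm_nonneg[of \<nu> "T \<phi>"] by linarith
      ultimately show ?thesis by blast
    next
      case True
      obtain \<phi>1 F where F': "finite F" "F \<subseteq> mspace m" "\<forall>x\<in>F. 0 < measure \<nu> {x}"
        and \<phi>1': "\<forall>x. x \<notin> F \<longrightarrow> \<phi>1 x = 0" "L2_norm \<nu> \<phi>1 \<le> 1"
        and big: "(L2_operator_norm \<nu> T)\<^sup>2 / 32 \<le> (\<Sum>x\<in>F. measure \<nu> {x} * (norm (T \<phi>1 x))\<^sup>2)"
        using L2_operator_truncation[OF bdd True] .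
      have F: "finite F" "F \<subseteq> mspace m" "\<And>x. x \<in> F \<Longrightarrow> 0 < measure \<nu> {x}"
        and \<phi>1: "\<And>x. x \<notin> F \<Longrightarrow> \<phi>1 x = 0" "L2_norm \<nu> \<phi>1 \<le> 1"
        using F' \<phi>1' by auto
      \<comment> \<open>\<open>B\<close> expands the values of both \<open>\<phi>1\<close> and
        \<open>T \<phi>1\<close>, so neither loses mass when written in coordinates.\<close>
      obtain B :: "'h set" where B: "finite B" "orthonormal_on B (\<lambda>e. e)"
        "\<forall>v\<in>\<phi>1 ` F \<union> T \<phi>1 ` F. v = (\<Sum>e\<in>B. cinner v e *\<^sub>C e)"
        using finite_orthonormal_expansion[of "\<phi>1 ` F \<union> T \<phi>1 ` F"] F(1) by auto
      define I where "I = F \<times> B"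
      define w where "w x = sqrt (measure \<nu> {x})" for x
      have w: "0 < w x" if "x \<in> F" for x using F(3)[OF that] by (simp add: w_def)
      have w2: "(w x)\<^sup>2 = measure \<nu> {x}" for x by (simp add: w_def)
      \<comment> \<open>The factor \<open>1 / w\<close> makes the \<open>\<beta> j\<close> with
        \<open>j\<close> in \<open>I\<close> orthonormal in \<open>L2\<close>. With respect to them,
        \<open>t\<close> is the matrix of \<open>T\<close> and \<open>u\<close> the coordinate
        vector of \<open>\<phi>1\<close>.\<close>
      define \<beta> where "\<beta> j y = (if y = fst j \<and> fst j \<in> F then complex_of_real (1 / w y) *\<^sub>C snd j else 0)"
        for j :: "'x \<times> 'h" and y
      define t where "t i j = cinner (T (\<beta> j) (fst i)) (snd i) * complex_of_real (w (fst i))" for i j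
      define u where "u j = cinner (\<phi>1 (fst j)) (snd j) * complex_of_real (w (fst j))" for j
      define emb where "emb v y = (\<Sum>j\<in>I. v j *\<^sub>C \<beta> j y)" for v y
      have fI: "finite I" using F B by (simp add: I_def)
      have \<beta>0: "\<beta> j y = 0" if "y \<notin> F" for j y using that by (auto simp: \<beta>_def)
      have emb0: "emb v y = 0" if "y \<notin> F" for v y using \<beta>0[OF that] by (simp add: emb_def)
      have embF: "emb v y = (\<Sum>e\<in>B. (v (y, e) * complex_of_real (1 / w y)) *\<^sub>C e)" if "y \<in> F" for v y
      proof -
        have "emb v y = (\<Sum>x\<in>F. \<Sum>e\<in>B. v (x, e) *\<^sub>C \<beta> (x, e) y)"
          unfolding emb_def I_def by (simp add: sum.cartesian_product)
        also have "\<dots> = (\<Sum>x\<in>F. if x = y then \<Sum>e\<in>B. (v (y, e) * complex_of_real (1 / w y)) *\<^sub>C e else 0)"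
          using that by (intro sum.cong HOL.refl) (auto simp: \<beta>_def scaleC_scaleC)
        finally show ?thesis using that F(1) by simp
      qed
      have embL2: "emb v \<in> L2 \<nu>" for v by (rule finite_support_L2(1)[OF F(1,2) emb0])
      have norm_emb: "(L2_norm \<nu> (emb v))\<^sup>2 = sqnorm I v" for v
      proof -
        have "(L2_norm \<nu> (emb v))\<^sup>2 = (\<Sum>y\<in>F. (w y)\<^sup>2 * (norm (emb v y))\<^sup>2)"
          unfolding w2 by (rule finite_support_L2(2)[OF F(1,2) emb0])
        also have "\<dots> = (\<Sum>y\<in>F. \<Sum>e\<in>B. (cmod (v (y, e)))\<^sup>2)"
        proof (intro sum.cong HOL.refl)
          fix y assume y: "y \<in> F"
          have "(norm (emb v y))\<^sup>2 = (\<Sum>e\<in>B. (cmod (v (y, e) * complex_of_real (1 / w y)))\<^sup>2)"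
            unfolding embF[OF y] by (rule norm_orthonormal_sum[OF B(1,2)])
          also have "\<dots> = (1 / w y)\<^sup>2 * (\<Sum>e\<in>B. (cmod (v (y, e)))\<^sup>2)"
            by (simp add: norm_mult norm_divide power_mult_distrib power_divide sum_distrib_left
                mult.commute del: of_real_divide)
          finally show "(w y)\<^sup>2 * (norm (emb v y))\<^sup>2 = (\<Sum>e\<in>B. (cmod (v (y, e)))\<^sup>2)"
            using w[OF y] by (simp add: power_divide)
        qed
        finally show ?thesis by (simp add: sqnorm_def I_def sum.cartesian_product)
      qed
      have emb_u: "emb u = \<phi>1"
      proof
        fix y show "emb u y = \<phi>1 y"
        proof (cases "y \<in> F")
          case y: True
          have "emb u y = (\<Sum>e\<in>B. cinner (\<phi>1 y) e *\<^sub>C e)"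
            unfolding embF[OF y] u_def using w[OF y] by (intro sum.cong HOL.refl) simp
          then show ?thesis using B(3) y by auto
        qed (simp add: emb0 \<phi>1)
      qed
      have mv: "mat_vec I t v (y, e) = cinner (T (emb v) y) e * complex_of_real (w y)" if "y \<in> F" for v y e
      proof -
        have "AE x in \<nu>. T (emb v) x = (\<Sum>j\<in>I. v j *\<^sub>C T (\<beta> j) x)"
          unfolding emb_def by (rule L2_operator_sum[OF bdd F(1,2) \<beta>0 fI])
        then have "T (emb v) y = (\<Sum>j\<in>I. v j *\<^sub>C T (\<beta> j) y)"
          using not_AE_zero_at_atom[OF sets, of y] that F measure_pos_iff by auto
        then show ?thesis
          by (simp add: mat_vec_def t_def cinner_sum_left cinner_scaleC_left sum_distrib_left
              mult.commute mult.left_commute)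
      qed
      have sq_mv: "sqnorm I (mat_vec I t v) =
          (\<Sum>y\<in>F. measure \<nu> {y} * (\<Sum>e\<in>B. (cmod (cinner (T (emb v) y) e))\<^sup>2))" for v
      proof -
        have "sqnorm I (mat_vec I t v) = (\<Sum>y\<in>F. \<Sum>e\<in>B. (cmod (mat_vec I t v (y, e)))\<^sup>2)"
          by (simp add: sqnorm_def I_def sum.cartesian_product)
        also have "\<dots> = (\<Sum>y\<in>F. \<Sum>e\<in>B. (w y)\<^sup>2 * (cmod (cinner (T (emb v) y) e))\<^sup>2)"
          by (intro sum.cong HOL.refl) (simp add: mv norm_mult power_mult_distrib mult.commute)
        finally show ?thesis by (simp add: sum_distrib_left w2)
      qed
      have TL2: "T (emb v) \<in> L2 \<nu>" for v using bdd embL2 unfolding L2_bounded_operator_def by blast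
      have mv_le: "sqnorm I (mat_vec I t v) \<le> (L2_norm \<nu> (T (emb v)))\<^sup>2" for v
      proof -
        have "sqnorm I (mat_vec I t v) \<le> (\<Sum>y\<in>F. measure \<nu> {y} * (norm (T (emb v) y))\<^sup>2)"
          unfolding sq_mv by (intro sum_mono mult_left_mono Bessel_inequality B) auto
        also have "\<dots> \<le> (L2_norm \<nu> (T (emb v)))\<^sup>2" by (rule sum_atoms_le_L2_norm[OF F(1,2) TL2])
        finally show ?thesis .
      qed
      \<comment> \<open>For \<open>u\<close> Bessel's inequality is an equality, because
        \<open>B\<close> expands \<open>T \<phi>1\<close> on \<open>F\<close>.\<close>
      have "(norm (T \<phi>1 y))\<^sup>2 = (\<Sum>e\<in>B. (cmod (cinner (T \<phi>1 y) e))\<^sup>2)" if "y \<in> F" for y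
        using norm_orthonormal_sum[OF B(1,2), of "\<lambda>e. cinner (T \<phi>1 y) e"] B(3) that by auto
      then have mv_u: "(L2_operator_norm \<nu> T)\<^sup>2 / 32 \<le> sqnorm I (mat_vec I t u)"
        unfolding sq_mv emb_u using big by simp
      have u1: "sqnorm I u \<le> 1"
        using norm_emb[of u] \<phi>1(2) L2_norm_nonneg[of \<nu> \<phi>1] unfolding emb_u
        by (metis power_le_one)
      \<comment> \<open>Up to a positive factor, an entry of \<open>t\<close> is the inner product
        of \<open>T (\<beta> j)\<close> with a function carried by one atom, and finite propagation
        applies to it.\<close>
      have t_prop: "mdist m (fst i) (fst j) \<le> real k" if i: "i \<in> I" and j: "j \<in> I" and tn: "t i j \<noteq> 0" for i j
      proof (rule ccontr)
        assume far: "\<not> ?thesis"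
        obtain y e where y: "i = (y, e)" "y \<in> F" using i by (auto simp: I_def)
        obtain x e' where x: "j = (x, e')" "x \<in> F" using j by (auto simp: I_def)
        define \<psi> where "\<psi> z = (if z = y then e else 0)" for z
        have L: "\<beta> j \<in> L2 \<nu>" "\<psi> \<in> L2 \<nu>"
          using F y x \<beta>0 by (auto intro!: finite_support_L2(1)[of F] simp: \<psi>_def)
        have "ennreal (mdist m x y) \<le> set_distance m (L2_support m \<nu> (\<beta> j)) (L2_support m \<nu> \<psi>)"
          unfolding set_distance_def using supp[of "\<beta> j"] supp[of \<psi>] x
          by (intro INF_greatest) (auto simp: \<beta>_def \<psi>_def split: if_splits)
        moreover have "ennreal (real k) < ennreal (mdist m x y)"
          using far x y by (simp add: mdist_commute ennreal_lessI not_le)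
        ultimately have "ennreal (real k) < set_distance m (L2_support m \<nu> (\<beta> j)) (L2_support m \<nu> \<psi>)"
          by (rule less_le_trans[rotated])
        then have "L2_inner \<nu> (T (\<beta> j)) \<psi> = 0"
          using T L unfolding propagation_operators_def by blast
        moreover have "has_bochner_integral \<nu> (\<lambda>z. cinner (T (\<beta> j) z) (\<psi> z))
            (\<Sum>z\<in>{y}. measure \<nu> {z} *\<^sub>R cinner (T (\<beta> j) z) (\<psi> z))"
          using y F by (intro integral_finite_support) (auto simp: \<psi>_def)
        ultimately have "measure \<nu> {y} *\<^sub>R cinner (T (\<beta> j) y) e = 0"
          unfolding L2_inner_def by (simp add: has_bochner_integral_iff \<psi>_def)
        then show False using tn y F(3)[of y] by (simp add: t_def)
      qed
      have fst_I: "fst ` I \<subseteq> mspace m" using F by (auto simp: I_def)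
      have mv_pos: "0 < sqnorm I (mat_vec I t u)" using mv_u True by (smt (verit) divide_pos_pos zero_less_power)
      obtain v where v: "0 < sqnorm I v"
        "\<forall>i\<in>I. \<forall>j\<in>I. v i \<noteq> 0 \<and> v j \<noteq> 0 \<longrightarrow> mdist m (fst i) (fst j) \<le> real (D k)"
        "c * sqnorm I (mat_vec I t u) * sqnorm I v \<le> sqnorm I (mat_vec I t v) * sqnorm I u"
        using D[of k, unfolded matrix_localization_def, rule_format, of I fst t u]
          fI fst_I t_prop mv_pos by blast
      have "c'\<^sup>2 * (L2_operator_norm \<nu> T)\<^sup>2 * (L2_norm \<nu> (emb v))\<^sup>2 \<le>
          c / 32 * (L2_operator_norm \<nu> T)\<^sup>2 * (L2_norm \<nu> (emb v))\<^sup>2"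
        using c'2 by (intro mult_right_mono) auto
      also have "\<dots> = c * ((L2_operator_norm \<nu> T)\<^sup>2 / 32) * sqnorm I v" by (simp add: norm_emb)
      also have "\<dots> \<le> c * sqnorm I (mat_vec I t u) * sqnorm I v"
        using mv_u c by (intro mult_right_mono mult_left_mono) auto
      also have "\<dots> \<le> sqnorm I (mat_vec I t v) * sqnorm I u" by (rule v(3))
      also have "\<dots> \<le> sqnorm I (mat_vec I t v) * 1" using u1 by (intro mult_left_mono) auto
      also have "\<dots> \<le> (L2_norm \<nu> (T (emb v)))\<^sup>2" using mv_le by simp
      finally have "(c' * L2_operator_norm \<nu> T * L2_norm \<nu> (emb v))\<^sup>2 \<le> (L2_norm \<nu> (T (emb v)))\<^sup>2"
        by (simp add: power_mult_distrib)
      then have "c' * L2_operator_norm \<nu> T * L2_norm \<nu> (emb v) \<le> L2_norm \<nu> (T (emb v))"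
        by (rule power2_le_imp_le) (rule L2_norm_nonneg)
      moreover have "\<not> (AE x in \<nu>. emb v x = 0)"
      proof
        assume "AE x in \<nu>. emb v x = 0"
        then have "(LINT x|\<nu>. (norm (emb v x))\<^sup>2) = (LINT x|\<nu>. 0)"
          by (intro integral_cong_AE borel_measurable) auto
        then show False using norm_emb[of v] v(1) by (simp add: L2_norm_power2)
      qed
      moreover have "set_diameter m (L2_support m \<nu> (emb v)) \<le> of_nat (f k)"
        unfolding set_diameter_le_iff
      proof (intro ballI)
        fix x y assume "x \<in> L2_support m \<nu> (emb v)" "y \<in> L2_support m \<nu> (emb v)"
        then have nz: "emb v x \<noteq> 0" "emb v y \<noteq> 0" using supp[of "emb v"] by auto
        have "\<exists>e\<in>B. v (z, e) \<noteq> 0 \<and> z \<in> F" if "emb v z \<noteq> 0" for z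
        proof (rule ccontr)
          assume no: "\<not> ?thesis"
          have "z \<in> F" using emb0 that by blast
          then have "emb v z = 0" using no by (simp add: embF)
          then show False using that by simp
        qed
        from this[OF nz(1)] this[OF nz(2)] obtain e e' where
          "(x, e) \<in> I" "(y, e') \<in> I" "v (x, e) \<noteq> 0" "v (y, e') \<noteq> 0" by (auto simp: I_def)
        then have "mdist m x y \<le> real (D k)" using v(2) by force
        then show "mdist m x y \<le> real (f k)" using Df[of k] by linarith
      qed
      ultimately show ?thesis using embL2 by blast
    qed
  qed
  then show ?thesis
    unfolding operator_norm_localization_def using c' \<open>mono f\<close> by blast
qed

section \<open>Normal forms in HNN extensions\<close>

text \<open>A transversal of the left cosets of \<open>C\<close>. Representing \<open>C\<close> by
  the identity lets a trivial representative detect membership in \<open>C\<close>; the uniqueness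
  of normal forms relies on this.\<close>

definition coset_rep :: "('a, 'b) monoid_scheme \<Rightarrow> 'a set \<Rightarrow> 'a \<Rightarrow> 'a" where
  "coset_rep G C g = (if g \<in> C then \<one>\<^bsub>G\<^esub> else (SOME r. r \<in> carrier G \<and> inv\<^bsub>G\<^esub> r \<otimes>\<^bsub>G\<^esub> g \<in> C))"

lemma (in group) coset_rep:
  assumes C: "subgroup C G" and g: "g \<in> carrier G"
  shows coset_rep_closed: "coset_rep G C g \<in> carrier G"
    and coset_rep_inv_mult: "inv (coset_rep G C g) \<otimes> g \<in> C"
proof -
  have "\<exists>r. r \<in> carrier G \<and> inv r \<otimes> g \<in> C"
    using g subgroup.one_closed[OF C] by (intro exI[of _ g]) simp
  from someI_ex[OF this] show "coset_rep G C g \<in> carrier G" "inv (coset_rep G C g) \<otimes> g \<in> C"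
    using g by (auto simp: coset_rep_def)
qed

lemma (in group) inv_mult_mem_subgroup_iff:
  assumes C: "subgroup C G" and g: "g \<in> carrier G" "r \<in> carrier G" and c: "c \<in> C"
  shows "inv r \<otimes> (g \<otimes> c) \<in> C \<longleftrightarrow> inv r \<otimes> g \<in> C"
proof -
  have cc: "c \<in> carrier G" using C c by (rule subgroup.mem_carrier)
  have e: "inv r \<otimes> (g \<otimes> c) = inv r \<otimes> g \<otimes> c" using g cc by (simp add: m_assoc)
  have "inv r \<otimes> g = inv r \<otimes> g \<otimes> c \<otimes> inv c" using g cc by (simp add: m_assoc)
  then show ?thesis
    unfolding e using subgroup.m_closed[OF C] subgroup.m_inv_closed[OF C c] c by metis
qed

lemma (in group) mult_mem_subgroup_iff:
  assumes C: "subgroup C G" and g: "g \<in> carrier G" and c: "c \<in> C"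
  shows "g \<otimes> c \<in> C \<longleftrightarrow> g \<in> C"
  using inv_mult_mem_subgroup_iff[OF C g one_closed c] g subgroup.mem_carrier[OF C c] by simp

text \<open>The predicate under \<open>SOME\<close> is the same for \<open>g\<close> and
  \<open>g \<otimes> c\<close>, so the choice depends only on the coset.\<close>

lemma (in group) coset_rep_mult:
  assumes C: "subgroup C G" and g: "g \<in> carrier G" and c: "c \<in> C"
  shows "coset_rep G C (g \<otimes> c) = coset_rep G C g"
proof -
  have "(\<lambda>r. r \<in> carrier G \<and> inv r \<otimes> (g \<otimes> c) \<in> C) = (\<lambda>r. r \<in> carrier G \<and> inv r \<otimes> g \<in> C)"
    using inv_mult_mem_subgroup_iff[OF C g _ c] by blast
  then show ?thesis by (simp add: coset_rep_def mult_mem_subgroup_iff[OF C g c])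
qed

lemma (in group) coset_rep_idem:
  assumes C: "subgroup C G" and g: "g \<in> carrier G"
  shows "coset_rep G C (coset_rep G C g) = coset_rep G C g"
proof -
  let ?r = "coset_rep G C g"
  have r: "?r \<in> carrier G" "inv ?r \<otimes> g \<in> C" using coset_rep[OF C g] .
  then have "?r \<otimes> (inv ?r \<otimes> g) = g" using g by (simp flip: m_assoc)
  then show ?thesis using coset_rep_mult[OF C r] by simp
qed

lemma (in group) coset_rep_eq_one_iff:
  assumes C: "subgroup C G" and g: "g \<in> carrier G"
  shows "coset_rep G C g = \<one> \<longleftrightarrow> g \<in> C"
proof
  assume "coset_rep G C g = \<one>"
  then show "g \<in> C" using coset_rep_inv_mult[OF C g] g by simp
qed (simp add: coset_rep_def)

text \<open>The sign \<open>True\<close> stands for \<open>t\<close> and \<open>False\<close> for \<open>t\<^sup>-\<^sup>1\<close>. A state \<open>([(r\<^sub>n, s\<^sub>n), \<dots>, (r\<^sub>1, s\<^sub>1)], g)\<close>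
  encodes the normal form \<open>r\<^sub>1 t\<^bsup>s1\<^esup> \<dots> r\<^sub>n t\<^bsup>sn\<^esup> g\<close>, so that the list, read modulo right
  multiplication by \<open>G\<close>, is a vertex of the Bass-Serre tree and its tail is the parent vertex.\<close>

type_synonym 'a hnn_state = "('a \<times> bool) list \<times> 'a"

section \<open>Action of words on normal forms\<close>

locale hnn_extension = group G for G :: "('a, 'b) monoid_scheme" (structure) +
  fixes A :: "'a set" and \<theta> :: "'a \<Rightarrow> 'a"
  assumes subgroup_A: "subgroup A G" and mon: "\<theta> \<in> mon (G\<lparr>carrier := A\<rparr>) G"
begin

abbreviation hcong :: "('a hnn_letter list \<times> 'a hnn_letter list) set" where
  "hcong \<equiv> hnn_congruence G A \<theta>"

abbreviation K :: "'a hnn_letter list set monoid" where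
  "K \<equiv> HNN G A \<theta>"

text \<open>The elements that pass through a stable letter from the left:
  \<open>c t^s = t^s (transfer s c)\<close>. For \<open>t\<close> these form
  \<open>\<theta>(A)\<close>, since the relation reads \<open>\<theta>(a) t = t a\<close>.\<close>

definition assoc_subgroup :: "bool \<Rightarrow> 'a set" where
  "assoc_subgroup s = (if s then \<theta> ` A else A)"

definition transfer :: "bool \<Rightarrow> 'a \<Rightarrow> 'a" where
  "transfer s = (if s then the_inv_into A \<theta> else \<theta>)"

abbreviation rep :: "bool \<Rightarrow> 'a \<Rightarrow> 'a" where
  "rep s \<equiv> coset_rep G (assoc_subgroup s)"

lemma group_hom_\<theta>: "group_hom (G\<lparr>carrier := A\<rparr>) G \<theta>"
  using mon subgroup.subgroup_is_group[OF subgroup_A is_group] is_group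
  by (auto simp: group_hom_def group_hom_axioms_def mon_def)

lemma inj_on_\<theta>: "inj_on \<theta> A"
  using mon by (simp add: mon_def)

lemma subgroup_assoc: "subgroup (assoc_subgroup s) G"
  using group_hom.img_is_subgroup[OF group_hom_\<theta>] subgroup_A by (simp add: assoc_subgroup_def)

lemma assoc_closed: "c \<in> assoc_subgroup s \<Longrightarrow> c \<in> carrier G"
  by (rule subgroup.mem_carrier[OF subgroup_assoc])

lemma \<theta>_mult: "a \<in> A \<Longrightarrow> b \<in> A \<Longrightarrow> \<theta> (a \<otimes> b) = \<theta> a \<otimes> \<theta> b"
  using group_hom.hom_mult[OF group_hom_\<theta>, of a b] by simp

lemma \<theta>_one: "\<theta> \<one> = \<one>"
  using group_hom.hom_one[OF group_hom_\<theta>] by simp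

lemma transfer_in: "c \<in> assoc_subgroup s \<Longrightarrow> transfer s c \<in> assoc_subgroup (\<not> s)"
  by (auto simp: assoc_subgroup_def transfer_def the_inv_into_f_f[OF inj_on_\<theta>])

lemma transfer_closed: "c \<in> assoc_subgroup s \<Longrightarrow> transfer s c \<in> carrier G"
  by (rule assoc_closed[OF transfer_in])

lemma transfer_transfer: "c \<in> assoc_subgroup s \<Longrightarrow> transfer (\<not> s) (transfer s c) = c"
  by (auto simp: assoc_subgroup_def transfer_def the_inv_into_f_f[OF inj_on_\<theta>])

lemma transfer_mult:
  assumes "c \<in> assoc_subgroup s" "d \<in> assoc_subgroup s"
  shows "transfer s (c \<otimes> d) = transfer s c \<otimes> transfer s d"
proof (cases s)
  case True
  then obtain a b where ab: "a \<in> A" "b \<in> A" "c = \<theta> a" "d = \<theta> b"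
    using assms by (auto simp: assoc_subgroup_def)
  then have "c \<otimes> d = \<theta> (a \<otimes> b)" "a \<otimes> b \<in> A"
    using subgroup.m_closed[OF subgroup_A] by (simp_all add: \<theta>_mult)
  then show ?thesis
    using True ab by (simp add: transfer_def the_inv_into_f_f[OF inj_on_\<theta>])
qed (use assms in \<open>simp add: assoc_subgroup_def transfer_def \<theta>_mult\<close>)

text \<open>Right multiplication by \<open>t^s\<close>. Writing \<open>g = r c\<close> with
  \<open>c\<close> in the associated subgroup gives \<open>g t^s = r t^s (transfer s c)\<close>,
  which adds a pair. If the preceding stable letter makes this a pinch in the sense of Britton, the
  last pair is removed instead.\<close>

fun turn :: "bool \<Rightarrow> 'a hnn_state \<Rightarrow> 'a hnn_state" where
  "turn s ([], g) = ([(rep s g, s)], transfer s (inv (rep s g) \<otimes> g))"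
| "turn s ((r, s') # l, g) =
    (if g \<in> assoc_subgroup s \<and> s' \<noteq> s then (l, r \<otimes> transfer s g)
     else ((rep s g, s) # (r, s') # l, transfer s (inv (rep s g) \<otimes> g)))"

fun step :: "'a hnn_letter \<Rightarrow> 'a hnn_state \<Rightarrow> 'a hnn_state" where
  "step (Base h) (l, g) = (l, g \<otimes> h)"
| "step Stable st = turn True st"
| "step Stable_inv st = turn False st"

fun run :: "'a hnn_letter list \<Rightarrow> 'a hnn_state \<Rightarrow> 'a hnn_state" where
  "run [] st = st"
| "run (x # w) st = run w (step x st)"

text \<open>Among representatives only the trivial one lies in the associated subgroup, so the
  condition at \<open>r = \<one>\<close> excludes every pinch.\<close>

fun reduced :: "('a \<times> bool) list \<Rightarrow> bool" where
  "reduced [] \<longleftrightarrow> True"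
| "reduced ((r, s) # l) \<longleftrightarrow> r \<in> carrier G \<and> rep s r = r \<and>
     (r = \<one> \<longrightarrow> l = [] \<or> snd (hd l) = s) \<and> reduced l"

definition valid_state :: "'a hnn_state \<Rightarrow> bool" where
  "valid_state st \<longleftrightarrow> reduced (fst st) \<and> snd st \<in> carrier G"

lemma turn_push:
  assumes "\<not> (g \<in> assoc_subgroup s \<and> l \<noteq> [] \<and> snd (hd l) \<noteq> s)"
  shows "turn s (l, g) = ((rep s g, s) # l, transfer s (inv (rep s g) \<otimes> g))"
  using assms by (cases l) auto

lemma turn_pop:
  assumes "g \<in> assoc_subgroup s"
  shows "turn s ((r, \<not> s) # l, g) = (l, r \<otimes> transfer s g)"
  using assms by simp

lemma turn_cases:
  obtains (pop) r l' where "l = (r, \<not> s) # l'" "g \<in> assoc_subgroup s"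
  | (push) "\<not> (g \<in> assoc_subgroup s \<and> l \<noteq> [] \<and> snd (hd l) \<noteq> s)"
proof (cases "g \<in> assoc_subgroup s \<and> l \<noteq> [] \<and> snd (hd l) \<noteq> s")
  case True
  then show thesis using pop[of "fst (hd l)" "tl l"] by (cases l) auto
next
  case False
  then show thesis by (rule push)
qed

lemma valid_turn:
  assumes "valid_state (l, g)"
  shows "valid_state (turn s (l, g))"
proof (cases rule: turn_cases[of l s g])
  case (pop r l')
  then show ?thesis using assms transfer_closed by (simp add: valid_state_def)
next
  case push
  have g: "g \<in> carrier G" using assms by (simp add: valid_state_def)
  then show ?thesis
    unfolding turn_push[OF push]
    using assms push coset_rep[OF subgroup_assoc g] coset_rep_idem[OF subgroup_assoc g]
      coset_rep_eq_one_iff[OF subgroup_assoc g] transfer_closed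
    by (auto simp: valid_state_def)
qed

text \<open>The relation \<open>t a t\<^sup>-\<^sup>1 = \<theta>(a)\<close> and, for \<open>a = 1\<close>, both cancellations.\<close>

lemma turn_turn:
  assumes v: "valid_state (l, g)" and a: "a \<in> assoc_subgroup (\<not> s)"
  shows "turn (\<not> s) (step (Base a) (turn s (l, g))) = (l, g \<otimes> transfer (\<not> s) a)"
proof (cases rule: turn_cases[of l s g])
  case (pop r l')
  have r: "r \<in> carrier G" "rep (\<not> s) r = r" "r = \<one> \<longrightarrow> l' = [] \<or> snd (hd l') = (\<not> s)"
    using v pop by (auto simp: valid_state_def)
  let ?c = "transfer s g \<otimes> a"
  have c: "transfer s g \<in> assoc_subgroup (\<not> s)" "?c \<in> assoc_subgroup (\<not> s)"
    using transfer_in[OF pop(2)] subgroup.m_closed[OF subgroup_assoc _ a] by auto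
  have rc: "rep (\<not> s) (r \<otimes> ?c) = r"
    using coset_rep_mult[OF subgroup_assoc r(1) c(2)] r by simp
  \<comment> \<open>After a removal the reverse turn must add a pair: for nontrivial
    \<open>r\<close> the product \<open>r \<otimes> ?c\<close> stays outside the subgroup, and for
    trivial \<open>r\<close> reducedness makes the next sign agree.\<close>
  have push: "\<not> (r \<otimes> ?c \<in> assoc_subgroup (\<not> s) \<and> l' \<noteq> [] \<and> snd (hd l') \<noteq> (\<not> s))"
    using coset_rep_eq_one_iff[OF subgroup_assoc r(1), of "\<not> s"]
      mult_mem_subgroup_iff[OF subgroup_assoc r(1) c(2)] r by auto
  have cc: "transfer s g \<in> carrier G" "a \<in> carrier G" using c(1) a assoc_closed by auto
  have "turn (\<not> s) (step (Base a) (turn s (l, g))) = turn (\<not> s) (l', r \<otimes> ?c)"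
    using pop r cc by (simp add: m_assoc)
  also have "\<dots> = ((r, \<not> s) # l', transfer (\<not> s) ?c)"
    unfolding turn_push[OF push] rc using r cc by (simp flip: m_assoc)
  also have "transfer (\<not> s) ?c = g \<otimes> transfer (\<not> s) a"
    by (simp add: transfer_mult[OF c(1) a] transfer_transfer[OF pop(2)])
  finally show ?thesis using pop by simp
next
  \<comment> \<open>Here the reverse turn removes the pair just added.\<close>
  case push
  have g: "g \<in> carrier G" using v by (simp add: valid_state_def)
  let ?r = "rep s g"
  let ?c = "inv ?r \<otimes> g"
  have r: "?r \<in> carrier G" "?c \<in> assoc_subgroup s" using coset_rep[OF subgroup_assoc g] .
  have c: "transfer s ?c \<in> assoc_subgroup (\<not> s)" by (rule transfer_in[OF r(2)])
  have ta: "transfer (\<not> s) a \<in> carrier G" by (rule transfer_closed[OF a])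
  have "turn (\<not> s) (step (Base a) (turn s (l, g))) = (l, ?r \<otimes> transfer (\<not> s) (transfer s ?c \<otimes> a))"
    unfolding turn_push[OF push] using turn_pop[of _ "\<not> s" ?r l] subgroup.m_closed[OF subgroup_assoc c a]
    by simp
  also have "transfer (\<not> s) (transfer s ?c \<otimes> a) = ?c \<otimes> transfer (\<not> s) a"
    by (simp add: transfer_mult[OF c a] transfer_transfer[OF r(2)])
  also have "?r \<otimes> (?c \<otimes> transfer (\<not> s) a) = g \<otimes> transfer (\<not> s) a"
    using r(1) g ta by (simp flip: m_assoc)
  finally show ?thesis .
qed

lemma turn_turn_cancel:
  assumes "valid_state (l, g)"
  shows "turn (\<not> s) (turn s (l, g)) = (l, g)"
proof -
  have 1: "\<one> \<in> assoc_subgroup s" for s by (rule subgroup.one_closed[OF subgroup_assoc])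
  have "transfer (\<not> s) \<one> = \<one>"
    using transfer_transfer[OF 1[of False]] by (cases s) (auto simp: transfer_def \<theta>_one)
  moreover have "step (Base \<one>) (turn s (l, g)) = turn s (l, g)"
    using valid_turn[OF assms, of s] by (cases "turn s (l, g)") (simp add: valid_state_def)
  ultimately show ?thesis
    using turn_turn[OF assms 1[of "\<not> s"]] assms by (simp add: valid_state_def)
qed

lemma valid_step: "valid_state st \<Longrightarrow> [x] \<in> hnn_words G \<Longrightarrow> valid_state (step x st)"
  by (cases x; cases st) (auto simp: valid_turn hnn_words_def, auto simp: valid_state_def)

lemma valid_run: "valid_state st \<Longrightarrow> w \<in> hnn_words G \<Longrightarrow> valid_state (run w st)"
proof (induction w arbitrary: st)
  case (Cons x w)
  then show ?case using valid_step[of st x] hnn_words_append[of "[x]" w G] by simp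
qed simp

lemma run_append: "run (u @ v) st = run v (run u st)"
  by (induction u arbitrary: st) auto

lemma run_relator:
  assumes "hnn_relator G A \<theta> x y" "valid_state st"
  shows "run x st = run y st"
  using assms(1)
proof cases
  case 1
  then show ?thesis using assms(2) by (cases st) (simp add: valid_state_def)
next
  case (2 g h)
  then show ?thesis using assms(2) by (cases st) (simp add: valid_state_def m_assoc)
next
  case 3
  then show ?thesis using assms(2) turn_turn_cancel[of "fst st" "snd st" True] by (cases st) simp
next
  case 4
  then show ?thesis using assms(2) turn_turn_cancel[of "fst st" "snd st" False] by (cases st) simp
next
  case (5 a)
  then have "a \<in> assoc_subgroup (\<not> True)" by (simp add: assoc_subgroup_def)
  from turn_turn[of "fst st" "snd st", OF _ this] show ?thesis
    using 5 assms(2) by (cases st) (simp add: transfer_def)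
qed

text \<open>Van der Waerden's argument: both sides of each relator act equally on valid states, so
  the state reached depends only on the group element. This gives the uniqueness of normal
  forms.\<close>

lemma run_congruence:
  "(v, w) \<in> hcong \<Longrightarrow> valid_state st \<Longrightarrow> run v st = run w st"
proof (induction arbitrary: st rule: hnn_congruence.induct)
  case (relator l r p s)
  then have "valid_state (run p st)" by (intro valid_run) auto
  with relator show ?case by (simp add: run_append run_relator)
qed auto

definition base_state :: "'a hnn_state" where
  "base_state = ([], \<one>)"

lemma valid_base_state: "valid_state base_state"
  by (simp add: valid_state_def base_state_def)

definition normal_form :: "'a hnn_letter list set \<Rightarrow> 'a hnn_state" where
  "normal_form X = run (SOME w. w \<in> X) base_state"

lemma normal_form_class:
  assumes "w \<in> hnn_words G"
  shows "normal_form (hcong `` {w}) = run w base_state"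
proof -
  have "w \<in> hcong `` {w}" using assms by (simp add: hnn_congruence.refl)
  then have "(SOME v. v \<in> hcong `` {w}) \<in> hcong `` {w}" by (rule someI)
  then have "(w, SOME v. v \<in> hcong `` {w}) \<in> hcong" by simp
  from run_congruence[OF this valid_base_state] show ?thesis unfolding normal_form_def by simp
qed

section \<open>Normal forms as words\<close>

fun stable_letter :: "bool \<Rightarrow> 'a hnn_letter" where
  "stable_letter True = Stable"
| "stable_letter False = Stable_inv"

fun list_word :: "('a \<times> bool) list \<Rightarrow> 'a hnn_letter list" where
  "list_word [] = []"
| "list_word ((r, s) # l) = list_word l @ [Base r, stable_letter s]"

definition state_word :: "'a hnn_state \<Rightarrow> 'a hnn_letter list" where
  "state_word st = list_word (fst st) @ [Base (snd st)]"

lemma stable_letter_word [simp]: "[stable_letter s] \<in> hnn_words G"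
  by (cases s) (auto simp: hnn_words_def)

lemma Base_word [simp]: "[Base g] \<in> hnn_words G \<longleftrightarrow> g \<in> carrier G"
  by (auto simp: hnn_words_def)

lemma Cons_word: "x # w \<in> hnn_words G \<longleftrightarrow> [x] \<in> hnn_words G \<and> w \<in> hnn_words G"
  using hnn_words_append[of "[x]" w G] by simp

lemma list_word_words: "reduced l \<Longrightarrow> list_word l \<in> hnn_words G"
proof (induction l rule: list_word.induct)
  case (2 r s l)
  then show ?case using Cons_word[of "Base r" "[stable_letter s]"] by simp
qed simp

lemma hcong_Base_mult:
  "g \<in> carrier G \<Longrightarrow> h \<in> carrier G \<Longrightarrow> ([Base g, Base h], [Base (g \<otimes> h)]) \<in> hcong"
  using hnn_congruence.relator[OF hnn_relator.intros(2)[of g G h A \<theta>], of "[]" "[]"]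
    Cons_word[of "Base g" "[Base h]"] by simp

lemma hcong_Base_one: "([Base \<one>], []) \<in> hcong"
  using hnn_congruence.relator[OF hnn_relator.intros(1)[of G A \<theta>], of "[]" "[]"] by simp

lemma hcong_cancel: "([stable_letter s, stable_letter (\<not> s)], []) \<in> hcong"
  using hnn_congruence.relator[OF hnn_relator.intros(3)[of G A \<theta>], of "[]" "[]"]
    hnn_congruence.relator[OF hnn_relator.intros(4)[of G A \<theta>], of "[]" "[]"]
  by (cases s) (auto simp: hnn_words_def)

text \<open>The defining relation multiplied by \<open>t\<close> on the right or by
  \<open>t^-1\<close> on the left, and cancelled.\<close>

lemma hcong_Base_stable:
  assumes "c \<in> assoc_subgroup s"
  shows "([Base c, stable_letter s], [stable_letter s, Base (transfer s c)]) \<in> hcong"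
proof -
  have main: "([Base (\<theta> a)], [Stable, Base a, Stable_inv]) \<in> hcong" if a: "a \<in> A" for a
  proof -
    have "a \<in> carrier G" "\<theta> a \<in> carrier G"
      using assoc_closed[of a False] assoc_closed[of "\<theta> a" True] a
      by (auto simp: assoc_subgroup_def)
    then have "([Stable, Base a, Stable_inv], [Base (\<theta> a)]) \<in> hcong"
      using hnn_congruence.relator[OF hnn_relator.intros(5)[of a A G \<theta>, OF a], of "[]" "[]"]
      by (simp add: hnn_words_def)
    then show ?thesis by (rule hnn_congruence.sym)
  qed
  have st: "[Stable] \<in> hnn_words G" "[Stable_inv] \<in> hnn_words G"
    using stable_letter_word[of True] stable_letter_word[of False] by auto
  show ?thesis
  proof (cases s)
    case True
    then obtain a where a: "a \<in> A" "c = \<theta> a" using assms by (auto simp: assoc_subgroup_def)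
    have ac: "a \<in> carrier G" using a subgroup.mem_carrier[OF subgroup_A] by blast
    have 1: "([Base (\<theta> a), Stable], [Stable, Base a, Stable_inv, Stable]) \<in> hcong"
      using hnn_congruence_context[OF main[OF a(1)], of "[]" "[Stable]"] st by simp
    have 2: "([Stable, Base a, Stable_inv, Stable], [Stable, Base a]) \<in> hcong"
      using hnn_congruence_context[OF hcong_cancel[of False], of "[Stable, Base a]" "[]"] st ac
        Cons_word[of Stable "[Base a]"] by simp
    show ?thesis
      using hnn_congruence.trans[OF 1 2] True a
      by (simp add: transfer_def the_inv_into_f_f[OF inj_on_\<theta>])
  next
    case False
    then have a: "c \<in> A" using assms by (auto simp: assoc_subgroup_def)
    have ac: "c \<in> carrier G" using a subgroup.mem_carrier[OF subgroup_A] by blast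
    have 1: "([Stable_inv, Base (\<theta> c)], [Stable_inv, Stable, Base c, Stable_inv]) \<in> hcong"
      using hnn_congruence_context[OF main[OF a], of "[Stable_inv]" "[]"] st by simp
    have 2: "([Stable_inv, Stable, Base c, Stable_inv], [Base c, Stable_inv]) \<in> hcong"
      using hnn_congruence_context[OF hcong_cancel[of False], of "[]" "[Base c, Stable_inv]"] st ac
        Cons_word[of "Base c" "[Stable_inv]"] by simp
    show ?thesis
      using hnn_congruence.sym[OF hnn_congruence.trans[OF 1 2]] False by (simp add: transfer_def)
  qed
qed

lemma state_word_turn:
  assumes v: "valid_state (l, g)"
  shows "(state_word (l, g) @ [stable_letter s], state_word (turn s (l, g))) \<in> hcong"
proof -
  have g: "g \<in> carrier G" and lw: "list_word l \<in> hnn_words G"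
    using v list_word_words by (auto simp: valid_state_def)
  show ?thesis
  proof (cases rule: turn_cases[of l s g])
    case (pop r l')
    have r: "r \<in> carrier G" and lw': "list_word l' \<in> hnn_words G"
      using v pop list_word_words by (auto simp: valid_state_def)
    have t: "transfer s g \<in> carrier G" by (rule transfer_closed[OF pop(2)])
    have pre: "list_word l' @ [Base r] \<in> hnn_words G" using lw' r by simp
    have "((list_word l' @ [Base r, stable_letter (\<not> s)]) @ [Base g, stable_letter s] @ [],
        (list_word l' @ [Base r, stable_letter (\<not> s)]) @ [stable_letter s, Base (transfer s g)] @ []) \<in> hcong"
      using hnn_congruence_context[OF hcong_Base_stable[OF pop(2)],
          of "list_word l' @ [Base r, stable_letter (\<not> s)]" "[]"] lw' r
          Cons_word[of "Base r" "[stable_letter (\<not> s)]"] by simp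
    moreover have "((list_word l' @ [Base r]) @ [stable_letter (\<not> s), stable_letter s] @ [Base (transfer s g)],
        (list_word l' @ [Base r]) @ [] @ [Base (transfer s g)]) \<in> hcong"
      using hnn_congruence_context[OF hcong_cancel[of "\<not> s"] pre, of "[Base (transfer s g)]"] t by simp
    moreover have "(list_word l' @ [Base r, Base (transfer s g)] @ [],
        list_word l' @ [Base (r \<otimes> transfer s g)] @ []) \<in> hcong"
      by (rule hnn_congruence_context[OF hcong_Base_mult[OF r t] lw']) simp
    ultimately have "(list_word l' @ [Base r, stable_letter (\<not> s), Base g, stable_letter s],
        list_word l' @ [Base (r \<otimes> transfer s g)]) \<in> hcong"
      using hnn_congruence.trans by (simp, blast)
    then show ?thesis using pop by (simp add: state_word_def)
  next
    case push
    let ?r = "rep s g"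
    let ?c = "inv ?r \<otimes> g"
    have r: "?r \<in> carrier G" "?c \<in> assoc_subgroup s" using coset_rep[OF subgroup_assoc g] .
    have c: "?c \<in> carrier G" by (rule assoc_closed[OF r(2)])
    have g_eq: "?r \<otimes> ?c = g" using r(1) g by (simp flip: m_assoc)
    have "([Base g], [Base ?r, Base ?c]) \<in> hcong"
      using hnn_congruence.sym[OF hcong_Base_mult[OF r(1) c]] g_eq by simp
    then have "(list_word l @ [Base g] @ [stable_letter s],
        list_word l @ [Base ?r, Base ?c] @ [stable_letter s]) \<in> hcong"
      by (rule hnn_congruence_context[OF _ lw stable_letter_word])
    moreover have "((list_word l @ [Base ?r]) @ [Base ?c, stable_letter s] @ [],
        (list_word l @ [Base ?r]) @ [stable_letter s, Base (transfer s ?c)] @ []) \<in> hcong"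
      by (rule hnn_congruence_context[OF hcong_Base_stable[OF r(2)]]) (use lw r in simp_all)
    ultimately have "(list_word l @ [Base g, stable_letter s],
        list_word l @ [Base ?r, stable_letter s, Base (transfer s ?c)]) \<in> hcong"
      using hnn_congruence.trans by (simp, blast)
    then show ?thesis unfolding turn_push[OF push] by (simp add: state_word_def)
  qed
qed

lemma state_word_step:
  assumes v: "valid_state st" and x: "[x] \<in> hnn_words G"
  shows "(state_word st @ [x], state_word (step x st)) \<in> hcong"
proof (cases x)
  case (Base h)
  obtain l g where st: "st = (l, g)" by (cases st)
  have "g \<in> carrier G" "h \<in> carrier G" "list_word l \<in> hnn_words G"
    using v x Base st list_word_words by (auto simp: valid_state_def)
  then show ?thesis
    using hnn_congruence_context[OF hcong_Base_mult, of g h "list_word l" "[]"] Base st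
    by (simp add: state_word_def)
next
  case Stable
  then show ?thesis using state_word_turn[of "fst st" "snd st" True] v by simp
next
  case Stable_inv
  then show ?thesis using state_word_turn[of "fst st" "snd st" False] v by simp
qed

text \<open>Existence of normal forms: reading the state back as a word recovers the group
  element.\<close>

lemma state_word_run: "w \<in> hnn_words G \<Longrightarrow> (w, state_word (run w base_state)) \<in> hcong"
proof (induction w rule: rev_induct)
  case Nil
  then show ?case
    using hnn_congruence.sym[OF hcong_Base_one] by (simp add: state_word_def base_state_def)
next
  case (snoc x w)
  then have w: "w \<in> hnn_words G" "[x] \<in> hnn_words G" by auto
  have "(w @ [x], state_word (run w base_state) @ [x]) \<in> hcong"
    using hnn_congruence_append[OF snoc.IH[OF w(1)] hnn_congruence.refl[OF w(2)]] .
  moreover have "(state_word (run w base_state) @ [x], state_word (step x (run w base_state))) \<in> hcong"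
    by (rule state_word_step[OF valid_run[OF valid_base_state w(1)] w(2)])
  ultimately show ?case by (simp add: run_append) (rule hnn_congruence.trans)
qed

section \<open>Vertices of the Bass-Serre tree and the base group\<close>

definition vertex :: "'a hnn_letter list set \<Rightarrow> ('a \<times> bool) list" where
  "vertex X = fst (normal_form X)"

definition incl :: "'a \<Rightarrow> 'a hnn_letter list set" where
  "incl g = hcong `` {[Base g]}"

lemma incl_closed: "g \<in> carrier G \<Longrightarrow> incl g \<in> carrier K"
  unfolding incl_def by (rule HNN_class_in_carrier) simp

lemma incl_mult:
  "g \<in> carrier G \<Longrightarrow> h \<in> carrier G \<Longrightarrow> incl (g \<otimes> h) = incl g \<otimes>\<^bsub>K\<^esub> incl h"
  unfolding incl_def
  by (simp add: HNN_mult_class) (rule equiv_class_eq[OF equiv_hnn_congruence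
        hnn_congruence.sym[OF hcong_Base_mult]])

lemma group_K: "group K"
  by (rule group_HNN[OF is_group])

lemma group_hom_incl: "group_hom G K incl"
  using is_group group_K incl_closed incl_mult
  by (auto simp: group_hom_def group_hom_axioms_def hom_def)

text \<open>The letter \<open>Base g\<close> takes \<open>base_state\<close> to a state from which
  \<open>g\<close> can be read off.\<close>

lemma inj_on_incl: "inj_on incl (carrier G)"
proof (rule inj_onI)
  fix g h assume gh: "g \<in> carrier G" "h \<in> carrier G" "incl g = incl h"
  then have "run [Base g] base_state = run [Base h] base_state"
    using normal_form_class[of "[Base g]"] normal_form_class[of "[Base h]"]
    unfolding incl_def by simp
  then show "g = h" using gh by (simp add: base_state_def)
qed

text \<open>Both elements are represented by the word of the common list followed by a single letter
  of \<open>G\<close>, and \<open>h\<close> is the quotient of these two letters.\<close>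

lemma vertex_eq_imp_same_coset:
  assumes X: "X \<in> carrier K" and Y: "Y \<in> carrier K" and XY: "vertex X = vertex Y"
  obtains h where "h \<in> carrier G" "Y = X \<otimes>\<^bsub>K\<^esub> incl h"
proof -
  obtain x where x: "x \<in> hnn_words G" "X = hcong `` {x}" using X by (rule HNN_carrierE)
  obtain y where y: "y \<in> hnn_words G" "Y = hcong `` {y}" using Y by (rule HNN_carrierE)
  obtain l g where rx: "run x base_state = (l, g)" by (cases "run x base_state")
  obtain l' g' where ry: "run y base_state = (l', g')" by (cases "run y base_state")
  have "l' = l" using XY rx ry by (simp add: vertex_def x y normal_form_class)
  have g: "g \<in> carrier G" "reduced l" "g' \<in> carrier G"
    using valid_run[OF valid_base_state x(1)] valid_run[OF valid_base_state y(1)] rx ry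
    by (auto simp: valid_state_def)
  define h where "h = inv g \<otimes> g'"
  have h: "h \<in> carrier G" "g \<otimes> h = g'" using g by (simp_all add: h_def flip: m_assoc)
  have lw: "list_word l \<in> hnn_words G" by (rule list_word_words[OF g(2)])
  have Xe: "X = hcong `` {list_word l @ [Base g]}"
    using equiv_class_eq[OF equiv_hnn_congruence state_word_run[OF x(1)]] x rx
    by (simp add: state_word_def)
  have Ye: "Y = hcong `` {list_word l @ [Base g']}"
    using equiv_class_eq[OF equiv_hnn_congruence state_word_run[OF y(1)]] y ry \<open>l' = l\<close>
    by (simp add: state_word_def)
  have "(list_word l @ [Base g, Base h] @ [], list_word l @ [Base (g \<otimes> h)] @ []) \<in> hcong"
    by (rule hnn_congruence_context[OF hcong_Base_mult[OF g(1) h(1)] lw]) simp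
  then have "(list_word l @ [Base g, Base h], list_word l @ [Base g']) \<in> hcong"
    using h(2) by simp
  from equiv_class_eq[OF equiv_hnn_congruence this] have "Y = hcong `` {list_word l @ [Base g, Base h]}"
    using Ye by simp
  also have "\<dots> = X \<otimes>\<^bsub>K\<^esub> incl h"
    unfolding Xe incl_def using lw g h by (subst HNN_mult_class) simp_all
  finally show thesis using that h(1) by blast
qed

text \<open>A path in the letters of the presentation is a path in the tree: letters of
  \<open>G\<close> fix the vertex, stable letters cross one edge.\<close>

lemma fst_step:
  "fst (step x st) = fst st \<or> (\<exists>y. fst (step x st) = y # fst st) \<or> (\<exists>y. fst st = y # fst (step x st))"
proof -
  have "fst (turn s (l, g)) = l \<or> (\<exists>y. fst (turn s (l, g)) = y # l) \<or> (\<exists>y. l = y # fst (turn s (l, g)))"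
    for s l g by (cases rule: turn_cases[of l s g]) (auto simp: turn_push)
  from this[of _ "fst st" "snd st"] show ?thesis by (cases x; cases st) auto
qed

text \<open>The highest vertex visited by a path is an ancestor of both of its ends.\<close>

lemma common_ancestor_run:
  "\<exists>v v' p q. w = v @ v' \<and> fst st = p @ fst (run v st) \<and> fst (run w st) = q @ fst (run v st) \<and>
     length p \<le> length w \<and> length q \<le> length w"
proof (induction w rule: rev_induct)
  case Nil
  show ?case by simp
next
  case (snoc x w)
  then obtain v v' p q where IH: "w = v @ v'" "fst st = p @ fst (run v st)"
    "fst (run w st) = q @ fst (run v st)" "length p \<le> length w" "length q \<le> length w" by blast
  let ?l = "fst (run w st)" and ?l' = "fst (run (w @ [x]) st)"
  have l': "?l' = fst (step x (run w st))" by (simp add: run_append)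
  consider "?l' = ?l" | y where "?l' = y # ?l" | y where "?l = y # ?l'"
    using fst_step[of x "run w st"] l' by auto
  then show ?case
  proof cases
    case 1
    then show ?thesis using IH by (intro exI[of _ v] exI[of _ "v' @ [x]"] exI[of _ p] exI[of _ q]) auto
  next
    case (2 y)
    then show ?thesis
      using IH by (intro exI[of _ v] exI[of _ "v' @ [x]"] exI[of _ p] exI[of _ "y # q"]) auto
  next
    case (3 y)
    show ?thesis
    proof (cases q)
      \<comment> \<open>The path stood at its highest vertex and now rises above it, so the whole
        path becomes the new prefix.\<close>
      case Nil
      then have "fst st = (p @ [y]) @ ?l'" using IH 3 by simp
      then show ?thesis
        using IH(4)
        by (intro exI[of _ "w @ [x]"] exI[of _ "[]"] exI[of _ "p @ [y]"] exI[of _ "[]"]) auto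
    next
      case (Cons z q')
      then have "?l' = q' @ fst (run v st)" using IH 3 by simp
      then show ?thesis
        using IH Cons by (intro exI[of _ v] exI[of _ "v' @ [x]"] exI[of _ p] exI[of _ q']) auto
    qed
  qed
qed

end

section \<open>Decomposition along the Bass-Serre tree\<close>

lemma finite_bounded:
  fixes f :: "'x \<Rightarrow> nat"
  assumes "finite B"
  obtains n where "\<forall>b\<in>B. f b \<le> n"
proof -
  have "f b \<le> Max (f ` B)" if "b \<in> B" for b using assms that by simp
  then show thesis using that by blast
qed

text \<open>Used for slabs: a vertex at least \<open>p\<close> levels below the upper boundary of
  its slab may rise by \<open>p\<close> levels without leaving it.\<close>

lemma div_eq_of_le_mod:
  fixes n p N :: nat
  assumes "p \<le> (n + p) mod N" "0 < N"
  shows "n div N = (n + p) div N"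
proof (rule div_nat_eqI)
  have *: "N * ((n + p) div N) + (n + p) mod N = n + p" by simp
  show "N * ((n + p) div N) \<le> n" using * assms(1) by linarith
  have "(n + p) mod N < N" using assms(2) by simp
  moreover have "N * Suc ((n + p) div N) = N + N * ((n + p) div N)" by simp
  ultimately show "n < N * Suc ((n + p) div N)" using * by linarith
qed

text \<open>The residues of \<open>n + \<sigma>\<close> are distinct as \<open>\<sigma>\<close> runs
  through a full period.\<close>

lemma card_shift_mod_less:
  "card {\<sigma> \<in> {..<N}. (n + \<sigma>) mod N < (R'::nat)} \<le> R'"
proof -
  have "inj_on (\<lambda>\<sigma>. (n + \<sigma>) mod N) {..<N}"
  proof (rule linorder_inj_onI)
    fix x y :: nat assume xy: "x < y" "x \<in> {..<N}" "y \<in> {..<N}"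
    show "(n + x) mod N \<noteq> (n + y) mod N"
    proof
      assume "(n + x) mod N = (n + y) mod N"
      then have "N dvd (n + y) - (n + x)" using mod_eq_dvd_iff_nat[of "n + x" "n + y" N] xy by simp
      then show False using xy by (auto dest!: dvd_imp_le)
    qed
  qed auto
  then have "card {\<sigma> \<in> {..<N}. (n + \<sigma>) mod N < R'} \<le> card {..<R'}"
    by (intro card_inj_on_le[of "\<lambda>\<sigma>. (n + \<sigma>) mod N"]) (auto intro: inj_on_subset)
  then show ?thesis by simp
qed

section \<open>Balls and topology of word metrics\<close>

context group
begin

lemma finite_word_ball:
  assumes S: "finite_generating_set G S"
  shows "finite {g \<in> carrier G. word_length G S g \<le> n}"
proof -
  have "finite (S \<union> m_inv G ` S)" using S by (simp add: finite_generating_set_def)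
  then have "finite {w. set w \<subseteq> S \<union> m_inv G ` S \<and> length w \<le> n}" by (rule finite_lists_length_le)
  moreover have "{g \<in> carrier G. word_length G S g \<le> n} \<subseteq>
      (\<lambda>w. foldr (mult G) w \<one>) ` {w. set w \<subseteq> S \<union> m_inv G ` S \<and> length w \<le> n}"
  proof
    fix g assume "g \<in> {g \<in> carrier G. word_length G S g \<le> n}"
    then have g: "g \<in> carrier G" "word_length G S g \<le> n" by auto
    obtain w where "length w = word_length G S g" "set w \<subseteq> S \<union> m_inv G ` S" "foldr (mult G) w \<one> = g"
      using word_length_witness[OF S g(1)] .
    then show "g \<in> (\<lambda>w. foldr (mult G) w \<one>) ` {w. set w \<subseteq> S \<union> m_inv G ` S \<and> length w \<le> n}"
      using g(2) by auto
  qed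
  ultimately show ?thesis by (rule finite_surj)
qed

lemma countable_carrier:
  assumes S: "finite_generating_set G S"
  shows "countable (carrier G)"
proof -
  have "carrier G \<subseteq> (\<Union>n. {g \<in> carrier G. word_length G S g \<le> n})" by auto
  moreover have "countable (\<Union>n. {g \<in> carrier G. word_length G S g \<le> n})"
    by (rule countable_UN) (auto intro!: countable_finite[OF finite_word_ball[OF S]])
  ultimately show ?thesis by (rule countable_subset)
qed

text \<open>Distances are integers, so open balls of radius 1 are singletons.\<close>

lemma word_metric_discrete:
  assumes S: "finite_generating_set G S"
  shows "mtopology_of (word_metric G S) = discrete_topology (mspace (word_metric G S))"
proof -
  interpret M: Metric_space "carrier G" "word_dist G S" by (rule Metric_space_word_dist[OF S])
  have ball: "M.mball x 1 \<subseteq> {x}" if "x \<in> carrier G" for x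
  proof
    fix y assume "y \<in> M.mball x 1"
    then have y: "y \<in> carrier G" "word_dist G S x y < 1" by auto
    then have "word_dist G S x y = 0" using that by (simp add: word_dist_def)
    then show "y \<in> {x}" using y that by simp
  qed
  have "openin M.mtopology U \<longleftrightarrow> U \<subseteq> carrier G" for U
    unfolding M.openin_mtopology using ball by (metis in_mono insertE empty_iff subsetI zero_less_one)
  then have "M.mtopology = discrete_topology (carrier G)" by (simp add: topology_eq)
  then show ?thesis
    by (simp add: mtopology_of_def mspace_word_metric[OF S] mdist_word_metric[OF S])
qed

end

section \<open>Distances in the HNN extension\<close>

locale hnn_word = hnn_extension +
  fixes S' :: "'a hnn_letter list set set"
  assumes S': "finite_generating_set K S'"
begin

sublocale K: group K
  by (rule group_K)

definition dist :: "'a hnn_letter list set \<Rightarrow> 'a hnn_letter list set \<Rightarrow> nat" where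
  "dist X Y = word_length K S' (inv\<^bsub>K\<^esub> X \<otimes>\<^bsub>K\<^esub> Y)"

lemma word_dist_eq: "X \<in> carrier K \<Longrightarrow> Y \<in> carrier K \<Longrightarrow> word_dist K S' X Y = real (dist X Y)"
  by (simp add: word_dist_def dist_def)

lemma dist_commute:
  assumes "X \<in> carrier K" "Y \<in> carrier K"
  shows "dist X Y = dist Y X"
  using Metric_space.commute[OF K.Metric_space_word_dist[OF S'], of X Y] assms
  by (simp add: word_dist_eq)

lemma dist_triangle:
  assumes "X \<in> carrier K" "Y \<in> carrier K" "Z \<in> carrier K"
  shows "dist X Z \<le> dist X Y + dist Y Z"
  using Metric_space.triangle[OF K.Metric_space_word_dist[OF S'], of X Y Z] assms
  by (simp add: word_dist_eq flip: of_nat_add)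

lemma dist_self: "X \<in> carrier K \<Longrightarrow> dist X X = 0"
  using Metric_space.zero[OF K.Metric_space_word_dist[OF S'], of X X] by (simp add: word_dist_eq)

text \<open>A letter \<open>Base g\<close> can be arbitrarily long with respect to
  \<open>S'\<close>, so one word is fixed for each of the finitely many elements of the ball of
  radius \<open>R\<close>, and \<open>R'\<close> dominates all prefixes of these words. Read from
  \<open>X\<close>, such a word traces a path in the tree to the vertex of \<open>Y\<close>, and
  \<open>Z\<close> is reached where this path is highest.\<close>

lemma near_common_ancestor:
  fixes R :: nat
  obtains R' where "R \<le> R'"
    "\<forall>X\<in>carrier K. \<forall>Y\<in>carrier K. dist X Y \<le> R \<longrightarrow>
      (\<exists>Z p q. Z \<in> carrier K \<and> vertex X = p @ vertex Z \<and> vertex Y = q @ vertex Z \<and>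
        length p \<le> R' \<and> length q \<le> R' \<and> dist X Z \<le> R' \<and> dist Y Z \<le> R')"
proof -
  define B where "B = {b \<in> carrier K. word_length K S' b \<le> R}"
  have B: "finite B" unfolding B_def by (rule K.finite_word_ball[OF S'])
  have "\<forall>b\<in>B. \<exists>w. w \<in> hnn_words G \<and> b = hcong `` {w}"
    unfolding B_def by (blast elim: HNN_carrierE)
  then obtain w where w: "\<And>b. b \<in> B \<Longrightarrow> w b \<in> hnn_words G \<and> b = hcong `` {w b}" by metis
  \<comment> \<open>The first summand bounds the displacement in the tree, the second the distance
    in \<open>K\<close> to every intermediate point.\<close>
  define h where "h b = length (w b) + (\<Sum>i\<le>length (w b). word_length K S' (hcong `` {take i (w b)}))" for b
  obtain n where "\<forall>b\<in>B. h b \<le> n" using finite_bounded[OF B, of h] .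
  then have n: "h b \<le> n" if "b \<in> B" for b using that by blast
  have "\<exists>Z p q. Z \<in> carrier K \<and> vertex X = p @ vertex Z \<and> vertex Y = q @ vertex Z \<and>
        length p \<le> R + n \<and> length q \<le> R + n \<and> dist X Z \<le> R + n \<and> dist Y Z \<le> R + n"
    if X: "X \<in> carrier K" and Y: "Y \<in> carrier K" and d: "dist X Y \<le> R" for X Y
  proof -
    define b where "b = inv\<^bsub>K\<^esub> X \<otimes>\<^bsub>K\<^esub> Y"
    have b: "b \<in> B" using X Y d by (simp add: b_def B_def dist_def)
    have Yb: "Y = X \<otimes>\<^bsub>K\<^esub> b" using X Y by (simp add: b_def flip: K.m_assoc)
    obtain x where x: "x \<in> hnn_words G" "X = hcong `` {x}" using X by (rule HNN_carrierE)
    have wb: "w b \<in> hnn_words G" "b = hcong `` {w b}" using w[OF b] by auto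
    have Yx: "Y = hcong `` {x @ w b}"
      using HNN_mult_class[OF x(1) wb(1), of A \<theta>] Yb x(2) wb(2) by simp
    let ?st = "run x base_state"
    obtain v v' p q where v: "w b = v @ v'" "fst ?st = p @ fst (run v ?st)"
      "fst (run (w b) ?st) = q @ fst (run v ?st)" "length p \<le> length (w b)" "length q \<le> length (w b)"
      using common_ancestor_run[of "w b" ?st] by blast
    have vw: "v \<in> hnn_words G" using wb(1) v(1) by simp
    define Z where "Z = hcong `` {x @ v}"
    have Z: "Z \<in> carrier K" unfolding Z_def by (rule HNN_class_in_carrier) (simp add: x vw)
    have ZX: "Z = X \<otimes>\<^bsub>K\<^esub> hcong `` {v}"
      unfolding Z_def x(2) by (rule HNN_mult_class[symmetric, OF x(1) vw])
    have vc: "hcong `` {v} \<in> carrier K" by (rule HNN_class_in_carrier[OF vw])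
    have "dist X Z = word_length K S' (hcong `` {v})"
      unfolding dist_def ZX using X vc by (simp flip: K.m_assoc)
    also have "\<dots> = word_length K S' (hcong `` {take (length v) (w b)})" by (simp add: v(1))
    also have "\<dots> \<le> (\<Sum>i\<le>length (w b). word_length K S' (hcong `` {take i (w b)}))"
      by (rule member_le_sum) (auto simp: v(1))
    also have "\<dots> \<le> n" using n[OF b] by (simp add: h_def)
    finally have dXZ: "dist X Z \<le> n" .
    then have "dist Y Z \<le> R + n"
      using dist_triangle[OF Y X Z] dist_commute[OF X Y] d by linarith
    moreover have "vertex X = p @ vertex Z" "vertex Y = q @ vertex Z"
      using v(2,3) x wb vw by (simp_all add: vertex_def x(2) Yx Z_def normal_form_class run_append)
    moreover have "length (w b) \<le> n" using n[OF b] by (simp add: h_def)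
    then have "length p \<le> R + n" "length q \<le> R + n" using v(4,5) by linarith+
    ultimately show ?thesis using Z dXZ by (intro exI[of _ Z] exI[of _ p] exI[of _ q]) auto
  qed
  then show thesis by (intro that[of "R + n"]) auto
qed

section \<open>Cosets, slabs and thresholds\<close>

definition near :: "nat \<Rightarrow> 'a hnn_letter list set \<Rightarrow> ('a \<times> bool) list \<Rightarrow> bool" where
  "near s X l \<longleftrightarrow> (\<exists>Z\<in>carrier K. vertex Z = l \<and> dist X Z \<le> s)"

lemma near_mono: "near s X l \<Longrightarrow> s \<le> s' \<Longrightarrow> near s' X l"
  unfolding near_def using order_trans by blast

lemma near_dist:
  assumes "X \<in> carrier K" "Y \<in> carrier K" "near s X l"
  shows "near (dist X Y + s) Y l"
proof -
  obtain Z where Z: "Z \<in> carrier K" "vertex Z = l" "dist X Z \<le> s"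
    using assms(3) by (auto simp: near_def)
  have "dist Y Z \<le> dist X Y + s"
    using dist_triangle[OF assms(2,1) Z(1)] dist_commute[OF assms(1,2)] Z(3) by linarith
  then show ?thesis using Z by (auto simp: near_def)
qed

text \<open>Levels count from the root, so this is the suffix of length \<open>j\<close>; for
  \<open>j\<close> beyond the depth, truncated subtraction returns the vertex itself.\<close>

definition ancestor :: "'a hnn_letter list set \<Rightarrow> nat \<Rightarrow> ('a \<times> bool) list" where
  "ancestor X j = drop (length (vertex X) - j) (vertex X)"

text \<open>For \<open>R \<le> s\<close>: the distance from \<open>X\<close> to the coset
  \<open>l\<close> lies above \<open>s - R\<close> and is at most \<open>s + R\<close>, so a move of
  length \<open>R\<close> may carry it across \<open>s\<close>.\<close>

definition critical :: "nat \<Rightarrow> nat \<Rightarrow> 'a hnn_letter list set \<Rightarrow> ('a \<times> bool) list \<Rightarrow> bool" where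
  "critical R s X l \<longleftrightarrow> near (s + R) X l \<and> \<not> near (s - R) X l"

text \<open>With \<open>a\<close> the distance from \<open>X\<close> to \<open>l\<close>, critical
  thresholds satisfy \<open>a - R \<le> s < a + R\<close>. The bound
  \<open>R \<le> R' \<le> s\<close> keeps \<open>s - R\<close> an honest difference.\<close>

lemma card_critical:
  assumes "R \<le> R'"
  shows "card {s \<in> {R'..<R' + M}. critical R s X l} \<le> 2 * R"
proof (cases "\<exists>a. near a X l")
  case True
  define a where "a = (LEAST a. near a X l)"
  have "near a X l" unfolding a_def using True by (rule LeastI_ex)
  have "{s \<in> {R'..<R' + M}. critical R s X l} \<subseteq> {a - R..<a + R}"
  proof
    fix s assume s: "s \<in> {s \<in> {R'..<R' + M}. critical R s X l}"
    then have "a \<le> s + R" unfolding a_def critical_def by (auto intro: Least_le)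
    moreover have "\<not> a \<le> s - R" using s near_mono[OF \<open>near a X l\<close>] by (auto simp: critical_def)
    ultimately show "s \<in> {a - R..<a + R}" using s assms by auto
  qed
  then have "card {s \<in> {R'..<R' + M}. critical R s X l} \<le> card {a - R..<a + R}"
    by (intro card_mono) auto
  then show ?thesis by simp
next
  case False
  then show ?thesis by (simp add: critical_def)
qed

definition same_slab :: "nat \<Rightarrow> nat \<Rightarrow> nat \<Rightarrow> 'a hnn_letter list set \<Rightarrow> bool" where
  "same_slab N \<sigma> j X \<longleftrightarrow> j \<le> length (vertex X) \<and> (j + \<sigma>) div N = (length (vertex X) + \<sigma>) div N"

text \<open>\<open>\<eta>\<close> pairs the shift of the slabs with the threshold. The remainder is
  bounded below to stay away from the boundary on the side of the root, because nearby elements are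
  compared through a common ancestor at most \<open>R'\<close> levels up.\<close>

definition kept :: "nat \<Rightarrow> nat \<Rightarrow> nat \<Rightarrow> nat \<times> nat \<Rightarrow> 'a hnn_letter list set \<Rightarrow> bool" where
  "kept R R' N \<eta> X \<longleftrightarrow> R' \<le> (length (vertex X) + fst \<eta>) mod N \<and>
     (\<forall>j. same_slab N (fst \<eta>) j X \<longrightarrow> \<not> critical R (snd \<eta>) X (ancestor X j))"

definition top_level :: "nat \<Rightarrow> nat \<times> nat \<Rightarrow> 'a hnn_letter list set \<Rightarrow> nat" where
  "top_level N \<eta> X = (LEAST j. same_slab N (fst \<eta>) j X \<and> near (snd \<eta>) X (ancestor X j))"

lemma near_self: "X \<in> carrier K \<Longrightarrow> near s X (ancestor X (length (vertex X)))"
  by (auto simp: near_def ancestor_def dist_self intro!: bexI[of _ X])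

text \<open>The least level exists because the vertex of \<open>X\<close> lies in its own slab and
  its coset at distance 0.\<close>

lemma top_level:
  assumes "X \<in> carrier K"
  shows "same_slab N (fst \<eta>) (top_level N \<eta> X) X \<and> near (snd \<eta>) X (ancestor X (top_level N \<eta> X))"
  unfolding top_level_def
  by (rule LeastI[of _ "length (vertex X)"]) (use near_self[OF assms] in \<open>simp add: same_slab_def\<close>)

lemma top_level_le:
  "same_slab N (fst \<eta>) j X \<Longrightarrow> near (snd \<eta>) X (ancestor X j) \<Longrightarrow> top_level N \<eta> X \<le> j"
  unfolding top_level_def by (rule Least_le) blast

lemma ancestor_common:
  assumes "vertex X = p @ m" "j \<le> length m"
  shows "ancestor X j = drop (length m - j) m"
  using assms by (simp add: ancestor_def)

text \<open>The chosen ancestor of \<open>X\<close> is not critical, so its distance from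
  \<open>X\<close> is at most \<open>snd \<eta> - R\<close>, and from \<open>Y\<close> at most
  \<open>snd \<eta>\<close>. Its level does not exceed that of \<open>m\<close>, so it is also an
  ancestor of \<open>Y\<close>. Applied in both directions, this equates the two levels.\<close>

lemma kept_transfer:
  assumes X: "X \<in> carrier K" and Y: "Y \<in> carrier K" and d: "dist X Y \<le> R"
    and kX: "kept R R' N \<eta> X"
    and Rs: "R \<le> snd \<eta>" and slab: "(length m + fst \<eta>) div N = (length (vertex X) + fst \<eta>) div N"
      "(length m + fst \<eta>) div N = (length (vertex Y) + fst \<eta>) div N"
    and m: "vertex X = p @ m" "vertex Y = q @ m" and le: "top_level N \<eta> X \<le> length m"
  shows "top_level N \<eta> Y \<le> top_level N \<eta> X"
proof (rule top_level_le)
  let ?j = "top_level N \<eta> X"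
  have t: "same_slab N (fst \<eta>) ?j X" "near (snd \<eta>) X (ancestor X ?j)"
    using top_level[OF X] by auto
  show "same_slab N (fst \<eta>) ?j Y" using t(1) slab le m by (simp add: same_slab_def)
  have "near (snd \<eta> + R) X (ancestor X ?j)" using t(2) by (rule near_mono) simp
  then have "near (snd \<eta> - R) X (ancestor X ?j)"
    using kX t(1) unfolding kept_def critical_def by blast
  from near_dist[OF X Y this] have "near (dist X Y + (snd \<eta> - R)) Y (ancestor X ?j)" .
  then have "near (snd \<eta>) Y (ancestor X ?j)" by (rule near_mono) (use d Rs in linarith)
  then show "near (snd \<eta>) Y (ancestor Y ?j)"
    by (simp add: ancestor_common[OF m(1) le] ancestor_common[OF m(2) le])
qed

lemma card_same_slab:
  assumes "0 < N"
  shows "finite {j. same_slab N \<sigma> j X}" "card {j. same_slab N \<sigma> j X} \<le> N"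
proof -
  let ?q = "(length (vertex X) + \<sigma>) div N"
  show "finite {j. same_slab N \<sigma> j X}"
    by (rule finite_subset[of _ "{..length (vertex X)}"]) (auto simp: same_slab_def)
  have "card {j. same_slab N \<sigma> j X} \<le> card {N * ?q..<N * ?q + N}"
  proof (rule card_inj_on_le[of "\<lambda>j. j + \<sigma>"])
    show "(\<lambda>j. j + \<sigma>) ` {j. same_slab N \<sigma> j X} \<subseteq> {N * ?q..<N * ?q + N}"
    proof
      fix i assume "i \<in> (\<lambda>j. j + \<sigma>) ` {j. same_slab N \<sigma> j X}"
      then have "i div N = ?q" by (auto simp: same_slab_def)
      then have "N * ?q + i mod N = i" by (metis mult_div_mod_eq)
      moreover have "i mod N < N" using assms by simp
      ultimately have "N * ?q \<le> i" "i < N * ?q + N" by linarith+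
      then show "i \<in> {N * ?q..<N * ?q + N}" by auto
    qed
  qed (auto simp: inj_on_def)
  then show "card {j. same_slab N \<sigma> j X} \<le> N" by simp
qed

text \<open>The parameters are a shift \<open>\<sigma>\<close> of the slabs of \<open>N\<close> consecutive levels of the tree and a
  threshold \<open>s\<close>. A point is assigned to its highest ancestor within its slab at distance at most
  \<open>s\<close>, and it is dropped when a move of length \<open>R\<close> could change slab or cross the threshold. There
  are at most \<open>N\<close> ancestors in a slab, so each point is dropped for few parameters.\<close>

lemma coset_decomposition:
  fixes R :: nat
  obtains \<Theta> :: "(nat \<times> nat) set"
    and c :: "nat \<times> nat \<Rightarrow> 'a hnn_letter list set \<Rightarrow> ('a \<times> bool) list option"
    and L :: nat
  where "finite \<Theta>" "\<Theta> \<noteq> {}"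
    "\<forall>X\<in>carrier K. 2 * card {\<eta> \<in> \<Theta>. c \<eta> X = None} \<le> card \<Theta>"
    "\<forall>\<eta>\<in>\<Theta>. \<forall>X\<in>carrier K. \<forall>Y\<in>carrier K. \<forall>l l'. dist X Y \<le> R \<and>
      c \<eta> X = Some l \<and> c \<eta> Y = Some l' \<longrightarrow> l = l'"
    "\<forall>\<eta>\<in>\<Theta>. \<forall>X\<in>carrier K. \<forall>l. c \<eta> X = Some l \<longrightarrow> near L X l"
proof -
  obtain R' where R': "R \<le> R'"
    "\<forall>X\<in>carrier K. \<forall>Y\<in>carrier K. dist X Y \<le> R \<longrightarrow>
      (\<exists>Z p q. Z \<in> carrier K \<and> vertex X = p @ vertex Z \<and> vertex Y = q @ vertex Z \<and>
        length p \<le> R' \<and> length q \<le> R' \<and> dist X Z \<le> R' \<and> dist Y Z \<le> R')"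
    using near_common_ancestor[of R] .
  \<comment> \<open>At most \<open>R'\<close> of the \<open>N\<close> shifts put a point too close
    to a boundary, which is at most a quarter.\<close>
  define N where "N = 4 * R' + 4"
  \<comment> \<open>For each shift at most \<open>N\<close> ancestors exclude \<open>2 * R\<close>
    thresholds each, again at most a quarter of the range; the summand 1 keeps the range
    nonempty.\<close>
  define M where "M = 8 * N * R + 1"
  define \<Theta> where "\<Theta> = {..<N} \<times> {R'..<R' + M}"
  define c where "c \<eta> X = (if kept R R' N \<eta> X then Some (ancestor X (top_level N \<eta> X)) else None)"
    for \<eta> X
  have N: "0 < N" by (simp add: N_def)
  have card\<Theta>: "card \<Theta> = N * M" by (simp add: \<Theta>_def)
  have dropped: "2 * card {\<eta> \<in> \<Theta>. c \<eta> X = None} \<le> card \<Theta>" if X: "X \<in> carrier K" for X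
  proof -
    let ?n = "length (vertex X)"
    let ?P = "{\<sigma> \<in> {..<N}. (?n + \<sigma>) mod N < R'} \<times> {R'..<R' + M}"
    let ?Q = "\<lambda>\<sigma> j. {s \<in> {R'..<R' + M}. critical R s X (ancestor X j)}"
    let ?U = "\<Union>\<sigma>\<in>{..<N}. \<Union>j\<in>{j. same_slab N \<sigma> j X}. {\<sigma>} \<times> ?Q \<sigma> j"
    have "{\<eta> \<in> \<Theta>. c \<eta> X = None} \<subseteq> ?P \<union> ?U"
      by (auto simp: c_def kept_def \<Theta>_def not_le)
    moreover have fin: "finite ?P" "finite ?U" using card_same_slab(1)[OF N] by auto
    ultimately have "card {\<eta> \<in> \<Theta>. c \<eta> X = None} \<le> card (?P \<union> ?U)"
      by (intro card_mono) auto
    also have "\<dots> \<le> card ?P + card ?U" by (rule card_Un_le)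
    also have "card ?P \<le> R' * M"
      using mult_right_mono[OF card_shift_mod_less[of N ?n R'], of M]
      by (simp add: card_cartesian_product)
    also have "card ?U \<le> (\<Sum>\<sigma><N. card (\<Union>j\<in>{j. same_slab N \<sigma> j X}. {\<sigma>} \<times> ?Q \<sigma> j))"
      by (rule card_UN_le) simp
    also have "\<dots> \<le> (\<Sum>\<sigma><N. N * (2 * R))"
    proof (rule sum_mono)
      fix \<sigma>
      have "card (\<Union>j\<in>{j. same_slab N \<sigma> j X}. {\<sigma>} \<times> ?Q \<sigma> j) \<le>
          (\<Sum>j\<in>{j. same_slab N \<sigma> j X}. card ({\<sigma>} \<times> ?Q \<sigma> j))"
        by (rule card_UN_le[OF card_same_slab(1)[OF N]])
      also have "\<dots> \<le> (\<Sum>j\<in>{j. same_slab N \<sigma> j X}. 2 * R)"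
        by (rule sum_mono) (simp only: card_cartesian_product_singleton card_critical[OF R'(1)])
      also have "\<dots> \<le> N * (2 * R)"
        using mult_right_mono[OF card_same_slab(2)[OF N, of \<sigma> X], of "2 * R"] by simp
      finally show "card (\<Union>j\<in>{j. same_slab N \<sigma> j X}. {\<sigma>} \<times> ?Q \<sigma> j) \<le> N * (2 * R)" .
    qed
    finally have *: "card {\<eta> \<in> \<Theta>. c \<eta> X = None} \<le> R' * M + N * (N * (2 * R))" by simp
    have "4 * (R' * M) \<le> N * M"
      using mult_right_mono[of "4 * R'" N M] by (simp add: N_def)
    moreover have "4 * (N * (N * (2 * R))) \<le> N * M"
      using mult_left_mono[of "8 * N * R" M N] by (simp add: M_def ac_simps)
    ultimately show ?thesis
      using * unfolding card\<Theta> by linarith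
  qed
  have separated: "l = l'"
    if \<eta>: "\<eta> \<in> \<Theta>" and X: "X \<in> carrier K" and Y: "Y \<in> carrier K" and d: "dist X Y \<le> R"
      and cX: "c \<eta> X = Some l" and cY: "c \<eta> Y = Some l'" for \<eta> X Y l l'
  proof -
    have kX: "kept R R' N \<eta> X" and l: "l = ancestor X (top_level N \<eta> X)"
      using cX by (auto simp: c_def split: if_splits)
    have kY: "kept R R' N \<eta> Y" and l': "l' = ancestor Y (top_level N \<eta> Y)"
      using cY by (auto simp: c_def split: if_splits)
    obtain Z p q where Z: "Z \<in> carrier K" "vertex X = p @ vertex Z" "vertex Y = q @ vertex Z"
      "length p \<le> R'" "length q \<le> R'" "dist X Z \<le> R'" "dist Y Z \<le> R'"
      using R'(2) X Y d by blast
    let ?m = "vertex Z"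
    have s: "R' \<le> snd \<eta>" using \<eta> by (auto simp: \<Theta>_def)
    have slabX: "(length ?m + fst \<eta>) div N = (length (vertex X) + fst \<eta>) div N"
      using div_eq_of_le_mod[of "length p" "length ?m + fst \<eta>" N] kX Z N
      by (simp add: kept_def ac_simps)
    have slabY: "(length ?m + fst \<eta>) div N = (length (vertex Y) + fst \<eta>) div N"
      using div_eq_of_le_mod[of "length q" "length ?m + fst \<eta>" N] kY Z N
      by (simp add: kept_def ac_simps)
    \<comment> \<open>The coset of \<open>Z\<close> is admissible for \<open>X\<close>: it lies in
      the same slab and within \<open>R' \<le> snd \<eta>\<close>. So the chosen ancestor is at or
      above it, where the ancestors of \<open>X\<close> and \<open>Y\<close> coincide.\<close>
    have tX: "top_level N \<eta> X \<le> length ?m"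
      by (rule top_level_le) (use Z s slabX in \<open>auto simp: same_slab_def near_def ancestor_common\<close>)
    have tY: "top_level N \<eta> Y \<le> length ?m"
      by (rule top_level_le) (use Z s slabY in \<open>auto simp: same_slab_def near_def ancestor_common\<close>)
    have Rs: "R \<le> snd \<eta>" using s R'(1) by linarith
    have "top_level N \<eta> Y \<le> top_level N \<eta> X"
      by (rule kept_transfer[OF X Y d kX Rs slabX slabY Z(2,3) tX])
    moreover have "top_level N \<eta> X \<le> top_level N \<eta> Y"
      using d by (intro kept_transfer[OF Y X _ kY Rs slabY slabX Z(3,2) tY]) (simp add: dist_commute X Y)
    ultimately have "top_level N \<eta> X = top_level N \<eta> Y" by simp
    then show ?thesis
      unfolding l l' using ancestor_common[OF Z(2) tX] ancestor_common[OF Z(3) tY] by simp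
  qed
  have close: "near (R' + M) X l"
    if \<eta>: "\<eta> \<in> \<Theta>" and X: "X \<in> carrier K" and c: "c \<eta> X = Some l" for \<eta> X l
  proof -
    have l: "l = ancestor X (top_level N \<eta> X)" using c by (auto simp: c_def split: if_splits)
    have "near (snd \<eta>) X l" unfolding l using top_level[OF X, of N \<eta>] by blast
    then show ?thesis by (rule near_mono) (use \<eta> in \<open>auto simp: \<Theta>_def\<close>)
  qed
  show thesis
  proof (rule that[of \<Theta> c "R' + M"])
    show "finite \<Theta>" by (simp add: \<Theta>_def)
    show "\<Theta> \<noteq> {}" using N by (auto simp: \<Theta>_def M_def)
    show "\<forall>X\<in>carrier K. 2 * card {\<eta> \<in> \<Theta>. c \<eta> X = None} \<le> card \<Theta>"
      using dropped by simp
    show "\<forall>\<eta>\<in>\<Theta>. \<forall>X\<in>carrier K. \<forall>Y\<in>carrier K. \<forall>l l'. dist X Y \<le> R \<and>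
        c \<eta> X = Some l \<and> c \<eta> Y = Some l' \<longrightarrow> l = l'"
      by (intro ballI allI impI, elim conjE) (rule separated)
    show "\<forall>\<eta>\<in>\<Theta>. \<forall>X\<in>carrier K. \<forall>l. c \<eta> X = Some l \<longrightarrow> near (R' + M) X l"
      by (intro ballI allI impI) (rule close)
  qed
qed

end

section \<open>Localization of HNN extensions\<close>

text \<open>If every quotient \<open>a w / b w\<close> were below \<open>r / U\<close>, summation
  would contradict the two bounds. The products allow \<open>b w\<close> and \<open>U\<close> to
  vanish.\<close>

lemma sum_ratio_pigeonhole:
  fixes a b :: "'w \<Rightarrow> real" and r U :: real
  assumes W: "finite W" and a: "\<And>w. w \<in> W \<Longrightarrow> 0 \<le> a w" and b: "\<And>w. w \<in> W \<Longrightarrow> 0 \<le> b w"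
    and "0 \<le> U" "0 < r" "r \<le> (\<Sum>w\<in>W. a w)" "(\<Sum>w\<in>W. b w) \<le> U"
  shows "\<exists>w\<in>W. 0 < a w \<and> r * b w \<le> a w * U"
proof (rule ccontr)
  assume contra: "\<not> ?thesis"
  have no: "a w * U < r * b w" if "w \<in> W" "0 < a w" for w using contra that by force
  have le: "a w * U \<le> r * b w" if "w \<in> W" for w
    using no[OF that] a[OF that] b[OF that] \<open>0 < r\<close> by (cases "a w = 0") auto
  have "\<exists>w\<in>W. 0 < a w"
  proof (rule ccontr)
    assume "\<not> ?thesis"
    then have "(\<Sum>w\<in>W. a w) = 0" using a by (intro sum.neutral) force
    then show False using assms by linarith
  qed
  then have "(\<Sum>w\<in>W. a w * U) < (\<Sum>w\<in>W. r * b w)"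
    using no le by (intro sum_strict_mono_ex1 W) auto
  also have "\<dots> \<le> r * U"
    unfolding sum_distrib_left[symmetric] using assms by (intro mult_left_mono) auto
  also have "\<dots> \<le> (\<Sum>w\<in>W. a w * U)"
    unfolding sum_distrib_right[symmetric] using assms by (intro mult_right_mono) auto
  finally show False by simp
qed

context hnn_word
begin

lemma dist_translate_incl:
  assumes "X \<in> carrier K" "g \<in> carrier G" "h \<in> carrier G"
  shows "dist (X \<otimes>\<^bsub>K\<^esub> incl g) (X \<otimes>\<^bsub>K\<^esub> incl h) = word_length K S' (incl (inv g \<otimes> h))"
proof -
  have i: "incl g \<in> carrier K" "incl h \<in> carrier K" using assms incl_closed by auto
  have "inv\<^bsub>K\<^esub> (X \<otimes>\<^bsub>K\<^esub> incl g) \<otimes>\<^bsub>K\<^esub> (X \<otimes>\<^bsub>K\<^esub> incl h) =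
      inv\<^bsub>K\<^esub> incl g \<otimes>\<^bsub>K\<^esub> (inv\<^bsub>K\<^esub> X \<otimes>\<^bsub>K\<^esub> (X \<otimes>\<^bsub>K\<^esub> incl h))"
    using assms(1) i by (simp add: K.inv_mult_group K.m_assoc)
  also have "inv\<^bsub>K\<^esub> X \<otimes>\<^bsub>K\<^esub> (X \<otimes>\<^bsub>K\<^esub> incl h) = incl h"
    using assms(1) i by (simp flip: K.m_assoc)
  also have "inv\<^bsub>K\<^esub> incl g \<otimes>\<^bsub>K\<^esub> incl h = incl (inv g \<otimes> h)"
    using assms group_hom.hom_inv[OF group_hom_incl, of g] by (simp add: incl_mult)
  finally show ?thesis by (simp add: dist_def)
qed

text \<open>The factor 2 comes from the averaging and is the only loss, whatever \<open>k\<close>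
  is: \<open>G\<close> is used at a different scale \<open>kG\<close>, but with the same
  \<open>c0\<close>.\<close>

lemma matrix_localization_hnn:
  assumes S: "finite_generating_set G S" and c0: "0 < c0"
    and ml: "\<forall>k. \<exists>D. matrix_localization TYPE('i) (word_metric G S) c0 k D"
  shows "\<exists>D. matrix_localization TYPE('i) (word_metric K S') (c0 / 2) k D"
proof -
  \<comment> \<open>Separation at scale \<open>2 * k\<close> keeps the
    \<open>k\<close>-neighbourhoods of different pieces disjoint.\<close>
  obtain \<Theta> :: "(nat \<times> nat) set" and c L where \<Theta>: "finite \<Theta>" "\<Theta> \<noteq> {}"
    and half: "\<forall>X\<in>carrier K. 2 * card {\<eta> \<in> \<Theta>. c \<eta> X = None} \<le> card \<Theta>"
    and sep: "\<forall>\<eta>\<in>\<Theta>. \<forall>X\<in>carrier K. \<forall>Y\<in>carrier K. \<forall>l l'. dist X Y \<le> 2 * k \<and>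
      c \<eta> X = Some l \<and> c \<eta> Y = Some l' \<longrightarrow> l = l'"
    and near: "\<forall>\<eta>\<in>\<Theta>. \<forall>X\<in>carrier K. \<forall>l. c \<eta> X = Some l \<longrightarrow> near L X l"
    using coset_decomposition[of "2 * k"] .
  \<comment> \<open>An entry of the matrix spans at most \<open>k\<close>, and each of its two
    points is later moved by at most \<open>L + k\<close> onto a coset.\<close>
  define n where "n = k + 2 * (L + k)"
  \<comment> \<open>As \<open>incl\<close> is injective, only finitely many elements of
    \<open>G\<close> have length at most \<open>n\<close> in \<open>K\<close>. This bounds their
    length in \<open>G\<close> without any control of the distortion.\<close>
  have "finite {g \<in> carrier G. incl g \<in> {Y \<in> carrier K. word_length K S' Y \<le> n}}"
    using finite_vimage_IntI[OF K.finite_word_ball[OF S', of n] inj_on_incl]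
    by (simp add: vimage_def Int_def conj_commute)
  from finite_bounded[OF this, of "word_length G S"] obtain kG
    where "\<forall>g\<in>{g \<in> carrier G. incl g \<in> {Y \<in> carrier K. word_length K S' Y \<le> n}}. word_length G S g \<le> kG" .
  then have kG: "word_length G S g \<le> kG" if "g \<in> carrier G" "word_length K S' (incl g) \<le> n" for g
    using that incl_closed by simp
  obtain DG where DG: "matrix_localization TYPE('i) (word_metric G S) c0 kG DG" using ml by blast
  obtain E where "\<forall>g\<in>{g \<in> carrier G. word_length G S g \<le> DG}. word_length K S' (incl g) \<le> E"
    using finite_bounded[OF finite_word_ball[OF S, of DG], of "\<lambda>g. word_length K S' (incl g)"] .
  then have E: "word_length K S' (incl g) \<le> E" if "g \<in> carrier G" "word_length G S g \<le> DG" for g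
    using that by simp
  \<comment> \<open>\<open>E\<close> is the diameter \<open>DG\<close> as seen in \<open>K\<close>;
    the rest moves both points back from the coset.\<close>
  define D where "D = E + 2 * (L + k)"
  have "matrix_localization TYPE('i) (word_metric K S') (c0 / 2) k D"
    unfolding matrix_localization_def K.mspace_word_metric[OF S'] K.mdist_word_metric[OF S']
  proof (intro allI impI, elim conjE)
    fix I :: "'i set" and p t u
    assume I: "finite I" and p: "p ` I \<subseteq> carrier K"
      and t: "\<forall>i\<in>I. \<forall>j\<in>I. t i j \<noteq> 0 \<longrightarrow> word_dist K S' (p i) (p j) \<le> real k"
      and tu: "0 < sqnorm I (mat_vec I t u)"
    have pK: "p i \<in> carrier K" if "i \<in> I" for i using p that by blast
    have tk: "dist (p i) (p j) \<le> k" if "i \<in> I" "j \<in> I" "t i j \<noteq> 0" for i j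
      using t that by (simp add: word_dist_eq pK)
    let ?f = "\<lambda>i. (cmod (mat_vec I t u i))\<^sup>2"
    define T where "T = sqnorm I (mat_vec I t u)"
    define U where "U = sqnorm I u"
    have T0: "0 < T" using tu by (simp add: T_def)
    \<comment> \<open>Exchanging the sums: each index is dropped for at most half of the parameters,
      so some parameter drops at most half of the mass of \<open>t u\<close>.\<close>
    have "\<exists>\<eta>\<in>\<Theta>. (\<Sum>i\<in>{i\<in>I. c \<eta> (p i) = None}. ?f i) \<le> T / 2"
    proof (rule ccontr)
      assume "\<not> ?thesis"
      then have "(\<Sum>\<eta>\<in>\<Theta>. T / 2) < (\<Sum>\<eta>\<in>\<Theta>. \<Sum>i\<in>{i\<in>I. c \<eta> (p i) = None}. ?f i)"
        using \<Theta> by (intro sum_strict_mono) auto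
      also have "\<dots> = (\<Sum>i\<in>I. \<Sum>\<eta>\<in>{\<eta>\<in>\<Theta>. c \<eta> (p i) = None}. ?f i)"
        by (rule sum.swap_restrict[OF \<Theta>(1) I])
      also have "\<dots> \<le> (\<Sum>i\<in>I. card \<Theta> / 2 * ?f i)"
      proof (rule sum_mono)
        fix i assume "i \<in> I"
        then have "real (2 * card {\<eta> \<in> \<Theta>. c \<eta> (p i) = None}) \<le> real (card \<Theta>)"
          using half pK by (simp only: of_nat_le_iff)
        then have "real (card {\<eta> \<in> \<Theta>. c \<eta> (p i) = None}) * ?f i \<le> card \<Theta> / 2 * ?f i"
          by (intro mult_right_mono) auto
        then show "(\<Sum>\<eta>\<in>{\<eta>\<in>\<Theta>. c \<eta> (p i) = None}. ?f i) \<le> card \<Theta> / 2 * ?f i" by simp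
      qed
      also have "\<dots> = card \<Theta> / 2 * T" by (simp add: T_def sqnorm_def sum_distrib_left)
      finally show False by simp
    qed
    then obtain \<eta> where \<eta>: "\<eta> \<in> \<Theta>" "(\<Sum>i\<in>{i\<in>I. c \<eta> (p i) = None}. ?f i) \<le> T / 2" by blast
    \<comment> \<open>\<open>\<Omega> w\<close> collects the outputs assigned to the vertex
      \<open>w\<close>, and \<open>J w\<close> contains all inputs that influence them.\<close>
    define \<Omega> where "\<Omega> w = {i\<in>I. c \<eta> (p i) = Some w}" for w
    define J where "J w = {j\<in>I. \<exists>i\<in>\<Omega> w. dist (p i) (p j) \<le> k}" for w
    define W where "W = {w. \<exists>i\<in>I. c \<eta> (p i) = Some w}"
    have "W \<subseteq> (\<lambda>i. the (c \<eta> (p i))) ` I" unfolding W_def by force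
    then have W: "finite W" using I by (meson finite_surj)
    have fin: "finite (\<Omega> w)" "finite (J w)" for w using I by (auto simp: \<Omega>_def J_def)
    have disjJ: "w = w'" if jJ: "j \<in> J w" "j \<in> J w'" for j w w'
    proof -
      obtain i i' where i: "i \<in> \<Omega> w" "dist (p i) (p j) \<le> k" "i' \<in> \<Omega> w'" "dist (p i') (p j) \<le> k"
        "j \<in> I" using jJ unfolding J_def by blast
      have K: "p i \<in> carrier K" "p i' \<in> carrier K" "p j \<in> carrier K" using i pK by (auto simp: \<Omega>_def)
      have "dist (p i) (p i') \<le> 2 * k"
        using dist_triangle[OF K(1,3,2)] dist_commute[OF K(2,3)] i by linarith
      then show ?thesis using sep \<eta>(1) K(1,2) i by (simp add: \<Omega>_def)
    qed
    have "(\<Union>w\<in>W. \<Omega> w) = {i\<in>I. c \<eta> (p i) \<noteq> None}" by (auto simp: W_def \<Omega>_def)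
    then have "(\<Sum>w\<in>W. sqnorm (\<Omega> w) (mat_vec I t u)) = (\<Sum>i\<in>{i\<in>I. c \<eta> (p i) \<noteq> None}. ?f i)"
      unfolding sqnorm_def
      by (subst sum.UNION_disjoint[symmetric]) (use W fin in \<open>auto simp: \<Omega>_def\<close>)
    also have "\<dots> = T - (\<Sum>i\<in>{i\<in>I. c \<eta> (p i) = None}. ?f i)"
    proof -
      have "{i\<in>I. c \<eta> (p i) \<noteq> None} = I - {i\<in>I. c \<eta> (p i) = None}" by auto
      then show ?thesis unfolding T_def sqnorm_def using I by (simp add: sum_diff)
    qed
    finally have sumA: "T / 2 \<le> (\<Sum>w\<in>W. sqnorm (\<Omega> w) (mat_vec I t u))" using \<eta>(2) by linarith
    have "(\<Sum>w\<in>W. sqnorm (J w) u) = (\<Sum>j\<in>(\<Union>w\<in>W. J w). (cmod (u j))\<^sup>2)"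
      unfolding sqnorm_def by (rule sum.UNION_disjoint[symmetric]) (use W fin disjJ in blast)+
    also have "\<dots> \<le> U" unfolding U_def sqnorm_def by (rule sum_mono2[OF I]) (auto simp: J_def)
    finally have sumB: "(\<Sum>w\<in>W. sqnorm (J w) u) \<le> U" .
    have r0: "0 < T / 2" using T0 by simp
    have "\<exists>w\<in>W. 0 < sqnorm (\<Omega> w) (mat_vec I t u) \<and>
      T / 2 * sqnorm (J w) u \<le> sqnorm (\<Omega> w) (mat_vec I t u) * U"
      by (rule sum_ratio_pigeonhole[OF W _ _ _ r0 sumA sumB]) (auto simp: U_def)
    then obtain w where w: "w \<in> W" "0 < sqnorm (\<Omega> w) (mat_vec I t u)"
      "T / 2 * sqnorm (J w) u \<le> sqnorm (\<Omega> w) (mat_vec I t u) * U" by blast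
    define uw where "uw j = (if j \<in> J w then u j else 0)" for j
    define Iw where "Iw = {i\<in>I. near (L + k) (p i) w}"
    have Iw: "finite Iw" "Iw \<subseteq> I" using I by (auto simp: Iw_def)
    have \<Omega>_near: "near L (p i) w" if "i \<in> \<Omega> w" for i
      using near \<eta>(1) pK that by (auto simp: \<Omega>_def)
    have \<Omega>Iw: "\<Omega> w \<subseteq> Iw" using near_mono[OF \<Omega>_near] by (auto simp: Iw_def \<Omega>_def)
    have JIw: "J w \<subseteq> Iw"
    proof
      fix j assume "j \<in> J w"
      then obtain i where i: "i \<in> \<Omega> w" "dist (p i) (p j) \<le> k" "j \<in> I" by (auto simp: J_def)
      then have "near (dist (p i) (p j) + L) (p j) w"
        using near_dist[OF pK pK \<Omega>_near] by (auto simp: \<Omega>_def)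
      then show "j \<in> Iw" using near_mono i by (auto simp: Iw_def)
    qed
    have "\<Omega> w \<noteq> {}"
    proof
      assume "\<Omega> w = {}"
      with w(2) show False by (simp add: sqnorm_def)
    qed
    then obtain i0 where i0: "i0 \<in> \<Omega> w" by blast
    obtain g0 where g0: "g0 \<in> carrier K" "vertex g0 = w"
      using \<Omega>_near[OF i0] by (auto simp: near_def)
    have "\<exists>h. h \<in> carrier G \<and> dist (p i) (g0 \<otimes>\<^bsub>K\<^esub> incl h) \<le> L + k" if iI: "i \<in> Iw" for i
    proof -
      obtain Z where Z: "Z \<in> carrier K" "vertex Z = w" "dist (p i) Z \<le> L + k"
        using iI by (auto simp: Iw_def near_def)
      have e: "vertex g0 = vertex Z" using g0(2) Z(2) by simp
      obtain h where "h \<in> carrier G" "Z = g0 \<otimes>\<^bsub>K\<^esub> incl h"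
        using vertex_eq_imp_same_coset[OF g0(1) Z(1) e] .
      then show ?thesis using Z(3) by blast
    qed
    \<comment> \<open>Each index is moved to a nearby point of the coset of \<open>g0\<close>, which
      is identified with \<open>G\<close>. Several indices may receive the same point, as the
      multiplicities allow.\<close>
    then obtain q where q: "\<And>i. i \<in> Iw \<Longrightarrow> q i \<in> carrier G"
      "\<And>i. i \<in> Iw \<Longrightarrow> dist (p i) (g0 \<otimes>\<^bsub>K\<^esub> incl (q i)) \<le> L + k" by metis
    define z where "z i = g0 \<otimes>\<^bsub>K\<^esub> incl (q i)" for i
    have zK: "z i \<in> carrier K" if "i \<in> Iw" for i
      unfolding z_def using g0(1) incl_closed[OF q(1)[OF that]] by simp
    have pz: "dist (p i) (z i) \<le> L + k" if "i \<in> Iw" for i using q(2)[OF that] by (simp add: z_def)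
    have zz: "dist (z i) (z j) = word_length K S' (incl (inv (q i) \<otimes> q j))" if "i \<in> Iw" "j \<in> Iw" for i j
      unfolding z_def by (rule dist_translate_incl[OF g0(1) q(1)[OF that(1)] q(1)[OF that(2)]])
    have qq: "word_dist G S (q i) (q j) = real (word_length G S (inv (q i) \<otimes> q j))"
      if "i \<in> Iw" "j \<in> Iw" for i j using q(1) that by (simp add: word_dist_def)
    have cond: "word_dist G S (q i) (q j) \<le> real kG" if ij: "i \<in> Iw" "j \<in> Iw" and tn: "t i j \<noteq> 0" for i j
    proof -
      have I2: "i \<in> I" "j \<in> I" using ij Iw(2) by auto
      have K: "p i \<in> carrier K" "p j \<in> carrier K" using pK I2 by auto
      have d: "dist (p i) (p j) \<le> k" by (rule tk[OF I2 tn])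
      have zp: "dist (z i) (p i) \<le> L + k"
        using pz[OF ij(1)] dist_commute[OF zK[OF ij(1)] K(1)] by simp
      have "dist (z i) (z j) \<le> dist (z i) (p i) + dist (p i) (z j)"
        by (rule dist_triangle[OF zK[OF ij(1)] K(1) zK[OF ij(2)]])
      moreover have "dist (p i) (z j) \<le> dist (p i) (p j) + dist (p j) (z j)"
        by (rule dist_triangle[OF K zK[OF ij(2)]])
      ultimately have "dist (z i) (z j) \<le> (L + k) + (k + (L + k))"
        using d zp pz[OF ij(2)] by linarith
      then have "dist (z i) (z j) \<le> n" by (simp add: n_def)
      then show ?thesis using kG q(1) ij by (simp add: zz qq)
    qed
    \<comment> \<open>Rows in \<open>\<Omega> w\<close> have nonzero entries only in columns from
      \<open>J w\<close>, so cutting \<open>u\<close> down to \<open>J w\<close> preserves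
      \<open>t u\<close> there.\<close>
    have mv: "mat_vec Iw t uw i = mat_vec I t u i" if "i \<in> \<Omega> w" for i
    proof -
      have "mat_vec Iw t uw i = (\<Sum>j\<in>I. t i j * uw j)"
        unfolding mat_vec_def using JIw by (intro sum.mono_neutral_left[OF I Iw(2)]) (auto simp: uw_def)
      also have "\<dots> = mat_vec I t u i"
        unfolding mat_vec_def
      proof (intro sum.cong HOL.refl)
        fix j assume "j \<in> I"
        then show "t i j * uw j = t i j * u j"
          using tk[of i j] that by (cases "t i j = 0") (auto simp: uw_def J_def \<Omega>_def)
      qed
      finally show ?thesis .
    qed
    have a_le: "sqnorm (\<Omega> w) (mat_vec I t u) \<le> sqnorm Iw (mat_vec Iw t uw)"
    proof -
      have "sqnorm (\<Omega> w) (mat_vec I t u) = sqnorm (\<Omega> w) (mat_vec Iw t uw)"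
        unfolding sqnorm_def using mv by simp
      also have "\<dots> \<le> sqnorm Iw (mat_vec Iw t uw)" by (rule sqnorm_mono[OF Iw(1) \<Omega>Iw])
      finally show ?thesis .
    qed
    have b_eq: "sqnorm Iw uw = sqnorm (J w) u"
    proof -
      have "sqnorm (J w) uw = sqnorm Iw uw"
        unfolding sqnorm_def by (rule sum.mono_neutral_left[OF Iw(1) JIw]) (auto simp: uw_def)
      moreover have "sqnorm (J w) uw = sqnorm (J w) u" unfolding sqnorm_def by (simp add: uw_def)
      ultimately show ?thesis by simp
    qed
    have pos: "0 < sqnorm Iw (mat_vec Iw t uw)" using a_le w(2) by linarith
    have qc: "q ` Iw \<subseteq> carrier G" using q(1) by blast
    obtain v where v: "0 < sqnorm Iw v"
      "\<forall>i\<in>Iw. \<forall>j\<in>Iw. v i \<noteq> 0 \<and> v j \<noteq> 0 \<longrightarrow> word_dist G S (q i) (q j) \<le> real DG"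
      "c0 * sqnorm Iw (mat_vec Iw t uw) * sqnorm Iw v \<le> sqnorm Iw (mat_vec Iw t v) * sqnorm Iw uw"
      using DG[unfolded matrix_localization_def mspace_word_metric[OF S] mdist_word_metric[OF S],
          rule_format, of Iw q t uw] Iw(1) qc cond pos by blast
    \<comment> \<open>Extension by zero keeps the norm of the vector, and the additional rows can
      only increase that of its image.\<close>
    define v' where "v' i = (if i \<in> Iw then v i else 0)" for i
    have sv: "sqnorm I v' = sqnorm Iw v"
    proof -
      have "sqnorm Iw v' = sqnorm I v'"
        unfolding sqnorm_def by (rule sum.mono_neutral_left[OF I Iw(2)]) (auto simp: v'_def)
      then show ?thesis unfolding sqnorm_def by (simp add: v'_def)
    qed
    have mv': "mat_vec I t v' i = mat_vec Iw t v i" for i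
    proof -
      have "(\<Sum>j\<in>Iw. t i j * v' j) = mat_vec I t v' i"
        unfolding mat_vec_def by (rule sum.mono_neutral_left[OF I Iw(2)]) (auto simp: v'_def)
      then show ?thesis unfolding mat_vec_def by (simp add: v'_def)
    qed
    define V where "V = sqnorm I v'"
    define TV where "TV = sqnorm I (mat_vec I t v')"
    have V0: "0 < V" using v(1) by (simp add: V_def sv)
    have "sqnorm Iw (mat_vec Iw t v) = sqnorm Iw (mat_vec I t v')" by (simp add: sqnorm_def mv')
    also have "\<dots> \<le> TV" unfolding TV_def by (rule sqnorm_mono[OF I Iw(2)])
    finally have TVge: "sqnorm Iw (mat_vec Iw t v) \<le> TV" .
    let ?a = "sqnorm (\<Omega> w) (mat_vec I t u)" and ?b = "sqnorm (J w) u"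
    have "c0 * ?a * V \<le> c0 * sqnorm Iw (mat_vec Iw t uw) * sqnorm Iw v"
      unfolding V_def sv using a_le c0 by (intro mult_right_mono mult_left_mono) auto
    also have "\<dots> \<le> sqnorm Iw (mat_vec Iw t v) * ?b" using v(3) by (simp add: b_eq)
    also have "\<dots> \<le> TV * ?b" using TVge by (intro mult_right_mono) auto
    finally have m1: "c0 * ?a * V \<le> TV * ?b" .
    \<comment> \<open>The estimate itself forces \<open>?b\<close> to be positive, so that it can be
      cancelled at the end.\<close>
    have "0 < c0 * ?a * V" using c0 w(2) V0 by simp
    then have "0 < TV * ?b" using m1 by linarith
    then have "?b \<noteq> 0" by auto
    then have b0: "0 < ?b" using sqnorm_nonneg[of "J w" u] by linarith
    have U0: "0 \<le> U" by (simp add: U_def)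
    have "(c0 / 2 * T * V) * ?b = c0 * V * (T / 2 * ?b)" by simp
    also have "\<dots> \<le> c0 * V * (?a * U)" using w(3) c0 V0 by (intro mult_left_mono) auto
    also have "\<dots> = (c0 * ?a * V) * U" by (simp add: ac_simps)
    also have "\<dots> \<le> (TV * ?b) * U" by (rule mult_right_mono[OF m1 U0])
    also have "\<dots> = (TV * U) * ?b" by (simp add: ac_simps)
    finally have main: "c0 / 2 * T * V \<le> TV * U" using b0 by (rule mult_right_le_imp_le)
    have diam: "word_dist K S' (p i) (p j) \<le> real D" if "i \<in> I" "j \<in> I" "v' i \<noteq> 0" "v' j \<noteq> 0" for i j
    proof -
      have ij: "i \<in> Iw" "j \<in> Iw" "v i \<noteq> 0" "v j \<noteq> 0" using that by (auto simp: v'_def split: if_splits)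
      have K: "p i \<in> carrier K" "p j \<in> carrier K" using that pK by auto
      have "word_length G S (inv (q i) \<otimes> q j) \<le> DG" using v(2) ij qq by simp
      then have "dist (z i) (z j) \<le> E" using E q(1) ij by (simp add: zz)
      moreover have "dist (p i) (p j) \<le> dist (p i) (z i) + dist (z i) (p j)"
        by (rule dist_triangle[OF K(1) zK[OF ij(1)] K(2)])
      moreover have "dist (z i) (p j) \<le> dist (z i) (z j) + dist (z j) (p j)"
        by (rule dist_triangle[OF zK[OF ij(1)] zK[OF ij(2)] K(2)])
      moreover have "dist (z j) (p j) \<le> L + k"
        using pz[OF ij(2)] dist_commute[OF zK[OF ij(2)] K(2)] by simp
      ultimately have "dist (p i) (p j) \<le> (L + k) + (E + (L + k))"
        using pz[OF ij(1)] by linarith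
      then have "dist (p i) (p j) \<le> D" by (simp add: D_def)
      then show ?thesis by (simp add: word_dist_eq K)
    qed
    show "\<exists>v. 0 < sqnorm I v \<and>
        (\<forall>i\<in>I. \<forall>j\<in>I. v i \<noteq> 0 \<and> v j \<noteq> 0 \<longrightarrow> word_dist K S' (p i) (p j) \<le> real D) \<and>
        c0 / 2 * sqnorm I (mat_vec I t u) * sqnorm I v \<le> sqnorm I (mat_vec I t v) * sqnorm I u"
      using V0 diam main unfolding V_def T_def TV_def U_def by blast
  qed
  then show ?thesis by blast
qed

end

theorem corollary5p4:
  fixes G :: "('a, 'b) monoid_scheme"
    and A S :: "'a set"
    and \<theta> :: "'a \<Rightarrow> 'a"
    and S' :: "'a hnn_letter list set set"
  assumes "\<not> (\<exists>B :: 'h::{complex_hilbert_space, second_countable_topology} set.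
                finite B \<and> span B = UNIV)"
    and "group G"
    and "finite_generating_set G S"
    and "subgroup A G"
    and "\<theta> \<in> mon (G\<lparr>carrier := A\<rparr>) G"
    and "finite_generating_set (HNN G A \<theta>) S'"
    and "operator_norm_localization TYPE('h) (word_metric G S)"
  shows "operator_norm_localization TYPE('h) (word_metric (HNN G A \<theta>) S')"
proof -
  interpret G: group G by fact
  interpret hnn_word G A \<theta> S'
    by (intro hnn_word.intro hnn_extension.intro hnn_extension_axioms.intro hnn_word_axioms.intro assms)
  \<comment> \<open>The index type is dictated by the way back to operators: elements of the HNN
    extension paired with vectors of \<open>H\<close>.\<close>
  obtain c where c: "0 < c"
    "\<forall>k. \<exists>D. matrix_localization TYPE('a hnn_letter list set \<times> 'h) (word_metric G S) c k D"
    using operator_norm_localization_imp_matrix_localization[OF assms(1)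
        G.word_metric_discrete[OF assms(3)] assms(7)] by blast
  have "span {} \<noteq> (UNIV :: 'h set)" using assms(1) by blast
  then obtain h :: 'h where "h \<noteq> 0" by auto
  then show ?thesis
    using matrix_localization_hnn[OF assms(3) c] c(1)
    by (intro matrix_localization_imp_operator_norm_localization[where c = "c / 2" and h = h]
        K.word_metric_discrete[OF S']) (auto simp: K.mspace_word_metric[OF S'] K.countable_carrier[OF S'])
qed

end
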